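(* Let $M,N\ge 0$ be integers with $2M+N\ge 2$, let $L=\langle a_1,\dots,a_M,b_1,\dots,b_N\mid b_1^2,\dots,b_N^2\rangle$ with generating set $X=\{a_1^{\pm1},\dots,a_M^{\pm1},b_1,\dots,b_N\}$, and let $G$ be a group with finite symmetric generating set $Y$. Let $\tilde\sigma^{B^{\neq e'}}_{(G\wr L,\vec Y)}(z)$ be the contribution to the conjugacy growth series of $(G\wr L,\vec Y)$ of the conjugacy classes of elements $(\eta,b)$ whose cursor $b$ is non-trivial and of finite order. Then $$\tilde\sigma^{B^{\neq e'}}_{(G\wr L,\vec Y)}(z)=N\,z\,\tilde\sigma_{(G,Y)}(z)\,\Bigl(F_{\mathscr T}\bigl(z^2\tilde\sigma_{(G,Y)}(z),\,z^2(\tilde\sigma_{(G,Y)}(z)-1)\bigr)\Bigr)^{2M+N-1}.$$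
   Context: Wreath product. $e,e'$ are the neutral elements of $G,L$. $G\wr L=\bigl(\bigoplus_{i\in L}G\bigr)\rtimes L$ with product $(\eta,m)(\theta,n)=(\eta\theta^m,mn)$, where $\theta^m(i)=\theta(m^{-1}i)$. For $(\eta,b)\in G\wr L$, the element $b\in L$ is called the cursor. For $g\in G$, $\vec g\in\bigoplus_{i\in L}G$ has value $g$ at $e'$ and $e$ elsewhere. The generating set is $\vec Y=\{(\vec e,x):x\in X\}\cup\{(\vec y,e'):y\in Y\}$. Growth series. For a group $H$ with finite symmetric generating set $Z$, $|h|_Z$ is the word length. The length of a conjugacy class is the minimum of $|h|_Z$ over its elements $h$; the conjugacy growth series $\tilde\sigma_{(H,Z)}(z)$ has as coefficient of $z^n$ the number of conjugacy classes of $H$ of length $n$. The contribution of a family of conjugacy classes is the power series whose coefficient of $z^n$ is the number of classes in the family of length $n$. The series $F_{\mathscr T}$. The Cayley graph $\mathrm{Cay}(L,X)$ is the $(2M+N)$-regular tree. Fix $v\in X$ and let $\mathscr T$ be the set of all finite subtrees of $\mathrm{Cay}(L,X)$ containing $e'$ and containing no vertex adjacent to $e'$ other than possibly $v$. A leaf of a finite tree is a vertex of valence $0$ or $1$ in it. Then $F_{\mathscr T}(x,y)=\sum_{i,j\ge0}a_{ij}x^iy^j$, where $a_{ij}$ is the number of $T\in\mathscr T$ with exactly $i$ non-leaves and exactly $j$ leaves other than $e'$. This does not depend on $v$, and it satisfies $F_{\mathscr T}(x,y)=1+y-x+xF_{\mathscr T}(x,y)^{2M+N-1}$. *)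

theory Defs
  imports
    "HOL-Algebra.Product_Groups"
    "HOL-Algebra.Group_Action"
    "HOL-Computational_Algebra.Formal_Power_Series"
begin

section \<open>Group presentations\<close>

text \<open>
  Words are lists of signed letters: \<open>(True, s)\<close> stands for the generator \<open>s\<close> and
  \<open>(False, s)\<close> for its formal inverse. The group presented by \<open>\<langle>S | R\<rangle>\<close> consists of the words
  over \<open>S\<close> modulo the congruence generated by free cancellation and by \<open>r = 1\<close> for \<open>r \<in> R\<close>.
\<close>

type_synonym 's word = "(bool \<times> 's) list"

abbreviation words_over :: "'s set \<Rightarrow> 's word set" where
  "words_over S \<equiv> lists (UNIV \<times> S)"

inductive_set word_equiv :: "'s set \<Rightarrow> 's word set \<Rightarrow> ('s word \<times> 's word) set"
  for S :: "'s set" and R :: "'s word set" where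
  refl: "w \<in> words_over S \<Longrightarrow> (w, w) \<in> word_equiv S R"
| sym: "(u, w) \<in> word_equiv S R \<Longrightarrow> (w, u) \<in> word_equiv S R"
| trans: "(u, v) \<in> word_equiv S R \<Longrightarrow> (v, w) \<in> word_equiv S R \<Longrightarrow> (u, w) \<in> word_equiv S R"
| cancel: "u \<in> words_over S \<Longrightarrow> w \<in> words_over S \<Longrightarrow> s \<in> S \<Longrightarrow>
    (u @ [(p, s), (\<not> p, s)] @ w, u @ w) \<in> word_equiv S R"
| relator: "u \<in> words_over S \<Longrightarrow> w \<in> words_over S \<Longrightarrow> r \<in> R \<inter> words_over S \<Longrightarrow>
    (u @ r @ w, u @ w) \<in> word_equiv S R"

definition presented_group :: "'s set \<Rightarrow> 's word set \<Rightarrow> 's word set monoid" where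
  "presented_group S R =
    \<lparr>carrier = words_over S // word_equiv S R,
     monoid.mult = (\<lambda>A B. \<Union>u\<in>A. \<Union>w\<in>B. word_equiv S R `` {u @ w}),
     monoid.one = word_equiv S R `` {[]}\<rparr>"

definition generator :: "'s set \<Rightarrow> 's word set \<Rightarrow> 's \<Rightarrow> 's word set" where
  "generator S R s = word_equiv S R `` {[(True, s)]}"

text \<open>
  \<open>L = \<langle>a\<^sub>1, \<dots>, a\<^sub>M, b\<^sub>1, \<dots>, b\<^sub>N | b\<^sub>1\<^sup>2, \<dots>, b\<^sub>N\<^sup>2\<rangle>\<close>, with indices shifted to start at \<open>0\<close>:
  \<open>Inl i\<close> is the letter \<open>a\<close> with index \<open>i + 1\<close>, and \<open>Inr j\<close> is the letter \<open>b\<close> with index \<open>j + 1\<close>.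
\<close>

definition L_letters :: "nat \<Rightarrow> nat \<Rightarrow> (nat + nat) set" where
  "L_letters M N = {..<M} <+> {..<N}"

definition L_relators :: "nat \<Rightarrow> (nat + nat) word set" where
  "L_relators N = {[(True, Inr j), (True, Inr j)] | j. j < N}"

definition L_group :: "nat \<Rightarrow> nat \<Rightarrow> (nat + nat) word set monoid" where
  "L_group M N = presented_group (L_letters M N) (L_relators N)"

definition L_gens :: "nat \<Rightarrow> nat \<Rightarrow> (nat + nat) word set set" where
  "L_gens M N =
    (let gen = generator (L_letters M N) (L_relators N) in
      {gen (Inl i) | i. i < M} \<union> {inv\<^bsub>L_group M N\<^esub> (gen (Inl i)) | i. i < M} \<union>
      {gen (Inr j) | j. j < N})"

section \<open>Word length and conjugacy growth\<close>

definition finite_symmetric_generating_set :: "('a, 'c) monoid_scheme \<Rightarrow> 'a set \<Rightarrow> bool" where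
  "finite_symmetric_generating_set H Z \<longleftrightarrow>
    finite Z \<and> Z \<subseteq> carrier H \<and> (\<forall>z\<in>Z. inv\<^bsub>H\<^esub> z \<in> Z) \<and> generate H Z = carrier H"

definition word_length :: "('a, 'c) monoid_scheme \<Rightarrow> 'a set \<Rightarrow> 'a \<Rightarrow> nat" where
  "word_length H Z h =
    (LEAST n. \<exists>zs \<in> lists Z. length zs = n \<and> foldr (\<otimes>\<^bsub>H\<^esub>) zs \<one>\<^bsub>H\<^esub> = h)"

definition conj_class :: "('a, 'c) monoid_scheme \<Rightarrow> 'a \<Rightarrow> 'a set" where
  "conj_class H = orbit H (\<lambda>g. \<lambda>h \<in> carrier H. g \<otimes>\<^bsub>H\<^esub> h \<otimes>\<^bsub>H\<^esub> inv\<^bsub>H\<^esub> g)"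

definition class_length :: "('a, 'c) monoid_scheme \<Rightarrow> 'a set \<Rightarrow> 'a set \<Rightarrow> nat" where
  "class_length H Z C = (INF h\<in>C. word_length H Z h)"

text \<open>
  The coefficients are genuine cardinalities: \<open>Z\<close> being finite, only finitely many conjugacy
  classes have a given length.
\<close>

definition class_contribution :: "('a, 'c) monoid_scheme \<Rightarrow> 'a set \<Rightarrow> 'a set set \<Rightarrow> int fps" where
  "class_contribution H Z \<C> = Abs_fps (\<lambda>n. int (card {C \<in> \<C>. class_length H Z C = n}))"

definition conj_growth_series :: "('a, 'c) monoid_scheme \<Rightarrow> 'a set \<Rightarrow> int fps" where
  "conj_growth_series H Z = class_contribution H Z (conj_class H ` carrier H)"

section \<open>Wreath products\<close>

definition translate :: "('l, 'd) monoid_scheme \<Rightarrow> 'l \<Rightarrow> ('l \<Rightarrow> 'g) \<Rightarrow> 'l \<Rightarrow> 'g" where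
  "translate L m \<theta> = (\<lambda>i \<in> carrier L. \<theta> (inv\<^bsub>L\<^esub> m \<otimes>\<^bsub>L\<^esub> i))"

definition wreath_product ::
    "('g, 'c) monoid_scheme \<Rightarrow> ('l, 'd) monoid_scheme \<Rightarrow> (('l \<Rightarrow> 'g) \<times> 'l) monoid" where
  "wreath_product G L =
    (let B = sum_group (carrier L) (\<lambda>_. G) in
      \<lparr>carrier = carrier B \<times> carrier L,
       monoid.mult = (\<lambda>(\<eta>, m) (\<theta>, n). (\<eta> \<otimes>\<^bsub>B\<^esub> translate L m \<theta>, m \<otimes>\<^bsub>L\<^esub> n)),
       monoid.one = (\<one>\<^bsub>B\<^esub>, \<one>\<^bsub>L\<^esub>)\<rparr>)"

definition lamp :: "('g, 'c) monoid_scheme \<Rightarrow> ('l, 'd) monoid_scheme \<Rightarrow> 'g \<Rightarrow> 'l \<Rightarrow> 'g" where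
  "lamp G L g = (\<lambda>i \<in> carrier L. if i = \<one>\<^bsub>L\<^esub> then g else \<one>\<^bsub>G\<^esub>)"

definition wreath_gens :: "('g, 'c) monoid_scheme \<Rightarrow> ('l, 'd) monoid_scheme \<Rightarrow>
    'l set \<Rightarrow> 'g set \<Rightarrow> (('l \<Rightarrow> 'g) \<times> 'l) set" where
  "wreath_gens G L X Y =
    {(lamp G L \<one>\<^bsub>G\<^esub>, x) | x. x \<in> X} \<union> {(lamp G L y, \<one>\<^bsub>L\<^esub>) | y. y \<in> Y}"

definition nontrivial_torsion_cursor_classes ::
    "('g, 'c) monoid_scheme \<Rightarrow> ('l, 'd) monoid_scheme \<Rightarrow> (('l \<Rightarrow> 'g) \<times> 'l) set set" where
  "nontrivial_torsion_cursor_classes G L =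
    conj_class (wreath_product G L) `
      {(\<eta>, b) \<in> carrier (wreath_product G L).
         b \<noteq> \<one>\<^bsub>L\<^esub> \<and> (\<exists>n::nat. n > 0 \<and> b [^]\<^bsub>L\<^esub> n = \<one>\<^bsub>L\<^esub>)}"

section \<open>Subtrees of Cayley graphs\<close>

text \<open>Graphs are undirected and simple: a vertex set and a set of two-element edges.\<close>

type_synonym 'v ugraph = "'v set \<times> 'v set set"

definition cayley_graph :: "('l, 'd) monoid_scheme \<Rightarrow> 'l set \<Rightarrow> 'l ugraph" where
  "cayley_graph L X = (carrier L, {{g, g \<otimes>\<^bsub>L\<^esub> x} | g x. g \<in> carrier L \<and> x \<in> X})"

definition subgraph :: "'v ugraph \<Rightarrow> 'v ugraph \<Rightarrow> bool" where
  "subgraph T \<Gamma> \<longleftrightarrow>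
    fst T \<subseteq> fst \<Gamma> \<and> snd T \<subseteq> snd \<Gamma> \<and> (\<forall>d \<in> snd T. d \<subseteq> fst T)"

definition graph_connected :: "'v ugraph \<Rightarrow> bool" where
  "graph_connected T \<longleftrightarrow>
    fst T \<noteq> {} \<and> (\<forall>u \<in> fst T. \<forall>w \<in> fst T. (u, w) \<in> {(p, q). {p, q} \<in> snd T}\<^sup>*)"

definition graph_cycle :: "'v ugraph \<Rightarrow> 'v list \<Rightarrow> bool" where
  "graph_cycle T ps \<longleftrightarrow>
    length ps \<ge> 3 \<and> distinct ps \<and> set ps \<subseteq> fst T \<and>
    (\<forall>i. Suc i < length ps \<longrightarrow> {ps ! i, ps ! Suc i} \<in> snd T) \<and> {last ps, hd ps} \<in> snd T"

definition is_tree :: "'v ugraph \<Rightarrow> bool" where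
  "is_tree T \<longleftrightarrow> graph_connected T \<and> (\<nexists>ps. graph_cycle T ps)"

definition valence :: "'v ugraph \<Rightarrow> 'v \<Rightarrow> nat" where
  "valence T u = card {d \<in> snd T. u \<in> d}"

definition leaves :: "'v ugraph \<Rightarrow> 'v set" where
  "leaves T = {u \<in> fst T. valence T u \<le> 1}"

definition rooted_subtrees :: "('l, 'd) monoid_scheme \<Rightarrow> 'l set \<Rightarrow> 'l \<Rightarrow> 'l ugraph set" where
  "rooted_subtrees L X v =
    {T. subgraph T (cayley_graph L X) \<and> finite (fst T) \<and> is_tree T \<and> \<one>\<^bsub>L\<^esub> \<in> fst T \<and>
        (\<forall>u \<in> fst T. {\<one>\<^bsub>L\<^esub>, u} \<in> snd (cayley_graph L X) \<longrightarrow> u = v)}"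

text \<open>
  A series in two variables \<open>x\<close>, \<open>y\<close> is an element of \<open>\<int>[[y]][[x]]\<close>, so that the coefficient
  of \<open>x\<^sup>i y\<^sup>j\<close> is \<open>fps_nth (fps_nth F i) j\<close>.
\<close>

definition subtree_series ::
    "('l, 'd) monoid_scheme \<Rightarrow> 'l set \<Rightarrow> 'l \<Rightarrow> int fps fps" where
  "subtree_series L X v = Abs_fps (\<lambda>i. Abs_fps (\<lambda>j.
     int (card {T \<in> rooted_subtrees L X v.
       card (fst T - leaves T) = i \<and> card (leaves T - {\<one>\<^bsub>L\<^esub>}) = j})))"

text \<open>
  Substitution \<open>F(p, q)\<close> for \<open>p\<close>, \<open>q\<close> without constant term. As with \<^const>\<open>fps_compose\<close>, the
  sum may be cut off: the terms with \<open>i > n\<close> or \<open>j > n\<close> do not contribute to the \<open>n\<close>-th coefficient.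
\<close>

definition fps_subst2 :: "'a::comm_ring_1 fps fps \<Rightarrow> 'a fps \<Rightarrow> 'a fps \<Rightarrow> 'a fps" where
  "fps_subst2 F p q = Abs_fps (\<lambda>n.
     \<Sum>i\<le>n. \<Sum>j\<le>n. fps_nth (fps_nth F i) j * fps_nth (p ^ i * q ^ j) n)"

end

theory Submission
  imports Defs
begin

text \<open>
  Nontrivial elements of finite order in \<open>L\<close> are conjugate to letters \<open>b\<close> with \<open>b = b\<^sup>-\<^sup>1\<close>, of which
  there are \<open>N\<close>; different letters of this kind are not conjugate, and only \<open>\<one>\<close> and \<open>b\<close> commute with \<open>b\<close>
  (\<open>torsion_conjugate_to_involution\<close>, \<open>involution_conjugacy\<close>). So it suffices to consider the
  elements \<open>(\<eta>, b)\<close> for each such \<open>b\<close>. Left multiplication by \<open>b\<close> pairs the places \<open>i\<close> and \<open>b i\<close>.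
  Conjugation by lamps can change \<open>\<eta> i\<close> and \<open>\<eta> (b i)\<close> in any way that preserves the conjugacy
  class of the product \<open>\<eta> i \<eta> (b i)\<close>, and conjugation by \<open>b\<close> exchanges the two places, which does
  not affect this class either. The classes with cursor \<open>b\<close> therefore correspond to the finitely
  supported assignments of conjugacy classes of \<open>G\<close> to the pairs \<open>{i, b i}\<close>
  (\<open>coloured_trees_classes\<close>).

  The pairs are the vertices of the quotient of the Cayley graph by \<open>b\<close>, which is a tree rooted at
  \<open>{\<one>, b}\<close>, with \<open>card X - 1\<close> edges at the root and a loop in place of the edge from \<open>\<one>\<close> to \<open>b\<close>.
  The cursor of a word for an element of the class follows a closed walk in the quotient that uses
  the loop and visits all places with a nontrivial class. A shortest such walk passes twice through
  each edge of the smallest subtree \<open>T\<close> that contains the root and these places, and once through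
  the loop. The letters of the word that are not steps pay for the lamps. Hence the length of the
  class is \<open>1 + 2 (card T - 1)\<close> plus the lengths of the assigned classes of \<open>G\<close>
  (\<open>class_length_lit_le\<close>, \<open>class_length_lit_ge\<close>).

  For fixed \<open>T\<close>, summing over the assignments gives the factor \<open>z\<close> for the loop, \<open>\<sigma>\<close> for the root,
  and for every other vertex \<open>z\<^sup>2 \<sigma>\<close>, or \<open>z\<^sup>2 (\<sigma> - 1)\<close> if the vertex is a leaf, because the class at a
  leaf cannot be trivial when \<open>T\<close> is smallest. The tree \<open>T\<close> consists of independent trees along
  the \<open>card X - 1\<close> edges at the root, so the sum over \<open>T\<close> is a product of \<open>card X - 1\<close> series. Each
  of them is the series of the subtrees growing in one direction, and they all agree, because they
  satisfy a recursion that does not distinguish directions and has a unique solution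
  (\<open>branch_series_indep\<close>).
\<close>

section \<open>Sums of infinite families of formal power series\<close>

definition summable_family :: "'s set \<Rightarrow> ('s \<Rightarrow> int fps) \<Rightarrow> bool" where
  "summable_family S w \<longleftrightarrow> (\<forall>n. finite {s \<in> S. fps_nth (w s) n \<noteq> 0})"

text \<open>
  Only the families in which each coefficient is hit finitely often have a meaningful sum; for
  those the sum below is the limit of the finite partial sums. With all weights powers of
  \<^term>\<open>fps_X\<close> it is the generating function of \<open>S\<close> by the exponent.
\<close>

definition formal_sum :: "'s set \<Rightarrow> ('s \<Rightarrow> int fps) \<Rightarrow> int fps" where
  "formal_sum S w = Abs_fps (\<lambda>n. \<Sum>s | s \<in> S \<and> fps_nth (w s) n \<noteq> 0. fps_nth (w s) n)"

lemma formal_sum_nth: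
  assumes "finite A" "A \<subseteq> S" "\<And>s. s \<in> S \<Longrightarrow> fps_nth (w s) n \<noteq> 0 \<Longrightarrow> s \<in> A"
  shows "fps_nth (formal_sum S w) n = (\<Sum>s\<in>A. fps_nth (w s) n)"
  unfolding formal_sum_def fps_nth_Abs_fps
  by (rule sum.mono_neutral_left) (use assms in auto)

lemma formal_sum_cong:
  assumes "\<And>s. s \<in> S \<Longrightarrow> w s = w' s"
  shows "formal_sum S w = formal_sum S w'"
proof -
  have "{s. s \<in> S \<and> fps_nth (w s) n \<noteq> 0} = {s. s \<in> S \<and> fps_nth (w' s) n \<noteq> 0}" for n
    using assms by auto
  thus ?thesis unfolding formal_sum_def using assms by (auto simp: fps_eq_iff intro!: sum.cong)
qed

lemma formal_sum_finite:
  assumes "finite S"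
  shows "formal_sum S w = (\<Sum>s\<in>S. w s)"
  using assms by (simp add: fps_eq_iff fps_sum_nth formal_sum_nth[of S])

lemma summable_family_finite: "finite S \<Longrightarrow> summable_family S w"
  by (simp add: summable_family_def)

lemma summable_family_subset:
  "summable_family S w \<Longrightarrow> S' \<subseteq> S \<Longrightarrow> summable_family S' w"
  unfolding summable_family_def by (blast intro: finite_subset[rotated])

lemma summable_family_cong:
  assumes "\<And>s. s \<in> S \<Longrightarrow> w s = w' s"
  shows "summable_family S w \<longleftrightarrow> summable_family S w'"
proof -
  have "{s. s \<in> S \<and> fps_nth (w s) n \<noteq> 0} = {s. s \<in> S \<and> fps_nth (w' s) n \<noteq> 0}" for n
    using assms by auto
  thus ?thesis unfolding summable_family_def by auto
qed

lemma formal_sum_bij: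
  assumes "bij_betw h S T" and "\<And>s. s \<in> S \<Longrightarrow> w s = w' (h s)"
  shows "formal_sum S w = formal_sum T w'"
proof (rule fps_ext)
  fix n
  have "bij_betw h {s. s \<in> S \<and> fps_nth (w s) n \<noteq> 0} {t. t \<in> T \<and> fps_nth (w' t) n \<noteq> 0}"
    using assms unfolding bij_betw_def by (auto simp: inj_on_def)
  from sum.reindex_bij_betw[OF this, of "\<lambda>t. fps_nth (w' t) n"]
  show "fps_nth (formal_sum S w) n = fps_nth (formal_sum T w') n"
    unfolding formal_sum_def by (simp add: assms(2))
qed

lemma summable_family_bij:
  assumes "bij_betw h S T" and "\<And>s. s \<in> S \<Longrightarrow> w s = w' (h s)"
  shows "summable_family S w \<longleftrightarrow> summable_family T w'"
proof -
  have "bij_betw h {s. s \<in> S \<and> fps_nth (w s) n \<noteq> 0} {t. t \<in> T \<and> fps_nth (w' t) n \<noteq> 0}" for n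
    using assms unfolding bij_betw_def by (auto simp: inj_on_def)
  thus ?thesis unfolding summable_family_def using bij_betw_finite by blast
qed

lemma formal_sum_Sigma:
  assumes "summable_family (Sigma A B) (\<lambda>(a, b). w a b)"
  shows "formal_sum (Sigma A B) (\<lambda>(a, b). w a b) = formal_sum A (\<lambda>a. formal_sum (B a) (w a))"
proof (rule fps_ext)
  fix n
  define U where "U = {s \<in> Sigma A B. fps_nth (case s of (a, b) \<Rightarrow> w a b) n \<noteq> 0}"
  define B' where "B' a = {b \<in> B a. fps_nth (w a b) n \<noteq> 0}" for a
  have fU: "finite U" using assms unfolding summable_family_def U_def by blast
  have U: "U = Sigma (fst ` U) B'"
    unfolding U_def B'_def by force
  have fst_U: "fst ` U \<subseteq> A" unfolding U_def by auto
  have fB: "finite (B' a)" if "a \<in> A" for a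
    by (rule finite_subset[OF _ finite_imageI[OF fU, of snd]]) (use that in \<open>force simp: U_def B'_def\<close>)
  have inner: "fps_nth (formal_sum (B a) (w a)) n = (\<Sum>b\<in>B' a. fps_nth (w a b) n)" if "a \<in> A" for a
    by (rule formal_sum_nth) (use fB[OF that] in \<open>auto simp: B'_def\<close>)
  have "fps_nth (formal_sum (Sigma A B) (\<lambda>(a, b). w a b)) n
      = (\<Sum>s\<in>U. fps_nth (case s of (a, b) \<Rightarrow> w a b) n)"
    by (rule formal_sum_nth) (use fU in \<open>auto simp: U_def\<close>)
  also have "\<dots> = (\<Sum>(a, b)\<in>Sigma (fst ` U) B'. fps_nth (w a b) n)"
    using U by (intro sum.cong) auto
  also have "\<dots> = (\<Sum>a\<in>fst ` U. \<Sum>b\<in>B' a. fps_nth (w a b) n)"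
    by (rule sum.Sigma[symmetric]) (use fU fB fst_U in auto)
  also have "\<dots> = (\<Sum>a\<in>fst ` U. fps_nth (formal_sum (B a) (w a)) n)"
    using fst_U by (intro sum.cong) (auto simp: inner)
  also have "\<dots> = fps_nth (formal_sum A (\<lambda>a. formal_sum (B a) (w a))) n"
  proof (rule formal_sum_nth[symmetric])
    fix a assume a: "a \<in> A" "fps_nth (formal_sum (B a) (w a)) n \<noteq> 0"
    with inner have "B' a \<noteq> {}" by auto
    thus "a \<in> fst ` U" using a(1) unfolding U_def B'_def by force
  qed (use fU fst_U in auto)
  finally show "fps_nth (formal_sum (Sigma A B) (\<lambda>(a, b). w a b)) n
    = fps_nth (formal_sum A (\<lambda>a. formal_sum (B a) (w a))) n" .
qed

lemma summable_family_Sigma_finite: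
  assumes "finite A" "\<And>a. a \<in> A \<Longrightarrow> summable_family (B a) (w a)"
  shows "summable_family (Sigma A B) (\<lambda>(a, b). w a b)"
  unfolding summable_family_def
proof
  fix n
  have "{s \<in> Sigma A B. fps_nth (case s of (a, b) \<Rightarrow> w a b) n \<noteq> 0}
      = Sigma A (\<lambda>a. {b \<in> B a. fps_nth (w a b) n \<noteq> 0})" by auto
  thus "finite {s \<in> Sigma A B. fps_nth (case s of (a, b) \<Rightarrow> w a b) n \<noteq> 0}"
    using assms unfolding summable_family_def by simp
qed

lemma formal_sum_Un_disjoint:
  assumes "summable_family A w" "summable_family B w" "A \<inter> B = {}"
  shows "formal_sum (A \<union> B) w = formal_sum A w + formal_sum B w"
proof (rule fps_ext)
  fix n
  have "{s. s \<in> A \<union> B \<and> fps_nth (w s) n \<noteq> 0}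
    = {s. s \<in> A \<and> fps_nth (w s) n \<noteq> 0} \<union> {s. s \<in> B \<and> fps_nth (w s) n \<noteq> 0}" by auto
  moreover have "finite {s. s \<in> A \<and> fps_nth (w s) n \<noteq> 0}" "finite {s. s \<in> B \<and> fps_nth (w s) n \<noteq> 0}"
    using assms(1,2) unfolding summable_family_def by auto
  ultimately show "fps_nth (formal_sum (A \<union> B) w) n = fps_nth (formal_sum A w + formal_sum B w) n"
    unfolding formal_sum_def using assms(3) by (auto intro!: sum.union_disjoint)
qed

lemma
  assumes "summable_family A w" "summable_family B w'"
  shows summable_family_times: "summable_family (A \<times> B) (\<lambda>(a, b). w a * w' b)"
    and formal_sum_times: "formal_sum (A \<times> B) (\<lambda>(a, b). w a * w' b) = formal_sum A w * formal_sum B w'"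
proof -
  \<comment> \<open>The coefficient of degree \<open>n\<close> of a product involves only the coefficients of degree at most \<open>n\<close>.\<close>
  define S where "S k = {s \<in> A. fps_nth (w s) k \<noteq> 0}" for k
  define T where "T k = {s \<in> B. fps_nth (w' s) k \<noteq> 0}" for k
  define SS where "SS n = (\<Union>k\<le>n. S k)" for n
  define TT where "TT n = (\<Union>k\<le>n. T k)" for n
  have fin: "finite (SS n)" "finite (TT n)" for n
    using assms unfolding summable_family_def S_def T_def SS_def TT_def by auto
  have sub: "SS n \<subseteq> A" "TT n \<subseteq> B" for n unfolding SS_def TT_def S_def T_def by auto
  have supp: "a \<in> SS n \<and> b \<in> TT n" if "a \<in> A" "b \<in> B" "fps_nth (w a * w' b) n \<noteq> 0" for a b n
  proof -
    have "\<exists>k\<in>{0..n}. fps_nth (w a) k * fps_nth (w' b) (n - k) \<noteq> 0"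
    proof (rule ccontr)
      assume "\<not> ?thesis"
      hence "fps_nth (w a * w' b) n = 0" unfolding fps_mult_nth by (intro sum.neutral) auto
      thus False using that by simp
    qed
    then obtain k where "k \<le> n" "fps_nth (w a) k \<noteq> 0" "fps_nth (w' b) (n - k) \<noteq> 0" by auto
    moreover have "n - k \<le> n" by simp
    ultimately show ?thesis unfolding SS_def TT_def S_def T_def using that by blast
  qed
  show "summable_family (A \<times> B) (\<lambda>(a, b). w a * w' b)"
    unfolding summable_family_def
  proof
    fix n
    show "finite {s \<in> A \<times> B. fps_nth (case s of (a, b) \<Rightarrow> w a * w' b) n \<noteq> 0}"
      by (rule finite_subset[of _ "SS n \<times> TT n"]) (use fin supp in auto)
  qed
  show "formal_sum (A \<times> B) (\<lambda>(a, b). w a * w' b) = formal_sum A w * formal_sum B w'"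
  proof (rule fps_ext)
    fix n
    have c1: "fps_nth (formal_sum A w) k = (\<Sum>a\<in>SS n. fps_nth (w a) k)" if "k \<le> n" for k
      by (rule formal_sum_nth) (use fin sub that in \<open>auto simp: SS_def S_def\<close>)
    have c2: "fps_nth (formal_sum B w') k = (\<Sum>a\<in>TT n. fps_nth (w' a) k)" if "k \<le> n" for k
      by (rule formal_sum_nth) (use fin sub that in \<open>auto simp: TT_def T_def\<close>)
    have "fps_nth (formal_sum (A \<times> B) (\<lambda>(a, b). w a * w' b)) n
        = (\<Sum>s\<in>SS n \<times> TT n. fps_nth (case s of (a, b) \<Rightarrow> w a * w' b) n)"
    proof (rule formal_sum_nth)
      show "SS n \<times> TT n \<subseteq> A \<times> B" using sub by (intro Sigma_mono)
      fix s assume "s \<in> A \<times> B" "fps_nth (case s of (a, b) \<Rightarrow> w a * w' b) n \<noteq> 0"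
      thus "s \<in> SS n \<times> TT n" using supp[of "fst s" "snd s" n] by (cases s) simp
    qed (simp add: fin)
    also have "\<dots> = (\<Sum>a\<in>SS n. \<Sum>b\<in>TT n. fps_nth (w a * w' b) n)"
      by (simp add: sum.cartesian_product case_prod_unfold)
    also have "\<dots> = (\<Sum>a\<in>SS n. \<Sum>b\<in>TT n. \<Sum>k=0..n. fps_nth (w a) k * fps_nth (w' b) (n - k))"
      by (simp add: fps_mult_nth)
    also have "\<dots> = (\<Sum>k=0..n. (\<Sum>a\<in>SS n. fps_nth (w a) k) * (\<Sum>b\<in>TT n. fps_nth (w' b) (n - k)))"
      unfolding sum_product by (simp add: sum.swap[of _ "{0..n}"])
    also have "\<dots> = fps_nth (formal_sum A w * formal_sum B w') n"
      unfolding fps_mult_nth by (intro sum.cong) (auto simp: c1 c2)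
    finally show "fps_nth (formal_sum (A \<times> B) (\<lambda>(a, b). w a * w' b)) n
      = fps_nth (formal_sum A w * formal_sum B w') n" .
  qed
qed

lemma
  assumes "summable_family S w"
  shows summable_family_cmult: "summable_family S (\<lambda>s. c * w s)"
    and formal_sum_cmult: "formal_sum S (\<lambda>s. c * w s) = c * formal_sum S w"
proof -
  have bij: "bij_betw (\<lambda>s. ((), s)) S ({()} \<times> S)"
    by (auto simp: bij_betw_def inj_on_def)
  note f = summable_family_finite[of "{()}" "\<lambda>_. c"]
  show "summable_family S (\<lambda>s. c * w s)"
    using summable_family_times[OF f assms] summable_family_bij[OF bij, of "\<lambda>s. c * w s" "\<lambda>(a, b). c * w b"]
    by simp
  show "formal_sum S (\<lambda>s. c * w s) = c * formal_sum S w"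
    using formal_sum_times[OF f assms] formal_sum_bij[OF bij, of "\<lambda>s. c * w s" "\<lambda>(a, b). c * w b"]
      formal_sum_finite[of "{()}" "\<lambda>_. c"]
    by simp
qed

text \<open>
  A product of finitely many sums is the sum over all simultaneous choices of one term in each;
  this is how independent choices at the vertices, or along the branches, of a tree are counted.
\<close>

lemma
  assumes "finite I" and "\<And>i. i \<in> I \<Longrightarrow> summable_family (B i) (w i)"
  shows summable_family_PiE: "summable_family (PiE I B) (\<lambda>f. \<Prod>i\<in>I. w i (f i))"
    and formal_sum_PiE: "formal_sum (PiE I B) (\<lambda>f. \<Prod>i\<in>I. w i (f i)) = (\<Prod>i\<in>I. formal_sum (B i) (w i))"
proof -
  have "summable_family (PiE I B) (\<lambda>f. \<Prod>i\<in>I. w i (f i)) \<and>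
    formal_sum (PiE I B) (\<lambda>f. \<Prod>i\<in>I. w i (f i)) = (\<Prod>i\<in>I. formal_sum (B i) (w i))"
    using assms
  proof (induction I rule: finite_induct)
    case empty
    show ?case by (simp add: formal_sum_finite summable_family_finite)
  next
    case (insert i I)
    define h where "h = (\<lambda>(y, g :: 'a \<Rightarrow> 'b). g(i := y))"
    have bij: "bij_betw h (B i \<times> PiE I B) (PiE (insert i I) B)"
      unfolding bij_betw_def h_def using inj_combinator[OF insert.hyps(2), of B]
      by (simp add: PiE_insert_eq)
    have w: "(case s of (a, g) \<Rightarrow> w i a * (\<Prod>j\<in>I. w j (g j))) = (\<Prod>j\<in>insert i I. w j (h s j))"
      if "s \<in> B i \<times> PiE I B" for s
    proof -
      obtain a g where s: "s = (a, g)" by (cases s)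
      have "(\<Prod>j\<in>I. w j ((g(i := a)) j)) = (\<Prod>j\<in>I. w j (g j))"
        using insert.hyps(2) by (intro prod.cong) auto
      thus ?thesis using insert.hyps by (simp add: s h_def)
    qed
    have IH: "summable_family (PiE I B) (\<lambda>f. \<Prod>j\<in>I. w j (f j))"
      "formal_sum (PiE I B) (\<lambda>f. \<Prod>j\<in>I. w j (f j)) = (\<Prod>j\<in>I. formal_sum (B j) (w j))"
      using insert.IH insert.prems by auto
    have Bi: "summable_family (B i) (w i)" using insert.prems by simp
    show ?case
      using summable_family_bij[OF bij, where w' = "\<lambda>f. \<Prod>j\<in>insert i I. w j (f j)", OF w]
        formal_sum_bij[OF bij, where w' = "\<lambda>f. \<Prod>j\<in>insert i I. w j (f j)", OF w]
        summable_family_times[OF Bi IH(1)] formal_sum_times[OF Bi IH(1)] IH(2) insert.hyps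
      by simp
  qed
  thus "summable_family (PiE I B) (\<lambda>f. \<Prod>i\<in>I. w i (f i))"
    and "formal_sum (PiE I B) (\<lambda>f. \<Prod>i\<in>I. w i (f i)) = (\<Prod>i\<in>I. formal_sum (B i) (w i))" by auto
qed

text \<open>
  If infinitely many classes had the same length \<open>n\<close>, both sides would have \<open>0\<close> as coefficient of
  degree \<open>n\<close>: the cardinality of an infinite set and a sum over it are \<open>0\<close>.
\<close>

lemma class_contribution_eq_formal_sum:
  assumes "bij_betw h S \<C>" and "\<And>s. s \<in> S \<Longrightarrow> class_length H Z (h s) = l s"
  shows "class_contribution H Z \<C> = formal_sum S (\<lambda>s. fps_X ^ l s)"
proof (rule fps_ext)
  fix n
  have "bij_betw h {s \<in> S. l s = n} {C \<in> \<C>. class_length H Z C = n}"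
    by (rule bij_betw_Collect[OF assms(1)]) (simp add: assms(2))
  hence "card {C \<in> \<C>. class_length H Z C = n} = card {s \<in> S. l s = n}"
    by (rule bij_betw_same_card[symmetric])
  moreover have "fps_nth (formal_sum S (\<lambda>s. fps_X ^ l s)) n = (\<Sum>s\<in>{s \<in> S. l s = n}. 1)"
    unfolding formal_sum_def fps_nth_Abs_fps
    by (rule sum.cong) (auto simp: fps_X_power_nth)
  ultimately show "fps_nth (class_contribution H Z \<C>) n = fps_nth (formal_sum S (\<lambda>s. fps_X ^ l s)) n"
    unfolding class_contribution_def by simp
qed

text \<open>
  If the coefficient of \<open>x\<^sup>i y\<^sup>j\<close> counts the members of \<open>S\<close> with \<open>a s = i\<close> and \<open>b s = j\<close>, then
  substituting amounts to adding up the monomials of the members. The cut-off in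
  \<^const>\<open>fps_subst2\<close> is harmless because \<open>p\<^sup>i q\<^sup>j\<close> has no terms of degree below \<open>i + j\<close>.
\<close>

lemma fps_subst2_eq_formal_sum:
  assumes fin: "\<And>i j. finite {s \<in> S. a s = i \<and> b s = j}"
    and F: "\<And>i j. fps_nth (fps_nth F i) j = int (card {s \<in> S. a s = i \<and> b s = j})"
    and ord: "\<And>n i j. n < i + j \<Longrightarrow> fps_nth (p ^ i * q ^ j) n = 0"
  shows "fps_subst2 F p q = formal_sum S (\<lambda>s. p ^ a s * q ^ b s)"
    and "summable_family S (\<lambda>s. p ^ a s * q ^ b s)"
proof -
  define U where "U n = (\<Union>i\<in>{..n}. \<Union>j\<in>{..n}. {s \<in> S. a s = i \<and> b s = j})" for n
  have fU: "finite (U n)" for n unfolding U_def using fin by auto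
  have U: "U n = {s \<in> S. a s \<le> n \<and> b s \<le> n}" for n unfolding U_def by auto
  have inU: "s \<in> U n" if "s \<in> S" "fps_nth (p ^ a s * q ^ b s) n \<noteq> 0" for s n
    using ord[of n "a s" "b s"] that unfolding U by (cases "n < a s + b s") auto
  show "summable_family S (\<lambda>s. p ^ a s * q ^ b s)"
    unfolding summable_family_def
  proof
    fix n show "finite {s \<in> S. fps_nth (p ^ a s * q ^ b s) n \<noteq> 0}"
      by (rule finite_subset[OF _ fU[of n]]) (use inU in auto)
  qed
  show "fps_subst2 F p q = formal_sum S (\<lambda>s. p ^ a s * q ^ b s)"
  proof (rule fps_ext)
    fix n
    let ?S = "\<lambda>i j. {s \<in> S. a s = i \<and> b s = j}"
    have "fps_nth (fps_subst2 F p q) n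
        = (\<Sum>i\<le>n. \<Sum>j\<le>n. int (card (?S i j)) * fps_nth (p ^ i * q ^ j) n)"
      by (simp add: fps_subst2_def F)
    also have "\<dots> = (\<Sum>i\<le>n. \<Sum>j\<le>n. \<Sum>s\<in>?S i j. fps_nth (p ^ a s * q ^ b s) n)"
      by (intro sum.cong) auto
    also have "\<dots> = (\<Sum>i\<le>n. \<Sum>s\<in>(\<Union>j\<in>{..n}. ?S i j). fps_nth (p ^ a s * q ^ b s) n)"
      by (intro sum.cong sum.UNION_disjoint[symmetric]) (auto intro: fin)
    also have "\<dots> = (\<Sum>s\<in>U n. fps_nth (p ^ a s * q ^ b s) n)"
      unfolding U_def by (intro sum.UNION_disjoint[symmetric]) (auto intro: fin)
    also have "\<dots> = fps_nth (formal_sum S (\<lambda>s. p ^ a s * q ^ b s)) n"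
      by (rule formal_sum_nth[symmetric]) (use fU inU in \<open>auto simp: U\<close>)
    finally show "fps_nth (fps_subst2 F p q) n = fps_nth (formal_sum S (\<lambda>s. p ^ a s * q ^ b s)) n" .
  qed
qed

section \<open>Word length and conjugacy classes\<close>

lemma word_length_le:
  assumes "zs \<in> lists Z" "foldr (\<otimes>\<^bsub>H\<^esub>) zs \<one>\<^bsub>H\<^esub> = h"
  shows "word_length H Z h \<le> length zs"
  unfolding word_length_def by (rule Least_le) (use assms in auto)

lemma word_length_attained:
  assumes "\<exists>zs \<in> lists Z. foldr (\<otimes>\<^bsub>H\<^esub>) zs \<one>\<^bsub>H\<^esub> = h"
  obtains zs where "zs \<in> lists Z" "foldr (\<otimes>\<^bsub>H\<^esub>) zs \<one>\<^bsub>H\<^esub> = h" "length zs = word_length H Z h"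
proof -
  have "\<exists>n. \<exists>zs \<in> lists Z. length zs = n \<and> foldr (\<otimes>\<^bsub>H\<^esub>) zs \<one>\<^bsub>H\<^esub> = h" using assms by blast
  from LeastI_ex[OF this] show ?thesis using that unfolding word_length_def by blast
qed

lemma class_length_le: "h \<in> C \<Longrightarrow> class_length H Z C \<le> word_length H Z h"
  unfolding class_length_def by (rule cINF_lower) auto

lemma class_length_attained:
  assumes "C \<noteq> {}"
  obtains h where "h \<in> C" "word_length H Z h = class_length H Z C"
proof -
  have "class_length H Z C \<in> word_length H Z ` C"
    unfolding class_length_def by (rule Inf_nat_def1) (use assms in auto)
  thus ?thesis using that by auto
qed

context group
begin

abbreviation ev :: "'a list \<Rightarrow> 'a" where "ev zs \<equiv> foldr (\<otimes>) zs \<one>"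

abbreviation conj_classes :: "'a set set" where "conj_classes \<equiv> conj_class G ` carrier G"

lemma foldr_mult_closed [simp]:
  "zs \<in> lists (carrier G) \<Longrightarrow> ev zs \<in> carrier G"
  by (induction zs) auto

lemma foldr_mult_append:
  "xs \<in> lists (carrier G) \<Longrightarrow> ys \<in> lists (carrier G) \<Longrightarrow>
    ev (xs @ ys) = ev xs \<otimes> ev ys"
  by (induction xs) (auto simp: m_assoc)

lemma word_length_mult_le:
  assumes "Z \<subseteq> carrier G"
    and "\<exists>zs \<in> lists Z. ev zs = g" "\<exists>zs \<in> lists Z. ev zs = h"
  shows "word_length G Z (g \<otimes> h) \<le> word_length G Z g + word_length G Z h"
proof -
  obtain xs where xs: "xs \<in> lists Z" "ev xs = g" "length xs = word_length G Z g"
    using word_length_attained[OF assms(2)] by blast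
  obtain ys where ys: "ys \<in> lists Z" "ev ys = h" "length ys = word_length G Z h"
    using word_length_attained[OF assms(3)] by blast
  have "xs \<in> lists (carrier G)" "ys \<in> lists (carrier G)" using xs ys assms(1) by auto
  hence "word_length G Z (g \<otimes> h) \<le> length (xs @ ys)"
    by (intro word_length_le) (use xs ys in \<open>auto simp: foldr_mult_append simp del: foldr_append\<close>)
  thus ?thesis using xs ys by simp
qed

text \<open>
  A bound on the word length that includes the existence of a word; \<^const>\<open>word_length\<close> itself is an
  unspecified number for elements without a word.
\<close>

definition spells :: "'a set \<Rightarrow> nat \<Rightarrow> 'a \<Rightarrow> bool" where
  "spells Z n h \<longleftrightarrow> (\<exists>zs \<in> lists Z. length zs \<le> n \<and> ev zs = h)"

lemma spells_mult:
  assumes "Z \<subseteq> carrier G" "spells Z m g" "spells Z n h"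
  shows "spells Z (m + n) (g \<otimes> h)"
proof -
  obtain xs where xs: "xs \<in> lists Z" "length xs \<le> m" "ev xs = g"
    using assms(2) unfolding spells_def by blast
  obtain ys where ys: "ys \<in> lists Z" "length ys \<le> n" "ev ys = h"
    using assms(3) unfolding spells_def by blast
  have l: "xs \<in> lists (carrier G)" "ys \<in> lists (carrier G)" using xs(1) ys(1) assms(1) by auto
  have "ev (xs @ ys) = g \<otimes> h" using foldr_mult_append[OF l] by (simp only: xs(3) ys(3))
  moreover have "xs @ ys \<in> lists Z" "length (xs @ ys) \<le> m + n" using xs ys by auto
  ultimately show ?thesis unfolding spells_def by blast
qed

lemma spells_gen: "z \<in> Z \<Longrightarrow> Z \<subseteq> carrier G \<Longrightarrow> spells Z 1 z"
  unfolding spells_def by (rule bexI[of _ "[z]"]) auto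

lemma word_length_le_spells: "spells Z n h \<Longrightarrow> word_length G Z h \<le> n"
  unfolding spells_def by (elim bexE conjE) (rule order_trans[OF word_length_le])

lemma word_length_one [simp]: "word_length G Z \<one> = 0"
  using word_length_le[of "[]" Z G \<one>] by simp

lemma generating_set_spells:
  assumes "finite_symmetric_generating_set G Z" "g \<in> carrier G"
  shows "\<exists>zs \<in> lists Z. ev zs = g"
proof -
  have Z: "Z \<subseteq> carrier G" "\<And>z. z \<in> Z \<Longrightarrow> inv z \<in> Z" "generate G Z = carrier G"
    using assms(1) unfolding finite_symmetric_generating_set_def by auto
  have "g \<in> generate G Z" using assms Z by simp
  thus ?thesis
  proof (induction rule: generate.induct)
    case one
    show ?case by (rule bexI[of _ "[]"]) auto
  next
    case (incl h)
    show ?case by (rule bexI[of _ "[h]"]) (use incl Z in auto)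
  next
    case (inv h)
    have "inv h \<in> carrier G" using inv Z by auto
    thus ?case using inv Z by (intro bexI[of _ "[inv h]"]) auto
  next
    case (eng h1 h2)
    then obtain xs ys where "xs \<in> lists Z" "ev xs = h1" "ys \<in> lists Z" "ev ys = h2"
      by blast
    moreover from this Z have "xs \<in> lists (carrier G)" "ys \<in> lists (carrier G)" by auto
    ultimately show ?case by (intro bexI[of _ "xs @ ys"]) (auto simp: foldr_mult_append simp del: foldr_append)
  qed
qed

lemma inv_mult_cancel [simp]:
  assumes "x \<in> carrier G" "y \<in> carrier G"
  shows "inv x \<otimes> (x \<otimes> y) = y" "x \<otimes> (inv x \<otimes> y) = y"
  using assms by (simp_all add: m_assoc[symmetric])

lemma conj_class_eq:
  "h \<in> carrier G \<Longrightarrow> conj_class G h = {g \<otimes> h \<otimes> inv g | g. g \<in> carrier G}"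
  unfolding conj_class_def orbit_def by auto

lemma conj_class_refl: "h \<in> carrier G \<Longrightarrow> h \<in> conj_class G h"
  by (auto simp: conj_class_eq intro!: exI[of _ \<one>])

lemma conj_class_eqI:
  assumes "h \<in> carrier G" "g \<in> carrier G"
  shows "conj_class G (g \<otimes> h \<otimes> inv g) = conj_class G h"
proof -
  have "k \<otimes> (g \<otimes> h \<otimes> inv g) \<otimes> inv k = (k \<otimes> g) \<otimes> h \<otimes> inv (k \<otimes> g)" if "k \<in> carrier G" for k
    using that assms by (simp add: inv_mult_group m_assoc)
  moreover have "k \<otimes> h \<otimes> inv k = (k \<otimes> inv g) \<otimes> (g \<otimes> h \<otimes> inv g) \<otimes> inv (k \<otimes> inv g)"
    if "k \<in> carrier G" for k
    using that assms by (simp add: inv_mult_group m_assoc)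
  ultimately have "{k \<otimes> (g \<otimes> h \<otimes> inv g) \<otimes> inv k | k. k \<in> carrier G}
      = {k \<otimes> h \<otimes> inv k | k. k \<in> carrier G}"
    using assms by (intro equalityI subsetI; clarify) (metis m_closed inv_closed)+
  thus ?thesis using assms by (simp add: conj_class_eq)
qed

lemma conj_class_eq_iff:
  assumes "h \<in> carrier G" "h' \<in> carrier G"
  shows "conj_class G h' = conj_class G h \<longleftrightarrow> (\<exists>g \<in> carrier G. h' = g \<otimes> h \<otimes> inv g)"
proof
  assume "conj_class G h' = conj_class G h"
  hence "h' \<in> conj_class G h" using conj_class_refl[OF assms(2)] by simp
  thus "\<exists>g \<in> carrier G. h' = g \<otimes> h \<otimes> inv g" using assms by (auto simp: conj_class_eq)
qed (use assms conj_class_eqI in auto)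

text \<open>
  In this form conjugacy can be checked in a wreath product without computing inverses there.
\<close>

lemma conj_class_eq_iff_intertwine:
  assumes "h \<in> carrier G" "h' \<in> carrier G"
  shows "conj_class G h' = conj_class G h \<longleftrightarrow> (\<exists>g \<in> carrier G. h' \<otimes> g = g \<otimes> h)"
proof -
  have "h' = g \<otimes> h \<otimes> inv g \<longleftrightarrow> h' \<otimes> g = g \<otimes> h" if "g \<in> carrier G" for g
    using that assms inv_solve_right[of h' "g \<otimes> h" g] by auto
  thus ?thesis using conj_class_eq_iff[OF assms] by blast
qed

lemma conj_class_mem:
  assumes "C \<in> conj_classes" "h \<in> C"
  shows "h \<in> carrier G" "conj_class G h = C"
proof -
  obtain k where k: "k \<in> carrier G" "C = conj_class G k" using assms by auto
  then obtain g where "g \<in> carrier G" "h = g \<otimes> k \<otimes> inv g" using assms by (auto simp: conj_class_eq)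
  thus "h \<in> carrier G" "conj_class G h = C" using k conj_class_eqI by auto
qed

lemma conj_class_commute:
  assumes "g \<in> carrier G" "h \<in> carrier G"
  shows "conj_class G (g \<otimes> h) = conj_class G (h \<otimes> g)"
proof -
  have "g \<otimes> h = g \<otimes> (h \<otimes> g) \<otimes> inv g" using assms by (simp add: m_assoc)
  thus ?thesis using conj_class_eqI[of "h \<otimes> g" g] assms by simp
qed

lemma conj_class_one: "conj_class G \<one> = {\<one>}"
  using conj_class_refl[OF one_closed] by (auto simp: conj_class_eq)

lemma conj_class_eq_one_iff:
  "h \<in> carrier G \<Longrightarrow> conj_class G h = {\<one>} \<longleftrightarrow> h = \<one>"
  using conj_class_one conj_class_refl by auto

lemma class_length_eq_0_iff:
  assumes "finite_symmetric_generating_set G Z" "C \<in> conj_classes"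
  shows "class_length G Z C = 0 \<longleftrightarrow> C = {\<one>}"
proof
  assume "class_length G Z C = 0"
  moreover have "C \<noteq> {}" using assms(2) conj_class_refl by auto
  ultimately obtain h where h: "h \<in> C" "word_length G Z h = 0"
    by (metis class_length_attained)
  have "h \<in> carrier G" using h assms(2) conj_class_mem by blast
  then obtain zs where "ev zs = h" "length zs = word_length G Z h"
    using word_length_attained[OF generating_set_spells[OF assms(1)]] by metis
  hence "h = \<one>" using h by simp
  thus "C = {\<one>}" using h assms(2) conj_class_mem conj_class_one by blast
next
  assume "C = {\<one>}"
  thus "class_length G Z C = 0" using class_length_le[of \<one> C G Z] by simp
qed

lemma finite_classes_of_length:
  assumes "finite_symmetric_generating_set G Z"
  shows "finite {C \<in> conj_classes. class_length G Z C = n}"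
proof (rule finite_subset)
  have "finite Z" using assms by (simp add: finite_symmetric_generating_set_def)
  thus "finite ((\<lambda>zs. conj_class G (ev zs)) ` {zs. set zs \<subseteq> Z \<and> length zs = n})"
    by (intro finite_imageI finite_lists_length_eq)
  show "{C \<in> conj_classes. class_length G Z C = n}
    \<subseteq> (\<lambda>zs. conj_class G (ev zs)) ` {zs. set zs \<subseteq> Z \<and> length zs = n}"
  proof
    fix C assume "C \<in> {C \<in> conj_classes. class_length G Z C = n}"
    hence C: "C \<in> conj_classes" "class_length G Z C = n" by auto
    have "C \<noteq> {}" using C(1) conj_class_refl by auto
    then obtain h where h: "h \<in> C" "word_length G Z h = n"
      using C by (metis class_length_attained)
    have hc: "h \<in> carrier G" "conj_class G h = C" using conj_class_mem[OF C(1) h(1)] by auto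
    then obtain zs where "zs \<in> lists Z" "ev zs = h" "length zs = n"
      using word_length_attained[OF generating_set_spells[OF assms]] h by metis
    thus "C \<in> (\<lambda>zs. conj_class G (ev zs)) ` {zs. set zs \<subseteq> Z \<and> length zs = n}"
      using hc by (intro image_eqI[of _ _ zs]) auto
  qed
qed

text \<open>
  The class of \<open>\<one>\<close> is the only one of length \<open>0\<close>, so leaving it out subtracts \<open>1\<close>.
\<close>

lemma
  assumes "finite_symmetric_generating_set G Z"
  shows summable_classes: "summable_family conj_classes (\<lambda>C. fps_X ^ class_length G Z C)"
    and formal_sum_classes:
      "formal_sum conj_classes (\<lambda>C. fps_X ^ class_length G Z C) = conj_growth_series G Z"
    and formal_sum_nontrivial_classes:
      "formal_sum (conj_classes - {{\<one>}}) (\<lambda>C. fps_X ^ class_length G Z C)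
        = conj_growth_series G Z - 1"
proof -
  let ?C = conj_classes and ?w = "\<lambda>C. fps_X ^ class_length G Z C :: int fps"
  have "{C \<in> ?C. fps_nth (?w C) n \<noteq> 0} = {C \<in> ?C. class_length G Z C = n}" for n
    by (auto simp: fps_X_power_nth)
  thus summ: "summable_family ?C ?w"
    unfolding summable_family_def using finite_classes_of_length[OF assms] by simp
  show tot: "formal_sum ?C ?w = conj_growth_series G Z"
    unfolding conj_growth_series_def
    by (rule class_contribution_eq_formal_sum[symmetric, where h = id]) auto
  have 1: "{\<one>} \<in> ?C" using conj_class_one one_closed by (metis imageI)
  have "formal_sum ((?C - {{\<one>}}) \<union> {{\<one>}}) ?w = formal_sum (?C - {{\<one>}}) ?w + formal_sum {{\<one>}} ?w"
  proof (rule formal_sum_Un_disjoint)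
    show "summable_family (?C - {{\<one>}}) ?w" by (rule summable_family_subset[OF summ]) blast
  qed (auto intro: summable_family_finite)
  moreover have "(?C - {{\<one>}}) \<union> {{\<one>}} = ?C" using 1 by blast
  moreover have "formal_sum {{\<one>}} ?w = 1"
    using class_length_eq_0_iff[OF assms 1] by (simp add: formal_sum_finite)
  ultimately show "formal_sum (?C - {{\<one>}}) ?w = conj_growth_series G Z - 1" using tot by simp
qed

end

section \<open>Rooted trees as prefix-closed sets of reduced words\<close>

definition reduced_words :: "('a \<Rightarrow> 'a) \<Rightarrow> 'a set \<Rightarrow> 'a list set" where
  "reduced_words \<iota> X = {w \<in> lists X. successively (\<lambda>x y. y \<noteq> \<iota> x) w}"

text \<open>
  A vertex is represented by the reduced word along the path to it from the root, where \<open>\<iota>\<close> is the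
  inversion of letters. The tree may only use the edges in \<open>S\<close> at its root.
\<close>

definition rooted_trees :: "('a \<Rightarrow> 'a) \<Rightarrow> 'a set \<Rightarrow> 'a set \<Rightarrow> 'a list set set" where
  "rooted_trees \<iota> X S = {T. finite T \<and> [] \<in> T \<and> T \<subseteq> reduced_words \<iota> X \<and>
     (\<forall>w \<in> T. w \<noteq> [] \<longrightarrow> hd w \<in> S \<and> butlast w \<in> T)}"

definition tip :: "'a list set \<Rightarrow> 'a list \<Rightarrow> bool" where
  "tip T t \<longleftrightarrow> (\<forall>x. t @ [x] \<notin> T)"

text \<open>
  The root has no weight: the series of subtrees does not count the leaf \<open>\<one>\<close>, and in the
  quotient by an involution the root has a weight of its own.
\<close>

definition tree_weight :: "int fps \<Rightarrow> int fps \<Rightarrow> 'a list set \<Rightarrow> int fps" where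
  "tree_weight p q T = (\<Prod>t\<in>T - {[]}. if tip T t then q else p)"

lemma rooted_trees_prefix:
  assumes "T \<in> rooted_trees \<iota> X S" "u @ v \<in> T"
  shows "u \<in> T"
  using assms(2)
proof (induction v rule: rev_induct)
  case (snoc x v)
  have "butlast (u @ v @ [x]) \<in> T" using assms(1) snoc.prems unfolding rooted_trees_def by blast
  thus ?case using snoc.IH by (simp add: butlast_append)
qed simp

lemma tip_extension:
  assumes "T \<in> rooted_trees \<iota> X S" "t \<in> T"
  obtains v where "t @ v \<in> T" "tip T (t @ v)"
proof -
  have fin: "finite T" using assms by (simp add: rooted_trees_def)
  let ?E = "{w \<in> T. \<exists>v. w = t @ v}"
  have "t \<in> ?E" using assms(2) by auto
  moreover have "\<forall>w. w \<in> ?E \<longrightarrow> length w < Suc (Max (length ` T))"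
    using fin by (auto simp: less_Suc_eq_le)
  ultimately have "\<exists>w. w \<in> ?E \<and> (\<forall>w'. w' \<in> ?E \<longrightarrow> length w' \<le> length w)"
    by (rule ex_has_greatest_nat[where P = "\<lambda>w. w \<in> ?E" and f = length])
  then obtain w where w: "w \<in> ?E" "\<And>w'. w' \<in> ?E \<Longrightarrow> length w' \<le> length w"
    by (elim exE conjE) (simp only:)
  then obtain v where v: "w = t @ v" by auto
  have "tip T w" unfolding tip_def using w(2) v by fastforce
  thus ?thesis using that v w(1) by blast
qed

lemma length_less_card_rooted_tree:
  assumes "T \<in> rooted_trees \<iota> X S" "w \<in> T"
  shows "length w < card T"
proof -
  have "finite T" using assms by (simp add: rooted_trees_def)
  moreover have "(\<lambda>i. take i w) ` {..length w} \<subseteq> T"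
    using rooted_trees_prefix[OF assms(1), of "take i w" "drop i w" for i] assms(2) by auto
  moreover have "inj_on (\<lambda>i. take i w) {..length w}"
    by (rule inj_onI) (metis atMost_iff length_take min.absorb2)
  ultimately have "card {..length w} \<le> card T" by (metis card_inj_on_le)
  thus ?thesis by simp
qed

lemma finite_rooted_trees_card_le:
  assumes "finite X"
  shows "finite {T \<in> rooted_trees \<iota> X S. card T \<le> k}"
proof (rule finite_subset)
  show "finite (Pow {w. set w \<subseteq> X \<and> length w \<le> k})"
    using finite_lists_length_le[OF assms] by simp
  show "{T \<in> rooted_trees \<iota> X S. card T \<le> k} \<subseteq> Pow {w. set w \<subseteq> X \<and> length w \<le> k}"
  proof clarify
    fix T w x assume T: "T \<in> rooted_trees \<iota> X S" "card T \<le> k" "w \<in> T"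
    have "set w \<subseteq> X" using T unfolding rooted_trees_def reduced_words_def by auto
    thus "set w \<subseteq> X \<and> length w \<le> k" using length_less_card_rooted_tree[OF T(1,3)] T(2) by simp
  qed
qed

lemma tree_weight_eq_powers:
  assumes "finite T"
  shows "tree_weight p q T = p ^ card {t \<in> T - {[]}. \<not> tip T t} * q ^ card {t \<in> T - {[]}. tip T t}"
proof -
  have "tree_weight p q T = (\<Prod>t\<in>(T - {[]}) \<inter> {t. tip T t}. q) * (\<Prod>t\<in>(T - {[]}) \<inter> - {t. tip T t}. p)"
    unfolding tree_weight_def by (rule prod.If_cases) (use assms in auto)
  moreover have "(T - {[]}) \<inter> {t. tip T t} = {t \<in> T - {[]}. tip T t}"
    "(T - {[]}) \<inter> - {t. tip T t} = {t \<in> T - {[]}. \<not> tip T t}" by auto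
  ultimately show ?thesis by (simp add: mult.commute)
qed

lemma fps_X_power_dvd_nth_zero:
  assumes "fps_X ^ k dvd (f :: int fps)" "n < k"
  shows "fps_nth f n = 0"
  using assms by (auto elim!: dvdE simp: fps_X_power_mult_nth)

lemma fps_X_power_dvd_tree_weight:
  assumes "finite T" "[] \<in> T" "fps_X dvd p" "fps_X dvd q"
  shows "fps_X ^ (card T - 1) dvd tree_weight p q T"
proof -
  have "(\<Prod>t\<in>T - {[]}. fps_X) dvd tree_weight p q T"
    unfolding tree_weight_def by (rule prod_dvd_prod) (use assms in auto)
  thus ?thesis using assms by (simp add: card_Diff_singleton)
qed

lemma summable_tree_weights:
  assumes "finite X" "fps_X dvd p" "fps_X dvd q"
  shows "summable_family (rooted_trees \<iota> X S) (tree_weight p q)"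
  unfolding summable_family_def
proof
  fix n
  show "finite {T \<in> rooted_trees \<iota> X S. fps_nth (tree_weight p q T) n \<noteq> 0}"
  proof (rule finite_subset[OF _ finite_rooted_trees_card_le[OF assms(1), of \<iota> S "Suc n"]])
    show "{T \<in> rooted_trees \<iota> X S. fps_nth (tree_weight p q T) n \<noteq> 0}
        \<subseteq> {T \<in> rooted_trees \<iota> X S. card T \<le> Suc n}"
    proof clarify
      fix T assume T: "T \<in> rooted_trees \<iota> X S" "fps_nth (tree_weight p q T) n \<noteq> 0"
      hence "finite T" "[] \<in> T" by (auto simp: rooted_trees_def)
      from fps_X_power_dvd_nth_zero[OF fps_X_power_dvd_tree_weight[OF this assms(2,3)], of n] T(2)
      show "card T \<le> Suc n" by linarith
    qed
  qed
qed

lemma hd_butlast_eq: "butlast w \<noteq> [] \<Longrightarrow> hd (butlast w) = hd w"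
  by (cases w) auto

text \<open>
  A tree is determined by its branches along the edges at the root, which can be chosen freely.
  Being a tip is decided within the branch.
\<close>

lemma rooted_trees_branches:
  assumes "finite S"
  defines "graft \<equiv> \<lambda>f. insert [] (\<Union>x\<in>S. f x)"
  shows "bij_betw graft (PiE S (\<lambda>x. rooted_trees \<iota> X {x})) (rooted_trees \<iota> X S)"
    and "\<And>f. f \<in> PiE S (\<lambda>x. rooted_trees \<iota> X {x}) \<Longrightarrow>
           (\<Prod>x\<in>S. tree_weight p q (f x)) = tree_weight p q (graft f)"
proof -
  let ?P = "PiE S (\<lambda>x. rooted_trees \<iota> X {x})"
  define branch where "branch T = (\<lambda>x\<in>S. {w \<in> T. w \<noteq> [] \<longrightarrow> hd w = x})" for T :: "'a list set"
  have hdf: "hd w = x" if "f \<in> ?P" "x \<in> S" "w \<in> f x" "w \<noteq> []" for f w x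
    using that unfolding rooted_trees_def by (auto simp: PiE_iff)
  have nilf: "[] \<in> f x" if "f \<in> ?P" "x \<in> S" for f x
    using that unfolding rooted_trees_def by (auto simp: PiE_iff)
  show "bij_betw graft ?P (rooted_trees \<iota> X S)"
  proof (rule bij_betw_byWitness[where f' = branch])
    show "\<forall>f\<in>?P. branch (graft f) = f"
    proof
      fix f assume f: "f \<in> ?P"
      show "branch (graft f) = f"
      proof
        fix x
        show "branch (graft f) x = f x"
        proof (cases "x \<in> S")
          case True
          have "{w \<in> graft f. w \<noteq> [] \<longrightarrow> hd w = x} = f x"
          proof (intro equalityI subsetI)
            fix w assume "w \<in> {w \<in> graft f. w \<noteq> [] \<longrightarrow> hd w = x}"
            thus "w \<in> f x" using hdf[OF f] nilf[OF f True] unfolding graft_def by auto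
          next
            fix w assume "w \<in> f x"
            thus "w \<in> {w \<in> graft f. w \<noteq> [] \<longrightarrow> hd w = x}"
              using hdf[OF f True] True unfolding graft_def by auto
          qed
          thus ?thesis using True by (simp add: branch_def)
        qed (use f in \<open>auto simp: branch_def PiE_iff extensional_def\<close>)
      qed
    qed
    show "\<forall>T\<in>rooted_trees \<iota> X S. graft (branch T) = T"
    proof
      fix T assume T: "T \<in> rooted_trees \<iota> X S"
      show "graft (branch T) = T"
      proof (intro equalityI subsetI)
        fix w assume "w \<in> graft (branch T)"
        thus "w \<in> T" using T by (auto simp: graft_def branch_def rooted_trees_def)
      next
        fix w assume "w \<in> T"
        thus "w \<in> graft (branch T)" using T by (auto simp: graft_def branch_def rooted_trees_def)
      qed
    qed
    show "graft ` ?P \<subseteq> rooted_trees \<iota> X S"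
    proof
      fix T assume "T \<in> graft ` ?P"
      then obtain f where f: "f \<in> ?P" "T = graft f" by auto
      have fx: "f x \<in> rooted_trees \<iota> X {x}" if "x \<in> S" for x using f that by auto
      have "finite T" using fx assms by (auto simp: f graft_def rooted_trees_def)
      moreover have "T \<subseteq> reduced_words \<iota> X"
        using fx by (fastforce simp: f graft_def rooted_trees_def reduced_words_def)
      moreover have "hd w \<in> S \<and> butlast w \<in> T" if "w \<in> T" "w \<noteq> []" for w
      proof -
        obtain x where x: "x \<in> S" "w \<in> f x" using \<open>w \<in> T\<close> \<open>w \<noteq> []\<close> f unfolding graft_def by auto
        thus ?thesis using fx[OF x(1)] \<open>w \<noteq> []\<close> unfolding f graft_def rooted_trees_def by auto
      qed
      ultimately show "T \<in> rooted_trees \<iota> X S"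
        unfolding rooted_trees_def by (auto simp: f graft_def)
    qed
    show "branch ` rooted_trees \<iota> X S \<subseteq> ?P"
    proof
      fix f assume "f \<in> branch ` rooted_trees \<iota> X S"
      then obtain T where T: "T \<in> rooted_trees \<iota> X S" "f = branch T" by auto
      have "{w \<in> T. w \<noteq> [] \<longrightarrow> hd w = x} \<in> rooted_trees \<iota> X {x}" if "x \<in> S" for x
        using T(1) unfolding rooted_trees_def
        by (auto simp: hd_butlast_eq)
      thus "f \<in> ?P" unfolding T branch_def by auto
    qed
  qed
  fix f assume f: "f \<in> ?P"
  have fx: "f x \<in> rooted_trees \<iota> X {x}" if "x \<in> S" for x using f that by auto
  have "tree_weight p q (graft f) = (\<Prod>t\<in>(\<Union>x\<in>S. f x - {[]}). if tip (graft f) t then q else p)"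
    unfolding tree_weight_def by (rule prod.cong) (auto simp: graft_def)
  also have "\<dots> = (\<Prod>x\<in>S. \<Prod>t\<in>f x - {[]}. if tip (graft f) t then q else p)"
  proof (rule prod.UNION_disjoint[where A = "\<lambda>x. f x - {[]}"])
    show "finite S" by (rule assms)
    show "\<forall>x\<in>S. finite (f x - {[]})" using fx by (auto simp: rooted_trees_def)
    show "\<forall>x\<in>S. \<forall>y\<in>S. x \<noteq> y \<longrightarrow> (f x - {[]}) \<inter> (f y - {[]}) = {}"
    proof (intro ballI impI equals0I)
      fix x y t assume "x \<in> S" "y \<in> S" "x \<noteq> y" "t \<in> (f x - {[]}) \<inter> (f y - {[]})"
      thus False using hdf[OF f, of x t] hdf[OF f, of y t] by simp
    qed
  qed
  also have "\<dots> = (\<Prod>x\<in>S. tree_weight p q (f x))"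
    unfolding tree_weight_def
  proof (rule prod.cong[OF HOL.refl], rule prod.cong[OF HOL.refl])
    fix x t assume x: "x \<in> S" and t: "t \<in> f x - {[]}"
    have "t @ [y] \<in> graft f \<longleftrightarrow> t @ [y] \<in> f x" for y
      using hdf[OF f, of x t] hdf[OF f, of _ "t @ [y]"] x t unfolding graft_def by (auto simp: hd_append)
    thus "(if tip (graft f) t then q else p) = (if tip (f x) t then q else p)"
      by (simp add: tip_def)
  qed
  finally show "(\<Prod>x\<in>S. tree_weight p q (f x)) = tree_weight p q (graft f)" ..
qed

lemma formal_sum_branches:
  assumes "finite X" "finite S" "fps_X dvd p" "fps_X dvd q"
  shows "formal_sum (rooted_trees \<iota> X S) (tree_weight p q)
    = (\<Prod>x\<in>S. formal_sum (rooted_trees \<iota> X {x}) (tree_weight p q))"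
proof -
  have "formal_sum (rooted_trees \<iota> X S) (tree_weight p q)
      = formal_sum (PiE S (\<lambda>x. rooted_trees \<iota> X {x})) (\<lambda>f. \<Prod>x\<in>S. tree_weight p q (f x))"
    by (rule formal_sum_bij[OF rooted_trees_branches(1)[OF assms(2)], symmetric],
        rule rooted_trees_branches(2)[OF assms(2)])
  also have "\<dots> = (\<Prod>x\<in>S. formal_sum (rooted_trees \<iota> X {x}) (tree_weight p q))"
    by (rule formal_sum_PiE[OF assms(2)]) (rule summable_tree_weights[OF assms(1,3,4)])
  finally show ?thesis .
qed

lemma singleton_rooted_tree [simp]: "{[]} \<in> rooted_trees \<iota> X S"
  by (simp add: rooted_trees_def reduced_words_def)

lemma tree_weight_singleton [simp]: "tree_weight p q {[]} = 1"
  by (simp add: tree_weight_def)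

text \<open>
  A tree that grows along a single edge \<open>x\<close> is a tree at the far end of \<open>x\<close> not using the way back.
  The far end has become a vertex other than the root, so it contributes a factor: \<open>q\<close> if nothing
  else grows there, and \<open>p\<close> otherwise.
\<close>

lemma rooted_trees_stem:
  assumes "x \<in> X"
  defines "plant \<equiv> \<lambda>T. insert [] ((#) x ` T)"
  shows "bij_betw plant (rooted_trees \<iota> X (X - {\<iota> x})) (rooted_trees \<iota> X {x} - {{[]}})"
    and "\<And>T. T \<in> rooted_trees \<iota> X S \<Longrightarrow>
           (if T = {[]} then q else p) * tree_weight p q T = tree_weight p q (plant T)"
proof -
  define uproot where "uproot T = tl ` (T - {[]})" for T :: "'a list set"
  have plant_uproot: "plant (uproot T) = T" if T: "T \<in> rooted_trees \<iota> X {x}" for T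
  proof -
    have "x # tl w = w" if "w \<in> T" "w \<noteq> []" for w
      using T that unfolding rooted_trees_def by (cases w) auto
    hence "(#) x ` tl ` (T - {[]}) = T - {[]}"
      unfolding image_image by (intro equalityI subsetI) (auto intro!: image_eqI)
    thus ?thesis using T unfolding plant_def uproot_def rooted_trees_def by auto
  qed
  show "bij_betw plant (rooted_trees \<iota> X (X - {\<iota> x})) (rooted_trees \<iota> X {x} - {{[]}})"
  proof (rule bij_betw_byWitness[where f' = uproot])
    show "\<forall>T\<in>rooted_trees \<iota> X (X - {\<iota> x}). uproot (plant T) = T"
      by (auto simp: uproot_def plant_def image_iff)
    show "\<forall>T\<in>rooted_trees \<iota> X {x} - {{[]}}. plant (uproot T) = T"
      using plant_uproot by blast
    show "plant ` rooted_trees \<iota> X (X - {\<iota> x}) \<subseteq> rooted_trees \<iota> X {x} - {{[]}}"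
    proof
      fix T' assume "T' \<in> plant ` rooted_trees \<iota> X (X - {\<iota> x})"
      then obtain T where T: "T \<in> rooted_trees \<iota> X (X - {\<iota> x})" "T' = plant T" by auto
      have "x # w \<in> reduced_words \<iota> X" if "w \<in> T" for w
        using T(1) that assms(1) unfolding rooted_trees_def reduced_words_def
        by (fastforce simp: successively_Cons)
      moreover have "[] \<in> reduced_words \<iota> X" by (simp add: reduced_words_def)
      ultimately show "T' \<in> rooted_trees \<iota> X {x} - {{[]}}"
        using T unfolding rooted_trees_def plant_def by auto
    qed
    show "uproot ` (rooted_trees \<iota> X {x} - {{[]}}) \<subseteq> rooted_trees \<iota> X (X - {\<iota> x})"
    proof
      fix T' assume "T' \<in> uproot ` (rooted_trees \<iota> X {x} - {{[]}})"
      then obtain T where T: "T \<in> rooted_trees \<iota> X {x}" "T \<noteq> {[]}" "T' = uproot T" by auto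
      have T': "w \<in> T' \<longleftrightarrow> x # w \<in> T" for w
        using plant_uproot[OF T(1)] unfolding T(3) plant_def by (metis (no_types, lifting) image_iff insert_iff list.distinct(1) list.inject)
      have "finite T'" using T by (simp add: uproot_def rooted_trees_def)
      moreover have "[] \<in> T'"
      proof -
        have "[] \<in> T" using T(1) by (simp add: rooted_trees_def)
        then obtain w where w: "w \<in> T" "w \<noteq> []" using T(2) by blast
        have "hd w = x" using T(1) w by (auto simp: rooted_trees_def)
        hence "[x] @ tl w \<in> T" using w by (cases w) auto
        thus ?thesis using rooted_trees_prefix[OF T(1)] T' by blast
      qed
      moreover have "w \<in> reduced_words \<iota> X \<and> (w \<noteq> [] \<longrightarrow> hd w \<in> X - {\<iota> x} \<and> butlast w \<in> T')"
        if "w \<in> T'" for w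
      proof -
        have xw: "x # w \<in> T" using that T' by simp
        hence r: "x # w \<in> reduced_words \<iota> X" and b: "butlast (x # w) \<in> T"
          using T(1) unfolding rooted_trees_def by auto
        show ?thesis
        proof (cases "w = []")
          case False
          hence "x # butlast w \<in> T" using b by simp
          thus ?thesis using r False T' unfolding reduced_words_def by (auto simp: successively_Cons)
        qed (simp add: reduced_words_def)
      qed
      ultimately show "T' \<in> rooted_trees \<iota> X (X - {\<iota> x})"
        unfolding rooted_trees_def by auto
    qed
  qed
  fix T assume T: "T \<in> rooted_trees \<iota> X S"
  have tips: "tip (plant T) (x # t) \<longleftrightarrow> tip T t" for t
    by (auto simp: tip_def plant_def)
  have root: "tip T [] \<longleftrightarrow> T = {[]}"
  proof
    assume t: "tip T []"
    show "T = {[]}"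
    proof (rule ccontr)
      assume "T \<noteq> {[]}"
      moreover have "[] \<in> T" using T by (simp add: rooted_trees_def)
      ultimately obtain w where w: "w \<in> T" "w \<noteq> []" by blast
      hence "[hd w] @ tl w \<in> T" by simp
      hence "[hd w] \<in> T" using rooted_trees_prefix[OF T] by blast
      thus False using t by (simp add: tip_def)
    qed
  qed (simp add: tip_def)
  have fT: "finite T" "[] \<in> T" using T by (auto simp: rooted_trees_def)
  have "tree_weight p q (plant T) = (\<Prod>t\<in>(#) x ` T. if tip (plant T) t then q else p)"
    unfolding tree_weight_def by (rule prod.cong) (auto simp: plant_def)
  also have "\<dots> = (\<Prod>t\<in>T. if tip T t then q else p)"
    by (subst prod.reindex) (auto simp: tips)
  also have "\<dots> = (if T = {[]} then q else p) * tree_weight p q T"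
    using fT root unfolding tree_weight_def by (simp add: prod.remove)
  finally show "(if T = {[]} then q else p) * tree_weight p q T = tree_weight p q (plant T)" ..
qed

text \<open>
  Cutting off one branch, with its first edge, leaves two smaller trees. This is the induction step
  for tours of trees.
\<close>

lemma rooted_tree_cut:
  assumes T: "T \<in> rooted_trees \<iota> X S" and "T \<noteq> {[]}"
  obtains x T1 T2 where "x \<in> X" "T1 \<in> rooted_trees \<iota> X S" "T2 \<in> rooted_trees \<iota> X (X - {\<iota> x})"
    "T = T1 \<union> (#) x ` T2" "T1 \<inter> (#) x ` T2 = {}"
proof -
  have fT: "finite T" "[] \<in> T" "T \<subseteq> reduced_words \<iota> X"
    and pT: "\<And>w. w \<in> T \<Longrightarrow> w \<noteq> [] \<Longrightarrow> hd w \<in> S \<and> butlast w \<in> T"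
    using T unfolding rooted_trees_def by auto
  obtain w where w: "w \<in> T" "w \<noteq> []" using fT(2) assms(2) by blast
  define x where "x = hd w"
  have "w \<in> lists X" using w fT unfolding reduced_words_def by auto
  hence x: "x \<in> X" using w(2) unfolding x_def by (cases w) auto
  define B where "B = {w \<in> T. w \<noteq> [] \<longrightarrow> hd w = x}"
  have "B \<in> rooted_trees \<iota> X {x}"
    using fT pT unfolding rooted_trees_def B_def by (auto simp: hd_butlast_eq)
  moreover have "w \<in> B" using w by (simp add: B_def x_def)
  ultimately have "B \<in> rooted_trees \<iota> X {x} - {{[]}}" using w(2) by auto
  then obtain T2 where T2: "T2 \<in> rooted_trees \<iota> X (X - {\<iota> x})" "B = insert [] ((#) x ` T2)"
    using rooted_trees_stem(1)[OF x, of \<iota>] unfolding bij_betw_def by blast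
  define T1 where "T1 = {w \<in> T. w \<noteq> [] \<longrightarrow> hd w \<noteq> x}"
  have "T1 \<in> rooted_trees \<iota> X S"
    using fT pT unfolding rooted_trees_def T1_def by (auto simp: hd_butlast_eq)
  moreover have B': "(#) x ` T2 = B - {[]}" using T2(2) by auto
  moreover have "T = T1 \<union> (B - {[]})" unfolding T1_def B_def by auto
  moreover have "T1 \<inter> (B - {[]}) = {}" unfolding T1_def B_def by auto
  ultimately show ?thesis using that[OF x] T2(1) by simp
qed

definition prefix_hull :: "'a list set \<Rightarrow> 'a list set" where
  "prefix_hull A = insert [] {u. \<exists>v. u @ v \<in> A}"

lemma prefix_hull_rooted_tree:
  assumes "finite A" "A \<subseteq> reduced_words \<iota> X" "\<And>w. w \<in> A \<Longrightarrow> w \<noteq> [] \<Longrightarrow> hd w \<in> S"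
  shows "prefix_hull A \<in> rooted_trees \<iota> X S"
proof -
  have "prefix_hull A \<subseteq> insert [] (\<Union>w\<in>A. (\<lambda>i. take i w) ` {..length w})"
  proof
    fix u assume "u \<in> prefix_hull A"
    then consider "u = []" | v where "u @ v \<in> A" by (auto simp: prefix_hull_def)
    thus "u \<in> insert [] (\<Union>w\<in>A. (\<lambda>i. take i w) ` {..length w})"
    proof cases
      case 2
      moreover have "u = take (length u) (u @ v)" "length u \<le> length (u @ v)" by auto
      ultimately show ?thesis by blast
    qed simp
  qed
  hence "finite (prefix_hull A)" by (rule finite_subset) (use assms(1) in auto)
  moreover have "[] \<in> prefix_hull A" by (simp add: prefix_hull_def)
  moreover have "prefix_hull A \<subseteq> reduced_words \<iota> X"
    using assms(2) unfolding prefix_hull_def reduced_words_def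
    by (auto simp: successively_append_iff)
  moreover have "hd u \<in> S \<and> butlast u \<in> prefix_hull A" if u: "u \<in> prefix_hull A" "u \<noteq> []" for u
  proof -
    obtain v where v: "u @ v \<in> A" using u by (auto simp: prefix_hull_def)
    have "butlast u @ (last u # v) = u @ v"
      using u(2) by (metis append_Cons append_Nil append.assoc append_butlast_last_id)
    hence "butlast u @ (last u # v) \<in> A" using v by (simp only:)
    hence "butlast u \<in> prefix_hull A" unfolding prefix_hull_def by blast
    thus ?thesis using assms(3)[OF v] u(2) by simp
  qed
  ultimately show ?thesis unfolding rooted_trees_def by simp
qed

lemma prefix_hull_superset: "A \<subseteq> prefix_hull A"
  by (auto simp: prefix_hull_def intro: exI[of _ "[]"])

text \<open>
  Either nothing grows along the edge \<open>x\<close>, or its far end is a tip, or trees grow along all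
  edges at the far end other than the one leading back.
\<close>

lemma branch_series_recursion:
  fixes \<iota> :: "'a \<Rightarrow> 'a"
  assumes "finite X" "x \<in> X" "fps_X dvd p" "fps_X dvd q"
  defines "F \<equiv> \<lambda>u. formal_sum (rooted_trees \<iota> X {u}) (tree_weight p q)"
  shows "F x = 1 + q + p * ((\<Prod>u\<in>X - {\<iota> x}. F u) - 1)"
proof -
  let ?S = "X - {\<iota> x}" and ?w = "tree_weight p q :: 'a list set \<Rightarrow> int fps"
  let ?w' = "\<lambda>T :: 'a list set. (if T = {[]} then q else p) * ?w T"
  note summ = summable_tree_weights[OF assms(1,3,4), of \<iota>]
  have summ1: "summable_family (rooted_trees \<iota> X S - {{[]}}) ?w" for S
    by (rule summable_family_subset[OF summ]) blast
  have split: "formal_sum (rooted_trees \<iota> X S) w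
      = w {[]} + formal_sum (rooted_trees \<iota> X S - {{[]}}) w"
    if "summable_family (rooted_trees \<iota> X S - {{[]}}) w" for S w
    using formal_sum_Un_disjoint[OF summable_family_finite[of "{{[]}}" w] that]
      insert_Diff[OF singleton_rooted_tree[of \<iota> X S]]
    by (simp add: formal_sum_finite)
  have w': "?w' T = p * ?w T" if "T \<in> rooted_trees \<iota> X ?S - {{[]}}" for T using that by simp
  have summ': "summable_family (rooted_trees \<iota> X ?S - {{[]}}) ?w'"
    using summable_family_cong[of "rooted_trees \<iota> X ?S - {{[]}}" ?w' "\<lambda>T. p * ?w T"]
      summable_family_cmult[OF summ1[of ?S], of p] w' by blast
  have "F x = 1 + formal_sum (rooted_trees \<iota> X {x} - {{[]}}) ?w"
    unfolding F_def using split[OF summ1] by simp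
  also have "formal_sum (rooted_trees \<iota> X {x} - {{[]}}) ?w = formal_sum (rooted_trees \<iota> X ?S) ?w'"
    by (rule formal_sum_bij[OF rooted_trees_stem(1)[OF assms(2)], symmetric],
        rule rooted_trees_stem(2)[OF assms(2)])
  also have "\<dots> = q + formal_sum (rooted_trees \<iota> X ?S - {{[]}}) ?w'"
    using split[OF summ'] by simp
  also have "formal_sum (rooted_trees \<iota> X ?S - {{[]}}) ?w'
      = formal_sum (rooted_trees \<iota> X ?S - {{[]}}) (\<lambda>T. p * ?w T)"
    by (rule formal_sum_cong) (rule w')
  also have "\<dots> = p * formal_sum (rooted_trees \<iota> X ?S - {{[]}}) ?w"
    by (rule formal_sum_cmult[OF summ1])
  also have "formal_sum (rooted_trees \<iota> X ?S - {{[]}}) ?w = formal_sum (rooted_trees \<iota> X ?S) ?w - 1"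
    using split[OF summ1] by simp
  also have "formal_sum (rooted_trees \<iota> X ?S) ?w = (\<Prod>u\<in>?S. F u)"
    unfolding F_def by (rule formal_sum_branches) (use assms in auto)
  finally show ?thesis by (simp add: algebra_simps)
qed

lemma fps_eqI_X_power_dvd:
  assumes "\<And>n. fps_X ^ n dvd (f - g :: int fps)"
  shows "f = g"
proof (rule fps_ext)
  fix n
  show "fps_nth f n = fps_nth g n"
    using fps_X_power_dvd_nth_zero[OF assms, of n "Suc n"] by simp
qed

lemma prod_cong_dvd:
  fixes d :: "'b :: comm_ring_1"
  assumes "finite A" "\<And>a. a \<in> A \<Longrightarrow> d dvd f a - g a"
  shows "d dvd (\<Prod>a\<in>A. f a) - (\<Prod>a\<in>A. g a)"
  using assms
proof (induction A rule: finite_induct)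
  case (insert a A)
  have "(\<Prod>a\<in>insert a A. f a) - (\<Prod>a\<in>insert a A. g a)
      = (f a - g a) * prod f A + g a * (prod f A - prod g A)"
    using insert.hyps by (simp add: algebra_simps)
  thus ?case using insert by (metis dvd_add dvd_mult dvd_mult2 insertCI)
qed simp

text \<open>
  The recursion determines the coefficients one after the other, by the same rule for every
  \<open>x\<close>, because its right-hand side has \<open>card X - 1\<close> factors for every \<open>x\<close>. This is why the
  trees growing along one edge are equinumerous with those growing along another.
\<close>

lemma branch_series_indep:
  fixes \<iota> :: "'a \<Rightarrow> 'a"
  assumes "finite X" "\<And>x. x \<in> X \<Longrightarrow> \<iota> x \<in> X" "fps_X dvd p" "fps_X dvd q" "x \<in> X" "y \<in> X"
  defines "F \<equiv> \<lambda>u. formal_sum (rooted_trees \<iota> X {u}) (tree_weight p q)"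
  shows "F x = F y"
proof (rule fps_eqI_X_power_dvd)
  have rec: "F u = 1 + q + p * ((\<Prod>u\<in>X - {\<iota> u}. F u) - 1)" if "u \<in> X" for u
    unfolding F_def using branch_series_recursion[OF assms(1) that assms(3,4)] .
  fix n
  show "fps_X ^ n dvd F x - F y"
    using assms(5,6)
  proof (induction n arbitrary: x y)
    case (Suc n)
    have c: "card (X - {\<iota> u}) = card X - 1" if "u \<in> X" for u using assms(1,2) that by simp
    have "fps_X ^ n dvd (\<Prod>u\<in>X - {\<iota> u}. F u) - F y ^ (card X - 1)" if "u \<in> X" for u
      using prod_cong_dvd[of "X - {\<iota> u}" "fps_X ^ n" F "\<lambda>_. F y"] Suc.IH Suc.prems assms(1) c[OF that]
      by simp
    from dvd_diff[OF this[of x] this[of y]]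
    have "fps_X ^ n dvd (\<Prod>u\<in>X - {\<iota> x}. F u) - (\<Prod>u\<in>X - {\<iota> y}. F u)"
      using Suc.prems by simp
    hence "fps_X * fps_X ^ n dvd p * ((\<Prod>u\<in>X - {\<iota> x}. F u) - (\<Prod>u\<in>X - {\<iota> y}. F u))"
      using assms(3) by (rule mult_dvd_mono[rotated])
    also have "\<dots> = (1 + q + p * ((\<Prod>u\<in>X - {\<iota> x}. F u) - 1)) - (1 + q + p * ((\<Prod>u\<in>X - {\<iota> y}. F u) - 1))"
      by (simp add: algebra_simps)
    also have "\<dots> = F x - F y"
      by (simp only: rec[OF Suc.prems(1), symmetric] rec[OF Suc.prems(2), symmetric])
    finally show ?case by simp
  qed simp
qed

section \<open>Groups whose Cayley graph is a tree\<close>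

text \<open>
  The hypotheses say that \<open>L\<close> is a free product of infinite cyclic groups and groups of order
  two, and that \<open>X\<close> consists of the canonical generators and their inverses.
\<close>

locale tree_group = group L for L (structure) +
  fixes X
  assumes finite_gens: "finite X"
    and gens_closed: "X \<subseteq> carrier L"
    and inv_gens: "\<And>x. x \<in> X \<Longrightarrow> inv x \<in> X"
    and spelled: "\<And>g. g \<in> carrier L \<Longrightarrow> \<exists>w \<in> reduced_words (m_inv L) X. ev w = g"
    and spelling_unique: "inj_on ev (reduced_words (m_inv L) X)"
begin

abbreviation red where "red \<equiv> reduced_words (m_inv L) X"
abbreviation trees where "trees S \<equiv> rooted_trees (m_inv L) X S"

definition nf where "nf = the_inv_into red ev"

lemma gen_closed [simp]: "x \<in> X \<Longrightarrow> x \<in> carrier L"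
  using gens_closed by auto

lemma red_closed: "w \<in> red \<Longrightarrow> w \<in> lists (carrier L)"
  unfolding reduced_words_def using gens_closed by auto

lemma ev_red_closed [simp]: "w \<in> red \<Longrightarrow> ev w \<in> carrier L"
  using red_closed foldr_mult_closed by blast

lemma ev_lists_closed [simp]: "w \<in> lists X \<Longrightarrow> ev w \<in> carrier L"
  by (rule foldr_mult_closed) (use gens_closed in auto)

lemma nf_ev [simp]: "w \<in> red \<Longrightarrow> nf (ev w) = w"
  unfolding nf_def by (rule the_inv_into_f_f[OF spelling_unique])

lemma nf_red [simp]: "g \<in> carrier L \<Longrightarrow> nf g \<in> red"
  using spelled nf_ev by metis

lemma ev_nf [simp]: "g \<in> carrier L \<Longrightarrow> ev (nf g) = g"
  using spelled nf_ev by metis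

lemma nf_eqI: "w \<in> red \<Longrightarrow> ev w = g \<Longrightarrow> nf g = w"
  using nf_ev by auto

lemma nf_inject: "g \<in> carrier L \<Longrightarrow> h \<in> carrier L \<Longrightarrow> nf g = nf h \<longleftrightarrow> g = h"
  by (metis ev_nf)

lemma Nil_red [simp]: "[] \<in> red"
  by (simp add: reduced_words_def)

lemma nf_one [simp]: "nf \<one> = []"
  by (rule nf_eqI) auto

lemma nf_gen [simp]: "x \<in> X \<Longrightarrow> nf x = [x]"
  by (rule nf_eqI) (auto simp: reduced_words_def)

lemma gen_not_one: "x \<in> X \<Longrightarrow> x \<noteq> \<one>"
  using nf_gen nf_one by (metis list.distinct(1))

lemma red_append_iff:
  "u @ v \<in> red \<longleftrightarrow> u \<in> red \<and> v \<in> red \<and> (u \<noteq> [] \<longrightarrow> v \<noteq> [] \<longrightarrow> hd v \<noteq> inv (last u))"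
  unfolding reduced_words_def by (auto simp: successively_append_iff)

lemma red_Cons_iff: "x # w \<in> red \<longleftrightarrow> x \<in> X \<and> w \<in> red \<and> (w \<noteq> [] \<longrightarrow> hd w \<noteq> inv x)"
  unfolding reduced_words_def by (auto simp: successively_Cons)

lemma inv_gen_swap: "x \<in> X \<Longrightarrow> y \<in> X \<Longrightarrow> x = inv y \<longleftrightarrow> y = inv x"
  by (metis gen_closed inv_inv)

lemma nf_gen_mult:
  assumes "g \<in> carrier L" "x \<in> X"
  shows "nf (x \<otimes> g) = (if nf g \<noteq> [] \<and> hd (nf g) = inv x then tl (nf g) else x # nf g)"
proof (cases "nf g \<noteq> [] \<and> hd (nf g) = inv x")
  case True
  then obtain u where u: "nf g = inv x # u" by (cases "nf g") auto
  hence r: "u \<in> red" using nf_red[OF assms(1)] by (simp add: red_Cons_iff)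
  have "g = inv x \<otimes> ev u" using ev_nf[OF assms(1)] u by simp
  hence "x \<otimes> g = ev u" using r assms by (simp add: m_assoc[symmetric])
  thus ?thesis using True u r by simp
next
  case False
  hence "x # nf g \<in> red" using assms by (auto simp: red_Cons_iff)
  moreover have "ev (x # nf g) = x \<otimes> g" using assms by simp
  ultimately show ?thesis using False nf_eqI by auto
qed

lemma nf_mult_gen:
  assumes "g \<in> carrier L" "x \<in> X"
  shows "nf (g \<otimes> x) = (if nf g \<noteq> [] \<and> last (nf g) = inv x then butlast (nf g) else nf g @ [x])"
proof (cases "nf g \<noteq> [] \<and> last (nf g) = inv x")
  case True
  then obtain u where u: "nf g = u @ [inv x]" by (cases "nf g" rule: rev_cases) auto
  hence r: "u \<in> red" using nf_red[OF assms(1)] by (simp add: red_append_iff)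
  have "g = ev u \<otimes> inv x"
    using ev_nf[OF assms(1)] u foldr_mult_append[OF red_closed[OF r], of "[inv x]"] assms by simp
  hence "g \<otimes> x = ev u" using r assms by (simp add: m_assoc)
  thus ?thesis using True u r by simp
next
  case False
  have "[x] \<in> red" using assms by (simp add: red_Cons_iff)
  moreover have "nf g \<noteq> [] \<Longrightarrow> last (nf g) \<in> X"
    using nf_red[OF assms(1)] unfolding reduced_words_def by auto
  ultimately have "nf g @ [x] \<in> red"
    using assms False inv_gen_swap[of x "last (nf g)"] by (auto simp: red_append_iff)
  moreover have "ev (nf g @ [x]) = g \<otimes> x"
    using foldr_mult_append[OF red_closed[OF nf_red[OF assms(1)]], of "[x]"] assms by simp
  ultimately show ?thesis using False nf_eqI by auto
qed

section \<open>Involutions\<close>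

text \<open>
  Every power of a cyclically reduced word is reduced, so an element of finite order is conjugate
  to one whose word cannot be shortened cyclically and yet begins with the inverse of its last
  letter: a single letter, equal to its inverse.
\<close>

lemma torsion_conjugate_to_involution:
  assumes "a \<in> carrier L" "a \<noteq> \<one>" "a [^] n = \<one>" "(n::nat) > 0"
  shows "\<exists>h \<in> carrier L. \<exists>b \<in> X. inv b = b \<and> a = h \<otimes> b \<otimes> inv h"
  using assms(1-3)
proof (induction "length (nf a)" arbitrary: a rule: less_induct)
  case less
  define w where "w = nf a"
  have w: "w \<in> red" "ev w = a" using less.prems unfolding w_def by auto
  have "w \<noteq> []" using w less.prems by auto
  have lastX: "last w \<in> X" using w(1) \<open>w \<noteq> []\<close> unfolding reduced_words_def by auto
  \<comment> \<open>Otherwise no letters cancel in a power of \<open>w\<close>, and \<open>a [^] n\<close> could not be trivial.\<close>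
  have cyc: "hd w = inv (last w)"
  proof (rule ccontr)
    assume nc: "hd w \<noteq> inv (last w)"
    have "concat (replicate k w) \<in> red \<and> ev (concat (replicate k w)) = a [^] k \<and>
        (k > 0 \<longrightarrow> concat (replicate k w) \<noteq> [] \<and> hd (concat (replicate k w)) = hd w)" for k
    proof (induction k)
      case (Suc k)
      let ?c = "concat (replicate k w)"
      have "w @ ?c \<in> red" using Suc w nc by (cases k) (auto simp: red_append_iff)
      moreover have "ev (w @ ?c) = a [^] Suc k"
      proof -
        have "ev (w @ ?c) = ev w \<otimes> ev ?c" by (rule foldr_mult_append) (use w Suc red_closed in blast)+
        also have "\<dots> = a \<otimes> a [^] k" using Suc w by simp
        also have "\<dots> = a [^] Suc k" by (rule nat_pow_Suc2[symmetric, OF less.prems(1)])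
        finally show ?thesis .
      qed
      ultimately show ?case using \<open>w \<noteq> []\<close> by (simp add: hd_append)
    qed auto
    from this[of n] have "concat (replicate n w) = nf \<one>" "concat (replicate n w) \<noteq> []"
      using less.prems assms(4) nf_ev by metis+
    thus False by simp
  qed
  define x where "x = hd w"
  have x: "x \<in> X" "last w = inv x" using lastX cyc inv_gens by (auto simp: x_def)
  show ?case
  proof (cases "tl w = []")
    case True
    hence "w = [x]" using \<open>w \<noteq> []\<close> by (cases w) (auto simp: x_def)
    hence "inv x = x" "a = x" using x w by auto
    thus ?thesis using x by (intro bexI[of _ \<one>] bexI[of _ x]) auto
  next
    case False
    define u where "u = butlast (tl w)"
    have wu: "w = x # u @ [inv x]"
      using False \<open>w \<noteq> []\<close> x(2) unfolding u_def x_def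
      by (metis append_butlast_last_id last_tl list.collapse)
    hence ur: "u \<in> red" using w(1) by (auto simp: red_Cons_iff red_append_iff)
    have "u \<noteq> []" using w(1) wu by (auto simp: red_Cons_iff)
    define a' where "a' = ev u"
    have a': "a' \<in> carrier L" "nf a' = u" using ur by (auto simp: a'_def)
    have "a = x \<otimes> (a' \<otimes> inv x)"
      using w(2) wu foldr_mult_append[OF red_closed[OF ur], of "[inv x]"] x a'_def by simp
    hence aa': "a = x \<otimes> a' \<otimes> inv x" using x a' by (simp add: m_assoc)
    have pw: "a [^] k = x \<otimes> a' [^] k \<otimes> inv x" for k :: nat
    proof (induction k)
      case (Suc k)
      thus ?case using aa' x a' by (simp add: m_assoc)
    qed (use x in simp)
    have "a' [^] n = \<one>"
    proof -
      have "x \<otimes> a' [^] n \<otimes> inv x = \<one>" using pw[of n] less.prems by simp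
      hence "x \<otimes> a' [^] n = x" using x a' by (metis gen_closed inv_inv inv_unique' inv_equality m_closed nat_pow_closed inv_closed)
      thus ?thesis using x a' by (metis gen_closed l_cancel_one nat_pow_closed)
    qed
    moreover have "a' \<noteq> \<one>" using a'(2) \<open>u \<noteq> []\<close> by auto
    moreover have "length (nf a') < length (nf a)" using a'(2) wu w_def by simp
    ultimately obtain h b where hb: "h \<in> carrier L" "b \<in> X" "inv b = b" "a' = h \<otimes> b \<otimes> inv h"
      using less.hyps a'(1) by blast
    have "a = (x \<otimes> h) \<otimes> b \<otimes> inv (x \<otimes> h)"
      unfolding aa' hb(4) using x hb by (simp add: inv_mult_group m_assoc)
    thus ?thesis using hb x by (intro bexI[of _ "x \<otimes> h"] bexI[of _ b]) auto
  qed
qed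

text \<open>
  Multiplication by \<open>b\<close> on the right changes the end of the normal form of \<open>h\<close>, and multiplication by
  \<open>b'\<close> on the left changes its beginning. The results can only agree if the normal form of \<open>h\<close> is
  too short to have a beginning distinct from its end.
\<close>

lemma involution_conjugacy:
  assumes "h \<in> carrier L" "b \<in> X" "b' \<in> X" "inv b = b" "inv b' = b'" "h \<otimes> b = b' \<otimes> h"
  shows "b = b'" "h = \<one> \<or> h = b"
proof -
  define w where "w = nf h"
  have w: "w \<in> red" "ev w = h" using assms(1) by (auto simp: w_def)
  have eq: "(if w \<noteq> [] \<and> last w = b then butlast w else w @ [b])
      = (if w \<noteq> [] \<and> hd w = b' then tl w else b' # w)"
  proof -
    have "nf (h \<otimes> b) = (if w \<noteq> [] \<and> last w = b then butlast w else w @ [b])"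
      using nf_mult_gen[OF assms(1,2)] by (simp only: assms(4) w_def)
    moreover have "nf (b' \<otimes> h) = (if w \<noteq> [] \<and> hd w = b' then tl w else b' # w)"
      using nf_gen_mult[OF assms(1,3)] by (simp only: assms(5) w_def)
    ultimately show ?thesis by (simp only: assms(6))
  qed
  consider "w = []" | x where "w = [x]" | x y u where "w = x # u @ [y]"
    by (cases w; cases "tl w" rule: rev_cases) auto
  hence "b = b' \<and> (w = [] \<or> w = [b])"
  proof cases
    case 3
    have "length (butlast w) < length w" "length (tl w) < length w" using 3 by auto
    have False
    proof (cases "y = b")
      case True
      hence "butlast w = (if x = b' then tl w else b' # w)" using eq 3 by simp
      hence "x = b'" "x # u = u @ [y]" using 3 by (auto split: if_splits)
      hence "u = [] \<or> hd u = b'" by (metis hd_append2 list.sel(1))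
      thus False using w(1) 3 \<open>x = b'\<close> \<open>x # u = u @ [y]\<close> assms(5)
        by (cases u) (auto simp: red_Cons_iff)
    next
      case False
      hence "w @ [b] = (if x = b' then tl w else b' # w)" using eq 3 by simp
      hence "x \<noteq> b'" "w @ [b] = b' # w" using 3 by (auto split: if_splits dest: arg_cong[of _ _ length])
      thus False using 3 by simp
    qed
    thus ?thesis ..
  qed (use eq in \<open>auto split: if_splits\<close>)
  thus "b = b'" "h = \<one> \<or> h = b" using w assms(2) by auto
qed

section \<open>Closed walks in the quotient by an involution\<close>

text \<open>
  The orbits of left multiplication by an involution \<open>b\<close> are represented by the words not
  beginning with \<open>b\<close>. In the quotient of the Cayley graph the edge from \<open>\<one>\<close> to \<open>b\<close> becomes a
  loop at the root.
\<close>

definition fold_by where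
  "fold_by b w = (if w \<noteq> [] \<and> hd w = b then tl w else w)"

lemma fold_by_mult:
  assumes "g \<in> carrier L" "b \<in> X" "inv b = b"
  shows "fold_by b (nf (b \<otimes> g)) = fold_by b (nf g)"
    and "nf (b \<otimes> g) \<noteq> [] \<and> hd (nf (b \<otimes> g)) = b \<longleftrightarrow> \<not> (nf g \<noteq> [] \<and> hd (nf g) = b)"
proof -
  have "tl (nf g) \<noteq> [] \<Longrightarrow> hd (nf g) = b \<Longrightarrow> hd (tl (nf g)) \<noteq> b"
    using nf_red[OF assms(1)] assms(3) by (cases "nf g") (auto simp: red_Cons_iff)
  thus "fold_by b (nf (b \<otimes> g)) = fold_by b (nf g)"
    and "nf (b \<otimes> g) \<noteq> [] \<and> hd (nf (b \<otimes> g)) = b \<longleftrightarrow> \<not> (nf g \<noteq> [] \<and> hd (nf g) = b)"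
    using nf_gen_mult[OF assms(1,2)] assms(3) by (auto simp: fold_by_def)
qed

text \<open>
  A step in the Cayley graph becomes a step along an edge of the quotient tree or a passage through
  the loop at the root, and only the loop leads from one half of the Cayley graph to the other.
\<close>

lemma fold_by_step:
  assumes "g \<in> carrier L" "x \<in> X" "b \<in> X" "inv b = b"
  defines "u \<equiv> fold_by b (nf g)" and "u' \<equiv> fold_by b (nf (g \<otimes> x))"
  shows "u' = u @ [x] \<or> u \<noteq> [] \<and> u' = butlast u \<or> u = [] \<and> u' = []"
    and "(nf g \<noteq> [] \<and> hd (nf g) = b) \<noteq> (nf (g \<otimes> x) \<noteq> [] \<and> hd (nf (g \<otimes> x)) = b) \<Longrightarrow> u = [] \<and> u' = []"
proof -
  define w where "w = nf g"
  have w': "nf (g \<otimes> x) = (if w \<noteq> [] \<and> last w = inv x then butlast w else w @ [x])"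
    unfolding w_def by (rule nf_mult_gen[OF assms(1,2)])
  have xb: "inv x = b \<Longrightarrow> x = b" using assms(2,4) inv_inv[of x] by auto
  consider "w = []" | y where "w = [y]" | y z v where "w = y # v @ [z]"
    by (cases w; cases "tl w" rule: rev_cases) auto
  hence "(u' = u @ [x] \<or> u \<noteq> [] \<and> u' = butlast u \<or> u = [] \<and> u' = []) \<and>
    ((w \<noteq> [] \<and> hd w = b) \<noteq> (nf (g \<otimes> x) \<noteq> [] \<and> hd (nf (g \<otimes> x)) = b) \<longrightarrow> u = [] \<and> u' = [])"
    unfolding u_def u'_def w_def[symmetric] w' fold_by_def
    by cases (simp_all add: assms(4) xb)
  thus "u' = u @ [x] \<or> u \<noteq> [] \<and> u' = butlast u \<or> u = [] \<and> u' = []"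
    and "(nf g \<noteq> [] \<and> hd (nf g) = b) \<noteq> (nf (g \<otimes> x) \<noteq> [] \<and> hd (nf (g \<otimes> x)) = b) \<Longrightarrow> u = [] \<and> u' = []"
    unfolding w_def by blast+
qed

text \<open>
  A property that holds at one time and fails at another is gained and lost on a closed walk.
\<close>

lemma cyclic_flip:
  assumes "Q t" "t \<le> s" "\<not> Q r" "r \<le> s" "Q (0::nat) = Q s"
  shows "\<exists>n<s. \<not> Q n \<and> Q (Suc n)" "\<exists>n<s. Q n \<and> \<not> Q (Suc n)"
proof -
  have stay: "P n" if "P m" "m \<le> n" "n \<le> s" "\<And>n. n < s \<Longrightarrow> P n \<Longrightarrow> P (Suc n)" for P m n
    using that(2,3)
  proof (induction rule: dec_induct)
    case base show ?case by (rule that(1))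
  next
    case (step n) thus ?case using that(4)[of n] by simp
  qed
  have wrap: "P t'" if "P r'" "r' \<le> s" "t' \<le> s" "P s \<Longrightarrow> P 0" "\<And>n. n < s \<Longrightarrow> P n \<Longrightarrow> P (Suc n)" for P r' t'
  proof -
    have "P s" by (rule stay[OF that(1,2) order_refl that(5)])
    thus ?thesis using stay[of P 0 t', OF that(4) _ that(3,5)] by simp
  qed
  show "\<exists>n<s. \<not> Q n \<and> Q (Suc n)"
  proof (rule ccontr)
    assume "\<not> ?thesis"
    hence "\<not> Q t" by (intro wrap[of "\<lambda>n. \<not> Q n" r t]) (use assms in auto)
    thus False using assms(1) by simp
  qed
  show "\<exists>n<s. Q n \<and> \<not> Q (Suc n)"
  proof (rule ccontr)
    assume "\<not> ?thesis"
    hence "Q r" by (intro wrap[of Q t r]) (use assms in auto)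
    thus False using assms(3) by simp
  qed
qed

text \<open>
  A walk from \<open>k\<close> to \<open>b \<otimes> k\<close> becomes closed in the quotient and runs through the loop, since it
  changes from one side of the edge between \<open>\<one>\<close> and \<open>b\<close> to the other. So it is at the root at
  some time, and each edge below which it ever gets is crossed at least once in each direction.
\<close>

lemma closed_walk_length:
  assumes "b \<in> X" "inv b = b" "xs \<in> lists X" "k \<in> carrier L" "k \<otimes> ev xs = b \<otimes> k"
    and "finite H" "[] \<notin> H"
    and visited: "\<And>w. w \<in> H \<Longrightarrow> \<exists>n \<le> length xs. \<exists>v. fold_by b (nf (k \<otimes> ev (take n xs))) = w @ v"
  shows "2 * card H + 1 \<le> length xs"
proof -
  define s where "s = length xs"
  define p where "p n = k \<otimes> ev (take n xs)" for n
  define \<pi> where "\<pi> n = fold_by b (nf (p n))" for n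
  define B where "B n \<longleftrightarrow> nf (p n) \<noteq> [] \<and> hd (nf (p n)) = b" for n
  have tk: "take n xs \<in> lists X" for n using assms(3) by (auto dest: in_set_takeD)
  have pc: "p n \<in> carrier L" for n unfolding p_def using tk assms(4) by simp
  have X: "xs ! n \<in> X" if "n < s" for n using that assms(3) by (auto simp: s_def)
  have p_Suc: "p (Suc n) = p n \<otimes> xs ! n" if "n < s" for n
  proof -
    have "take n xs \<in> lists (carrier L)" using tk[of n] gens_closed by auto
    hence "ev (take (Suc n) xs) = ev (take n xs) \<otimes> xs ! n"
      using that X[OF that] foldr_mult_append[of "take n xs" "[xs ! n]"]
      by (simp add: take_Suc_conv_app_nth s_def del: foldr_append)
    thus ?thesis unfolding p_def using X[OF that] tk[of n] assms(4) by (simp add: m_assoc)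
  qed
  have ends: "p 0 = k" "p s = b \<otimes> k" using assms(4,5) by (auto simp: p_def s_def)
  have closed: "\<pi> 0 = \<pi> s" and B: "B s \<longleftrightarrow> \<not> B 0"
    unfolding \<pi>_def B_def ends using fold_by_mult[OF assms(4,1,2)] by auto
  have step: "\<pi> (Suc n) = \<pi> n @ [xs ! n] \<or> \<pi> n \<noteq> [] \<and> \<pi> (Suc n) = butlast (\<pi> n) \<or> \<pi> n = [] \<and> \<pi> (Suc n) = []"
    "B n \<noteq> B (Suc n) \<Longrightarrow> \<pi> n = [] \<and> \<pi> (Suc n) = []" if "n < s" for n
    using fold_by_step[OF pc[of n] X[OF that] assms(1,2)] p_Suc[OF that] unfolding \<pi>_def B_def by auto
  have "\<exists>n<s. B n \<noteq> B (Suc n)"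
  proof (rule ccontr)
    assume c: "\<not> ?thesis"
    have "n \<le> s \<Longrightarrow> B n = B 0" for n by (induction n) (use c in auto)
    thus False using B by blast
  qed
  then obtain r where r: "r < s" "\<pi> r = []" "\<pi> (Suc r) = []" using step(2) by blast
  \<comment> \<open>The steps away from the root and the steps towards it; the loop at time \<open>r\<close> is of neither kind.\<close>
  define In where "In = {n. n < s \<and> length (\<pi> (Suc n)) = Suc (length (\<pi> n))}"
  define Out where "Out = {n. n < s \<and> length (\<pi> n) = Suc (length (\<pi> (Suc n)))}"
  have inout: "w \<in> (\<lambda>n. \<pi> (Suc n)) ` In \<and> w \<in> \<pi> ` Out" if w: "w \<in> H" for w
  proof -
    define Q where "Q n \<longleftrightarrow> (\<exists>v. \<pi> n = w @ v)" for n
    obtain t where t: "t \<le> s" "Q t" using visited[OF w] by (auto simp: Q_def \<pi>_def p_def s_def)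
    have "\<not> Q r" using r w assms(7) by (auto simp: Q_def)
    note flip = cyclic_flip[of Q t s r, OF t(2,1) this less_imp_le[OF r(1)]]
    have "Q 0 = Q s" by (simp add: Q_def closed)
    with flip obtain m n where m: "m < s" "\<not> Q m" "Q (Suc m)" and n: "n < s" "Q n" "\<not> Q (Suc n)"
      by blast
    obtain v where v: "\<pi> (Suc m) = w @ v" using m by (auto simp: Q_def)
    have m': "\<pi> (Suc m) = \<pi> m @ [xs ! m]"
    proof -
      have "\<pi> m \<noteq> [] \<Longrightarrow> \<pi> (Suc m) \<noteq> butlast (\<pi> m)"
        using m(2) v unfolding Q_def by (metis append.assoc append_butlast_last_id)
      moreover have "\<pi> (Suc m) \<noteq> []" using v w assms(7) by auto
      ultimately show ?thesis using step(1)[OF m(1)] by blast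
    qed
    have "v = []"
    proof (cases v rule: rev_cases)
      case (snoc ys y)
      hence "\<pi> m = w @ ys" using m' v by simp
      thus ?thesis using m(2) unfolding Q_def by blast
    qed
    hence "w \<in> (\<lambda>n. \<pi> (Suc n)) ` In" using m' v m(1) by (auto simp: In_def intro!: image_eqI[of _ _ m])
    moreover
    obtain v' where v': "\<pi> n = w @ v'" using n by (auto simp: Q_def)
    have n': "\<pi> (Suc n) = butlast (\<pi> n)" "\<pi> n \<noteq> []"
      using step(1)[OF n(1)] n(3) v' w assms(7) unfolding Q_def by auto
    have "v' = []" using n(3) n'(1) v' unfolding Q_def by (cases v' rule: rev_cases) (auto simp: butlast_append)
    hence "w \<in> \<pi> ` Out" using n' v' n(1) by (auto simp: Out_def intro!: image_eqI[of _ _ n])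
    ultimately show ?thesis by blast
  qed
  have fin: "finite In" "finite Out" by (auto simp: In_def Out_def)
  have "card H \<le> card In" "card H \<le> card Out"
    using inout fin by (meson surj_card_le subsetI)+
  moreover have "card (In \<union> Out \<union> {r}) \<le> card {..<s}"
    by (rule card_mono) (auto simp: In_def Out_def r)
  moreover have "In \<inter> Out = {}" "r \<notin> In \<union> Out" using r by (auto simp: In_def Out_def)
  hence "card (In \<union> Out \<union> {r}) = card In + card Out + 1" using fin by (simp add: card_Un_disjoint)
  ultimately show ?thesis by (simp add: s_def)
qed

end

section \<open>Finite subtrees of the Cayley graph\<close>

context tree_group
begin

definition parent_edge where "parent_edge w = {ev w, ev (butlast w)}"

definition tree_graph where
  "tree_graph T = (ev ` T, parent_edge ` (T - {[]}))"

lemma red_butlast: "w \<in> red \<Longrightarrow> butlast w \<in> red"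
  by (cases w rule: rev_cases) (auto simp: red_append_iff)

lemma ev_inject: "w \<in> red \<Longrightarrow> w' \<in> red \<Longrightarrow> ev w = ev w' \<longleftrightarrow> w = w'"
  by (metis nf_ev)

lemma nf_parent_edge: "w \<in> red \<Longrightarrow> nf ` parent_edge w = {w, butlast w}"
  by (simp add: parent_edge_def red_butlast)

lemma mem_parent_edge:
  "w \<in> red \<Longrightarrow> u \<in> red \<Longrightarrow> ev u \<in> parent_edge w \<longleftrightarrow> u = w \<or> u = butlast w"
  by (auto simp: parent_edge_def ev_inject red_butlast)

lemma parent_edge_inject:
  assumes "w \<in> red" "w' \<in> red" "w \<noteq> []" "w' \<noteq> []"
  shows "parent_edge w = parent_edge w' \<longleftrightarrow> w = w'"
proof
  assume "parent_edge w = parent_edge w'"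
  hence "{w, butlast w} = {w', butlast w'}" using nf_parent_edge assms(1,2) by metis
  moreover have "length (butlast w) < length w" "length (butlast w') < length w'" using assms by auto
  ultimately show "w = w'" by (metis doubleton_eq_iff less_asym)
qed simp

text \<open>
  Multiplication by a generator on the right either adds a last letter or removes it. So every edge
  joins a vertex to its parent.
\<close>

lemma cayley_edge_iff:
  "d \<in> snd (cayley_graph L X) \<longleftrightarrow> (\<exists>w \<in> red. w \<noteq> [] \<and> d = parent_edge w)"
proof
  assume "d \<in> snd (cayley_graph L X)"
  then obtain g x where d: "d = {g, g \<otimes> x}" and g: "g \<in> carrier L" and x: "x \<in> X"
    unfolding cayley_graph_def by auto
  show "\<exists>w \<in> red. w \<noteq> [] \<and> d = parent_edge w"
  proof (cases "nf g \<noteq> [] \<and> last (nf g) = inv x")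
    case True
    hence "butlast (nf g) = nf (g \<otimes> x)" using nf_mult_gen[OF g x] by simp
    hence "d = parent_edge (nf g)" using g x by (auto simp: d parent_edge_def)
    thus ?thesis using True g by (intro bexI[of _ "nf g"]) auto
  next
    case False
    hence n: "nf (g \<otimes> x) = nf g @ [x]" using nf_mult_gen[OF g x] by auto
    have gx: "g \<otimes> x \<in> carrier L" using g x by simp
    have "d = {ev (nf (g \<otimes> x)), ev (butlast (nf (g \<otimes> x)))}"
      unfolding ev_nf[OF gx] by (simp add: n d g insert_commute)
    hence "d = parent_edge (nf (g \<otimes> x))" by (simp only: parent_edge_def)
    thus ?thesis using nf_red[OF gx] n by (intro bexI[of _ "nf (g \<otimes> x)"]) simp_all
  qed
next
  assume "\<exists>w \<in> red. w \<noteq> [] \<and> d = parent_edge w"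
  then obtain w where w: "w \<in> red" "w \<noteq> []" "d = parent_edge w" by blast
  then obtain u x where ux: "w = u @ [x]" by (cases w rule: rev_cases) auto
  hence u: "u \<in> red" "x \<in> X" using w(1) by (auto simp: red_append_iff red_Cons_iff)
  have "ev w = ev u \<otimes> x"
    using foldr_mult_append[OF red_closed[OF u(1)], of "[x]"] u ux by simp
  hence "d = {ev u, ev u \<otimes> x}" using w(3) ux by (auto simp: parent_edge_def)
  moreover have "ev u \<in> carrier L" using u by simp
  ultimately show "d \<in> snd (cayley_graph L X)" using u(2) unfolding cayley_graph_def by auto
qed

lemma cayley_edge_to_shorter:
  assumes "{ev u, ev w} \<in> snd (cayley_graph L X)" "u \<in> red" "w \<in> red" "length u \<le> length w"
  shows "w \<noteq> [] \<and> u = butlast w"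
proof -
  obtain w' where w': "w' \<in> red" "w' \<noteq> []" "{ev u, ev w} = parent_edge w'"
    using assms(1) cayley_edge_iff by auto
  have "nf ` {ev u, ev w} = {w', butlast w'}" using w' nf_parent_edge by simp
  hence "{u, w} = {w', butlast w'}" using assms by simp
  moreover have "length (butlast w') < length w'" using w'(2) by simp
  ultimately show ?thesis using w'(2) assms(4) by (metis doubleton_eq_iff linorder_not_less)
qed

text \<open>A cycle would pass, at a vertex farthest from \<open>\<one>\<close>, through the parent of that vertex twice.\<close>

lemma cayley_acyclic:
  assumes "fst T \<subseteq> carrier L" "snd T \<subseteq> snd (cayley_graph L X)"
  shows "\<not> graph_cycle T ps"
proof
  assume "graph_cycle T ps"
  hence c: "length ps \<ge> 3" "distinct ps" "set ps \<subseteq> carrier L"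
      "\<And>i. Suc i < length ps \<Longrightarrow> {ps ! i, ps ! Suc i} \<in> snd (cayley_graph L X)"
      "{last ps, hd ps} \<in> snd (cayley_graph L X)"
    unfolding graph_cycle_def using assms by blast+
  define n where "n = length ps"
  have adj: "{ps ! i, ps ! (Suc i mod n)} \<in> snd (cayley_graph L X)" if "i < n" for i
  proof (cases "Suc i < n")
    case False
    hence "Suc i = n" using that by simp
    moreover from this have "ps ! i = last ps" using c(1) n_def by (metis diff_Suc_1 last_conv_nth list.size(3) nat.distinct(1))
    moreover have "ps ! 0 = hd ps" using c(1) by (cases ps) simp_all
    ultimately show ?thesis using c(5) by simp
  qed (use c(4)[of i] n_def in simp)
  have "\<exists>i. i < n \<and> (\<forall>j. j < n \<longrightarrow> length (nf (ps ! j)) \<le> length (nf (ps ! i)))"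
  proof (rule ex_has_greatest_nat[where P = "\<lambda>i. i < n" and f = "\<lambda>i. length (nf (ps ! i))"])
    show "0 < n" using c(1) n_def by linarith
    show "\<forall>j. j < n \<longrightarrow> length (nf (ps ! j)) < Suc (Max ((\<lambda>j. length (nf (ps ! j))) ` {..<n}))"
      by (auto simp: less_Suc_eq_le)
  qed
  then obtain i where i: "i < n" "\<And>j. j < n \<Longrightarrow> length (nf (ps ! j)) \<le> length (nf (ps ! i))" by blast
  have pc: "ps ! j \<in> carrier L" if "j < n" for j using c(3) that n_def by auto
  define j where "j = Suc i mod n"
  define k where "k = (i + (n - 1)) mod n"
  have jk: "j < n" "k < n" "Suc k mod n = i"
  proof -
    show "j < n" "k < n" using i(1) by (simp_all add: j_def k_def)
    have "Suc k mod n = Suc (i + (n - 1)) mod n" unfolding k_def by (simp add: mod_Suc_eq)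
    also have "Suc (i + (n - 1)) = i + n" using i(1) by simp
    finally show "Suc k mod n = i" using i(1) by simp
  qed
  have "nf (ps ! j) = butlast (nf (ps ! i))"
    using cayley_edge_to_shorter[of "nf (ps ! j)" "nf (ps ! i)"] adj[OF i(1)] i(2)[OF jk(1)] pc i(1) jk
    by (simp add: j_def insert_commute)
  moreover have "nf (ps ! k) = butlast (nf (ps ! i))"
    using cayley_edge_to_shorter[of "nf (ps ! k)" "nf (ps ! i)"] adj[OF jk(2)] i(2)[OF jk(2)] pc i(1) jk
    by simp
  ultimately have "ps ! j = ps ! k" using nf_inject pc jk by metis
  hence "j = k" using c(2) jk n_def by (simp add: nth_eq_iff_index_eq)
  hence "Suc j mod n = i" using jk by simp
  hence "(i + 2) mod n = i mod n" using i(1) by (simp add: j_def mod_Suc_eq)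
  hence "n dvd (i + 2) - i" by (subst (asm) mod_eq_dvd_iff_nat) auto
  thus False using c(1) n_def by (auto dest: dvd_imp_le)
qed

lemma tree_graph_in_rooted_subtrees:
  assumes T: "T \<in> trees {v}"
  shows "tree_graph T \<in> rooted_subtrees L X v"
proof -
  let ?E = "parent_edge ` (T - {[]})"
  have fT: "finite T" "[] \<in> T" "T \<subseteq> red"
    and pT: "\<And>w. w \<in> T \<Longrightarrow> w \<noteq> [] \<Longrightarrow> hd w = v \<and> butlast w \<in> T"
    using T unfolding rooted_trees_def by auto
  have Ecay: "?E \<subseteq> snd (cayley_graph L X)" using fT cayley_edge_iff by auto
  have car: "ev ` T \<subseteq> carrier L" using fT by auto
  have sub: "subgraph (tree_graph T) (cayley_graph L X)"
    using Ecay car pT unfolding subgraph_def tree_graph_def cayley_graph_def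
    by (auto simp: parent_edge_def)
  define R where "R = {(p, q). {p, q} \<in> ?E}"
  have symR: "sym (R\<^sup>*)"
    by (rule sym_rtrancl) (auto simp: R_def sym_def insert_commute)
  have root: "(ev w, \<one>) \<in> R\<^sup>*" if "w \<in> T" for w
    using that
  proof (induction w rule: rev_induct)
    case (snoc x w)
    have "w \<in> T" using pT[OF snoc.prems] by simp
    moreover have "(ev (w @ [x]), ev w) \<in> R"
      unfolding R_def using snoc.prems by (auto simp: parent_edge_def intro!: image_eqI[of _ _ "w @ [x]"])
    ultimately show ?case using snoc.IH by (meson converse_rtrancl_into_rtrancl)
  qed simp
  have "graph_connected (tree_graph T)"
    unfolding graph_connected_def tree_graph_def fst_conv snd_conv R_def[symmetric]
    using fT(2) root symR by (auto intro: rtrancl_trans[OF root symD[OF symR root]])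
  moreover have "\<nexists>ps. graph_cycle (tree_graph T) ps"
    using cayley_acyclic[of "tree_graph T"] Ecay car by (auto simp: tree_graph_def)
  moreover have "u = v" if u: "u \<in> ev ` T" "{\<one>, u} \<in> snd (cayley_graph L X)" for u
  proof -
    obtain w where w: "w \<in> T" "u = ev w" using u by auto
    have "{ev [], ev w} \<in> snd (cayley_graph L X)" using u w by simp
    from cayley_edge_to_shorter[OF this] fT w have "w \<noteq> []" "butlast w = []" by auto
    hence "w = [v]" using pT[OF w(1)] by (cases w) (auto split: if_splits)
    thus ?thesis using w fT by (auto simp: red_Cons_iff)
  qed
  moreover have "\<one> \<in> ev ` T" using fT(2) by (auto intro!: image_eqI[of _ _ "[]"])
  ultimately show ?thesis
    unfolding rooted_subtrees_def is_tree_def using sub fT(1) by (auto simp: tree_graph_def)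
qed

text \<open>
  A path in a subtree from a descendant of \<open>w\<close> to \<open>\<one>\<close> has to use the edge from \<open>w\<close> to its
  parent. So connectedness alone makes the vertex set prefix-closed, and the edges are forced.
\<close>

lemma rooted_subtree_eq_tree_graph:
  assumes T: "T \<in> rooted_subtrees L X v"
  shows "nf ` fst T \<in> trees {v}" and "tree_graph (nf ` fst T) = T"
proof -
  have sub: "fst T \<subseteq> carrier L" "snd T \<subseteq> snd (cayley_graph L X)" "\<And>d. d \<in> snd T \<Longrightarrow> d \<subseteq> fst T"
    and fin: "finite (fst T)" and one: "\<one> \<in> fst T"
    and conn: "\<And>u w. u \<in> fst T \<Longrightarrow> w \<in> fst T \<Longrightarrow> (u, w) \<in> {(p, q). {p, q} \<in> snd T}\<^sup>*"
    and nbr: "\<And>u. u \<in> fst T \<Longrightarrow> {\<one>, u} \<in> snd (cayley_graph L X) \<Longrightarrow> u = v"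
    using T unfolding rooted_subtrees_def subgraph_def is_tree_def graph_connected_def cayley_graph_def
    by auto
  have mem: "u \<in> nf ` fst T \<longleftrightarrow> ev u \<in> fst T" if "u \<in> red" for u
    using sub(1) that by (auto simp: image_iff) (metis nf_ev)
  have edge: "parent_edge w \<in> snd T" if w: "w \<in> nf ` fst T" "w \<noteq> []" for w
  proof (rule ccontr)
    assume no: "parent_edge w \<notin> snd T"
    have wr: "w \<in> red" using w sub(1) by auto
    have "\<exists>u. nf q = w @ u" if "(ev w, q) \<in> {(p, q). {p, q} \<in> snd T}\<^sup>*" for q
      using that
    proof (induction rule: rtrancl_induct)
      case base
      show ?case using wr by simp
    next
      case (step p q)
      have pq: "{p, q} \<in> snd T" using step by simp
      hence "{p, q} \<in> snd (cayley_graph L X)" using sub(2) by auto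
      then obtain w' where w': "w' \<in> red" "w' \<noteq> []" "{p, q} = parent_edge w'"
        using cayley_edge_iff by auto
      have "nf ` {p, q} = {w', butlast w'}" using w' nf_parent_edge by simp
      hence "{nf p, nf q} = {w', butlast w'}" by simp
      moreover have "w' \<noteq> w" using no pq w' by auto
      moreover obtain u where u: "nf p = w @ u" using step by auto
      ultimately show ?case
      proof (auto simp: doubleton_eq_iff, goal_cases)
        case 1
        thus ?case by (metis append_Nil2 butlast_append)
      next
        case 2
        thus ?case using w'(2) by (metis append.assoc append_butlast_last_id)
      qed
    qed
    from this[OF conn[of "ev w" \<one>]] show False using w mem[OF wr] one by auto
  qed
  have bl: "butlast w \<in> nf ` fst T" if "w \<in> nf ` fst T" "w \<noteq> []" for w
  proof -
    have "ev (butlast w) \<in> fst T" using edge[OF that] sub(3) by (auto simp: parent_edge_def)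
    moreover have "w \<in> red" using that sub(1) by auto
    ultimately show ?thesis using mem[of "butlast w"] red_butlast by blast
  qed
  have hd: "hd w = v" if "w \<in> nf ` fst T" "w \<noteq> []" for w
    using that
  proof (induction w rule: rev_induct)
    case (snoc x w)
    show ?case
    proof (cases "w = []")
      case True
      have "nf ` fst T \<subseteq> red" using sub(1) by auto
      hence "[x] \<in> red" using snoc.prems True by auto
      hence x: "[x] \<in> red" "x \<in> X" by (auto simp: red_Cons_iff)
      hence "x \<in> fst T" using mem[of "[x]"] snoc.prems True by simp
      moreover have "parent_edge [x] \<in> snd T" using edge[of "[x]"] snoc.prems True by simp
      hence "{\<one>, x} \<in> snd (cayley_graph L X)"
        using sub(2) x by (auto simp: parent_edge_def insert_commute)
      ultimately show ?thesis using nbr True by simp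
    qed (use snoc bl[of "w @ [x]"] in simp)
  qed simp
  show "nf ` fst T \<in> trees {v}"
    unfolding rooted_trees_def using fin one sub(1) bl hd by (auto intro!: image_eqI[of _ _ \<one>])
  have "ev ` nf ` fst T = fst T" using sub(1) by (force simp: image_image)
  moreover have "parent_edge ` (nf ` fst T - {[]}) = snd T"
  proof (intro equalityI subsetI)
    fix d assume d: "d \<in> snd T"
    then obtain w where w: "w \<in> red" "w \<noteq> []" "d = parent_edge w"
      using sub(2) cayley_edge_iff by blast
    hence "ev w \<in> fst T" using sub(3)[OF d] by (auto simp: parent_edge_def)
    thus "d \<in> parent_edge ` (nf ` fst T - {[]})" using w mem by blast
  qed (use edge in auto)
  ultimately show "tree_graph (nf ` fst T) = T" by (simp add: tree_graph_def)
qed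

lemma tree_graph_bij:
  "bij_betw tree_graph (trees {v}) (rooted_subtrees L X v)"
proof (rule bij_betw_byWitness[where f' = "\<lambda>T. nf ` fst T"])
  show "\<forall>T\<in>trees {v}. nf ` fst (tree_graph T) = T"
    unfolding rooted_trees_def tree_graph_def by (auto simp: image_image subset_iff image_iff)
qed (use rooted_subtree_eq_tree_graph tree_graph_in_rooted_subtrees in blast)+

text \<open>
  The root is a leaf because \<open>v\<close> is its only possible neighbour. Any other vertex has an edge to its
  parent, so it is a leaf if and only if it has no child.
\<close>

lemma leaves_tree_graph:
  assumes T: "T \<in> trees {v}"
  shows "leaves (tree_graph T) = ev ` insert [] {t \<in> T. tip T t}"
proof -
  have fT: "finite T" "[] \<in> T" "T \<subseteq> red"
    and pT: "\<And>w. w \<in> T \<Longrightarrow> w \<noteq> [] \<Longrightarrow> hd w = v \<and> butlast w \<in> T"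
    using T unfolding rooted_trees_def by auto
  let ?inc = "\<lambda>t. {d \<in> parent_edge ` (T - {[]}). ev t \<in> d}"
  have inc: "?inc t = parent_edge ` {w \<in> T - {[]}. t = w \<or> t = butlast w}" if "t \<in> T" for t
    using fT that mem_parent_edge by (auto simp: subset_iff)
  have val: "valence (tree_graph T) (ev t) = card {w \<in> T - {[]}. t = w \<or> t = butlast w}" if "t \<in> T" for t
  proof -
    have "inj_on parent_edge {w \<in> T - {[]}. t = w \<or> t = butlast w}"
      by (rule inj_onI) (use fT parent_edge_inject in blast)
    thus ?thesis unfolding valence_def tree_graph_def snd_conv inc[OF that] by (rule card_image)
  qed
  have "valence (tree_graph T) (ev t) \<le> 1 \<longleftrightarrow> t = [] \<or> tip T t" if t: "t \<in> T" for t
  proof -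
    let ?W = "{w \<in> T - {[]}. t = w \<or> t = butlast w}"
    have fW: "finite ?W" using fT by simp
    show ?thesis
    proof (cases "t = []")
      case True
      have "?W \<subseteq> {[v]}"
      proof
        fix w assume "w \<in> ?W"
        hence "w \<in> T" "w \<noteq> []" "butlast w = []" using True by auto
        thus "w \<in> {[v]}" using pT[of w] by (cases w) (auto split: if_splits)
      qed
      hence "card ?W \<le> card {[v]}" by (intro card_mono) auto
      thus ?thesis using val[OF t] True by simp
    next
      case False
      show ?thesis
      proof (cases "tip T t")
        case True
        have "?W \<subseteq> {t}"
        proof
          fix w assume w: "w \<in> ?W"
          have "t \<noteq> butlast w"
          proof
            assume "t = butlast w"
            hence "t @ [last w] \<in> T" using w by simp
            thus False using True unfolding tip_def by blast
          qed
          thus "w \<in> {t}" using w by simp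
        qed
        hence "card ?W \<le> card {t}" by (intro card_mono) auto
        thus ?thesis using val[OF t] True by simp
      next
        case ntip: False
        then obtain x where x: "t @ [x] \<in> T" by (auto simp: tip_def)
        hence "{t, t @ [x]} \<subseteq> ?W" using t False by auto
        from card_mono[OF fW this] have "2 \<le> card ?W" by simp
        thus ?thesis using val[OF t] ntip False by simp
      qed
    qed
  qed
  moreover have "fst (tree_graph T) = ev ` T" by (simp add: tree_graph_def)
  ultimately have "leaves (tree_graph T) = ev ` {t \<in> T. t = [] \<or> tip T t}"
    unfolding leaves_def by auto
  also have "{t \<in> T. t = [] \<or> tip T t} = insert [] {t \<in> T. tip T t}" using fT(2) by auto
  finally show ?thesis .
qed

text \<open>
  The non-leaves of a subtree are the vertices of its rooted tree that are neither the root nor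
  tips, and its leaves other than \<open>\<one>\<close> are the tips other than the root.
\<close>

lemma subtree_series_subst:
  assumes "v \<in> X" "fps_X dvd p" "fps_X dvd q"
  shows "fps_subst2 (subtree_series L X v) p q
    = formal_sum (trees {v}) (tree_weight p q)"
proof -
  let ?R = "trees {v}"
  define a where "a T = card {t \<in> T - {[]}. \<not> tip T t}" for T :: "'a list set"
  define b where "b T = card {t \<in> T - {[]}. tip T t}" for T :: "'a list set"
  have ab: "card (fst (tree_graph T) - leaves (tree_graph T)) = a T"
    "card (leaves (tree_graph T) - {\<one>}) = b T" if T: "T \<in> ?R" for T
  proof -
    have fT: "[] \<in> T" "T \<subseteq> red" using T unfolding rooted_trees_def by auto
    have inj: "inj_on ev T" using fT(2) spelling_unique by (rule inj_on_subset[rotated])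
    have "fst (tree_graph T) - leaves (tree_graph T) = ev ` (T - insert [] {t \<in> T. tip T t})"
      unfolding leaves_tree_graph[OF T] using fT unfolding tree_graph_def fst_conv
      by (intro inj_on_image_set_diff[symmetric, OF inj]) auto
    also have "T - insert [] {t \<in> T. tip T t} = {t \<in> T - {[]}. \<not> tip T t}" by auto
    finally show "card (fst (tree_graph T) - leaves (tree_graph T)) = a T"
      unfolding a_def using card_image[OF inj_on_subset[OF inj]] by auto
    have "leaves (tree_graph T) - {\<one>} = ev ` insert [] {t \<in> T. tip T t} - ev ` {[]}"
      unfolding leaves_tree_graph[OF T] by simp
    also have "\<dots> = ev ` (insert [] {t \<in> T. tip T t} - {[]})"
      using fT by (intro inj_on_image_set_diff[symmetric, OF inj]) auto
    also have "insert [] {t \<in> T. tip T t} - {[]} = {t \<in> T - {[]}. tip T t}" by auto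
    finally show "card (leaves (tree_graph T) - {\<one>}) = b T"
      unfolding b_def using card_image[OF inj_on_subset[OF inj]] by auto
  qed
  have cT: "card T = Suc (a T + b T)" if T: "T \<in> ?R" for T
  proof -
    have fT: "[] \<in> T" "finite T" using T unfolding rooted_trees_def by auto
    have "T - {[]} = {t \<in> T - {[]}. \<not> tip T t} \<union> {t \<in> T - {[]}. tip T t}" by auto
    hence "card (T - {[]}) = card ({t \<in> T - {[]}. \<not> tip T t} \<union> {t \<in> T - {[]}. tip T t})"
      by (rule arg_cong)
    also have "\<dots> = a T + b T"
      unfolding a_def b_def using fT by (intro card_Un_disjoint) auto
    finally have "card (T - {[]}) = a T + b T" .
    thus ?thesis using fT by (simp add: card_Diff_singleton) (metis Suc_pred card_gt_0_iff empty_iff)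
  qed
  have "fps_subst2 (subtree_series L X v) p q = formal_sum ?R (\<lambda>T. p ^ a T * q ^ b T)"
  proof (rule fps_subst2_eq_formal_sum)
    fix i j
    show "finite {T \<in> ?R. a T = i \<and> b T = j}"
      by (rule finite_subset[OF _ finite_rooted_trees_card_le[OF finite_gens, of "m_inv L" "{v}" "Suc (i + j)"]])
        (use cT in auto)
    have "bij_betw tree_graph {T \<in> ?R. a T = i \<and> b T = j}
      {T \<in> rooted_subtrees L X v. card (fst T - leaves T) = i \<and> card (leaves T - {\<one>}) = j}"
      by (rule bij_betw_Collect[OF tree_graph_bij]) (simp add: ab)
    from bij_betw_same_card[OF this]
    show "fps_nth (fps_nth (subtree_series L X v) i) j = int (card {T \<in> ?R. a T = i \<and> b T = j})"
      by (simp add: subtree_series_def)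
  next
    fix n i j :: nat assume "n < i + j"
    moreover have "fps_X ^ (i + j) dvd p ^ i * q ^ j"
      unfolding power_add by (intro mult_dvd_mono dvd_power_same assms)
    ultimately show "fps_nth (p ^ i * q ^ j) n = 0" using fps_X_power_dvd_nth_zero by blast
  qed
  also have "\<dots> = formal_sum ?R (tree_weight p q)"
    by (rule formal_sum_cong) (auto simp: a_def b_def tree_weight_eq_powers rooted_trees_def)
  finally show ?thesis .
qed

end

section \<open>Wreath products\<close>

locale group_pair = group L + G: group G
  for L :: "('l, 'd) monoid_scheme" (structure) and G :: "('g, 'c) monoid_scheme"
begin

abbreviation W where "W \<equiv> wreath_product G L"

abbreviation W_times (infixl "\<star>" 70) where "g \<star> h \<equiv> g \<otimes>\<^bsub>W\<^esub> h"
abbreviation G_times (infixl "\<odot>" 70) where "g \<odot> h \<equiv> g \<otimes>\<^bsub>G\<^esub> h"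
abbreviation G_one ("\<one>\<^sub>G") where "\<one>\<^sub>G \<equiv> \<one>\<^bsub>G\<^esub>"

definition base where
  "base = {\<eta> \<in> carrier L \<rightarrow>\<^sub>E carrier G. finite {i \<in> carrier L. \<eta> i \<noteq> \<one>\<^sub>G}}"

definition dark where "dark = (\<lambda>i \<in> carrier L. \<one>\<^sub>G)"

lemma W_carrier: "carrier W = base \<times> carrier L"
  unfolding wreath_product_def base_def by (simp add: Let_def carrier_sum_group G.is_group)

lemma W_mult: "(\<eta>, m) \<star> (\<theta>, n) = (\<lambda>i \<in> carrier L. \<eta> i \<odot> \<theta> (inv m \<otimes> i), m \<otimes> n)"
  unfolding wreath_product_def translate_def by (simp add: Let_def restrict_def) auto

lemma W_one: "\<one>\<^bsub>W\<^esub> = (dark, \<one>)"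
  unfolding wreath_product_def dark_def by (simp add: Let_def)

lemma base_closed: "\<eta> \<in> base \<Longrightarrow> i \<in> carrier L \<Longrightarrow> \<eta> i \<in> carrier G"
  unfolding base_def by auto

lemma base_finite_support: "\<eta> \<in> base \<Longrightarrow> finite {i \<in> carrier L. \<eta> i \<noteq> \<one>\<^sub>G}"
  unfolding base_def by auto

lemma base_eqI:
  "\<eta> \<in> base \<Longrightarrow> \<theta> \<in> base \<Longrightarrow> (\<And>i. i \<in> carrier L \<Longrightarrow> \<eta> i = \<theta> i) \<Longrightarrow> \<eta> = \<theta>"
  unfolding base_def by (auto intro: PiE_ext)

lemma restrict_base:
  assumes "\<And>i. i \<in> carrier L \<Longrightarrow> f i \<in> carrier G" "finite A"
    "\<And>i. i \<in> carrier L \<Longrightarrow> f i \<noteq> \<one>\<^sub>G \<Longrightarrow> i \<in> A"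
  shows "(\<lambda>i \<in> carrier L. f i) \<in> base"
proof -
  have "{i \<in> carrier L. (\<lambda>i \<in> carrier L. f i) i \<noteq> \<one>\<^sub>G} \<subseteq> A" using assms(3) by auto
  hence "finite {i \<in> carrier L. (\<lambda>i \<in> carrier L. f i) i \<noteq> \<one>\<^sub>G}"
    by (rule finite_subset) (rule assms(2))
  moreover have "(\<lambda>i \<in> carrier L. f i) \<in> carrier L \<rightarrow>\<^sub>E carrier G" using assms(1) by auto
  ultimately show ?thesis unfolding base_def by blast
qed

lemma finite_translated_support:
  assumes "\<theta> \<in> base" "m \<in> carrier L"
  shows "finite {i \<in> carrier L. \<theta> (m \<otimes> i) \<noteq> \<one>\<^sub>G}"
proof (rule finite_subset)
  show "{i \<in> carrier L. \<theta> (m \<otimes> i) \<noteq> \<one>\<^sub>G} \<subseteq> (\<otimes>) (inv m) ` {i \<in> carrier L. \<theta> i \<noteq> \<one>\<^sub>G}"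
  proof
    fix i assume i: "i \<in> {i \<in> carrier L. \<theta> (m \<otimes> i) \<noteq> \<one>\<^sub>G}"
    show "i \<in> (\<otimes>) (inv m) ` {i \<in> carrier L. \<theta> i \<noteq> \<one>\<^sub>G}"
      using i assms(2) by (intro image_eqI[of _ _ "m \<otimes> i"]) auto
  qed
  show "finite ((\<otimes>) (inv m) ` {i \<in> carrier L. \<theta> i \<noteq> \<one>\<^sub>G})"
    using base_finite_support[OF assms(1)] by simp
qed

lemma dark_base: "dark \<in> base"
  unfolding dark_def by (rule restrict_base[of _ "{}"]) auto

lemma base_mult_closed:
  assumes "\<eta> \<in> base" "\<theta> \<in> base" "m \<in> carrier L"
  shows "(\<lambda>i \<in> carrier L. \<eta> i \<odot> \<theta> (m \<otimes> i)) \<in> base"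
proof (rule restrict_base)
  show "finite ({i \<in> carrier L. \<eta> i \<noteq> \<one>\<^sub>G} \<union> {i \<in> carrier L. \<theta> (m \<otimes> i) \<noteq> \<one>\<^sub>G})"
    using base_finite_support[OF assms(1)] finite_translated_support[OF assms(2,3)] by simp
qed (use assms base_closed in auto)

lemma group_W: "group W"
proof (rule groupI)
  fix g h assume "g \<in> carrier W" "h \<in> carrier W"
  thus "g \<star> h \<in> carrier W"
    by (auto simp: W_carrier W_mult base_mult_closed)
next
  show "\<one>\<^bsub>W\<^esub> \<in> carrier W" by (simp add: W_one W_carrier dark_base)
next
  fix g h k assume "g \<in> carrier W" "h \<in> carrier W" "k \<in> carrier W"
  then obtain \<eta> m \<theta> n \<xi> l where *: "g = (\<eta>, m)" "h = (\<theta>, n)" "k = (\<xi>, l)"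
      "\<eta> \<in> base" "m \<in> carrier L" "\<theta> \<in> base" "n \<in> carrier L" "\<xi> \<in> base" "l \<in> carrier L"
    by (auto simp: W_carrier)
  show "g \<star> h \<star> k = g \<star> (h \<star> k)"
    unfolding * W_mult using *
    by (auto intro!: restrict_ext simp: base_closed G.m_assoc m_assoc inv_mult_group)
next
  fix g assume "g \<in> carrier W"
  then obtain \<eta> m where *: "g = (\<eta>, m)" "\<eta> \<in> base" "m \<in> carrier L" by (auto simp: W_carrier)
  have "\<one>\<^bsub>W\<^esub> \<star> g = ((\<lambda>i \<in> carrier L. \<eta> i), m)"
    unfolding * W_mult W_one dark_def using * by (auto intro!: restrict_ext simp: base_closed)
  also have "(\<lambda>i \<in> carrier L. \<eta> i) = \<eta>"
    using *(2) unfolding base_def by (auto simp: PiE_def extensional_restrict)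
  finally show "\<one>\<^bsub>W\<^esub> \<star> g = g" using * by simp
  let ?h = "(\<lambda>i \<in> carrier L. inv\<^bsub>G\<^esub> \<eta> (m \<otimes> i), inv m)"
  have "?h \<star> g = \<one>\<^bsub>W\<^esub>"
    unfolding * W_mult W_one dark_def using * by (auto intro!: restrict_ext simp: base_closed)
  moreover have "(\<lambda>i \<in> carrier L. inv\<^bsub>G\<^esub> \<eta> (m \<otimes> i)) \<in> base"
    by (rule restrict_base[OF _ finite_translated_support[OF *(2,3)]]) (use * base_closed in auto)
  ultimately show "\<exists>h \<in> carrier W. h \<star> g = \<one>\<^bsub>W\<^esub>"
    using * by (intro bexI[of _ ?h]) (auto simp: W_carrier)
qed

end

section \<open>Words in lamplighter groups\<close>

locale lamplighter = tree_group L X + G: group G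
  for L :: "('l, 'd) monoid_scheme" (structure) and X and G :: "('g, 'c) monoid_scheme" +
  fixes Y
  assumes Y: "finite_symmetric_generating_set G Y"
begin

sublocale group_pair L G ..

sublocale W: group W by (rule group_W)

abbreviation Z where "Z \<equiv> wreath_gens G L X Y"

abbreviation Ylen where "Ylen \<equiv> word_length G Y"

lemma Y_closed: "Y \<subseteq> carrier G"
  using Y by (simp add: finite_symmetric_generating_set_def)

lemma lamp_one: "lamp G L \<one>\<^sub>G = dark"
  by (auto simp: lamp_def dark_def)

lemma lamp_base: "g \<in> carrier G \<Longrightarrow> lamp G L g \<in> base"
  unfolding lamp_def by (rule restrict_base[of _ "{\<one>}"]) (auto split: if_splits)

lemma Z_eq: "Z = (\<lambda>x. (dark, x)) ` X \<union> (\<lambda>y. (lamp G L y, \<one>)) ` Y"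
  unfolding wreath_gens_def lamp_one by auto

lemma Z_closed: "Z \<subseteq> carrier W"
  unfolding Z_eq using Y_closed by (auto simp: W_carrier dark_base lamp_base)

lemma spells_step: "x \<in> X \<Longrightarrow> W.spells Z 1 (dark, x)"
  by (rule W.spells_gen[OF _ Z_closed]) (simp add: Z_eq)

lemma spells_cursor: "a \<in> carrier L \<Longrightarrow> \<exists>n. W.spells Z n (dark, a)"
proof -
  have "\<exists>n. W.spells Z n (dark, ev w)" if "w \<in> lists X" for w
    using that
  proof (induction w)
    case Nil
    have "W.spells Z 0 \<one>\<^bsub>W\<^esub>" unfolding W.spells_def by (rule bexI[of _ "[]"]) auto
    thus ?case by (auto simp: W_one)
  next
    case (Cons x w)
    then obtain n where "W.spells Z n (dark, ev w)" by auto
    from W.spells_mult[OF Z_closed spells_step this, of x] Cons.hyps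
    have "W.spells Z (1 + n) ((dark, x) \<star> (dark, ev w))" by auto
    moreover have "(dark, x) \<star> (dark, ev w) = (dark, ev (x # w))"
      unfolding W_mult dark_def using Cons.hyps by (auto intro!: restrict_ext)
    ultimately show ?case by auto
  qed
  moreover assume "a \<in> carrier L"
  ultimately show ?thesis using ev_nf nf_red unfolding reduced_words_def by (metis (no_types, lifting) mem_Collect_eq)
qed

lemma spells_lamp:
  assumes "g \<in> carrier G"
  shows "W.spells Z (Ylen g) (lamp G L g, \<one>)"
proof -
  obtain ys where ys: "ys \<in> lists Y" "G.ev ys = g" "length ys = Ylen g"
    using word_length_attained[OF G.generating_set_spells[OF Y assms]] by blast
  have "W.ev (map (\<lambda>y. (lamp G L y, \<one>)) ys) = (lamp G L (G.ev ys), \<one>)"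
    using ys(1)
  proof (induction ys)
    case (Cons y ys)
    have "y \<in> carrier G" "ys \<in> lists (carrier G)" using Cons.hyps Y_closed by auto
    thus ?case using Cons.IH G.foldr_mult_closed[of ys]
      by (auto simp: W_mult lamp_def intro!: restrict_ext)
  qed (simp add: W_one lamp_one)
  thus ?thesis unfolding W.spells_def using ys
    by (intro bexI[of _ "map (\<lambda>y. (lamp G L y, \<one>)) ys"]) (auto simp: Z_eq)
qed

text \<open>
  A subtree can be toured by a closed walk that uses each edge twice, and the lamps are lit on
  the way. For the induction one branch is cut off and toured on its own, from its own root.
\<close>

lemma spells_lamps_on_tree:
  assumes "T \<in> trees S" "\<zeta> \<in> base"
    "\<And>i. i \<in> carrier L \<Longrightarrow> \<zeta> i \<noteq> \<one>\<^sub>G \<Longrightarrow> nf i \<in> T"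
  shows "W.spells Z (2 * (card T - 1) + (\<Sum>t\<in>T. Ylen (\<zeta> (ev t)))) (\<zeta>, \<one>)"
  using assms
proof (induction "card T" arbitrary: T S \<zeta> rule: less_induct)
  case less
  note T = less.prems(1) and \<zeta> = less.prems(2,3)
  have fT: "finite T" "[] \<in> T" "T \<subseteq> red" using T unfolding rooted_trees_def by auto
  show ?case
  proof (cases "T = {[]}")
    case True
    have "\<zeta> i = \<one>\<^sub>G" if "i \<in> carrier L" "i \<noteq> \<one>" for i
      using \<zeta>(2)[OF that(1)] True that nf_inject[OF that(1) one_closed] by auto
    hence "\<zeta> = lamp G L (\<zeta> \<one>)"
      by (intro base_eqI \<zeta>(1) lamp_base) (auto simp: base_closed[OF \<zeta>(1)] lamp_def)
    thus ?thesis using spells_lamp[OF base_closed[OF \<zeta>(1) one_closed]] True by simp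
  next
    case False
    obtain x T1 T2 where x: "x \<in> X" and T1: "T1 \<in> trees S"
      and T2: "T2 \<in> trees (X - {inv x})"
      and TT: "T = T1 \<union> (#) x ` T2" "T1 \<inter> (#) x ` T2 = {}"
      by (rule rooted_tree_cut[OF T False])
    have f1: "finite T1" "[] \<in> T1" "T1 \<subseteq> red" using T1 unfolding rooted_trees_def by auto
    have f2: "finite T2" "[] \<in> T2" "T2 \<subseteq> red" "\<And>t. t \<in> T2 \<Longrightarrow> t \<noteq> [] \<Longrightarrow> hd t \<noteq> inv x"
      using T2 unfolding rooted_trees_def by auto
    have c2: "card ((#) x ` T2) = card T2" by (rule card_image) (simp add: inj_on_def)
    have c: "card T = card T1 + card T2" "card T1 > 0" "card T2 > 0"
      unfolding TT(1) using f1 f2 TT(2) c2 by (auto simp: card_Un_disjoint card_gt_0_iff)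
    define \<zeta>1 where "\<zeta>1 = (\<lambda>i \<in> carrier L. if nf i \<in> T1 then \<zeta> i else \<one>\<^sub>G)"
    define \<zeta>2 where "\<zeta>2 = (\<lambda>i \<in> carrier L. if nf i \<in> T2 then \<zeta> (x \<otimes> i) else \<one>\<^sub>G)"
    have b1: "\<zeta>1 \<in> base" unfolding \<zeta>1_def
      by (rule restrict_base[OF _ base_finite_support[OF \<zeta>(1)]])
        (auto simp: base_closed[OF \<zeta>(1)] split: if_splits)
    have b2: "\<zeta>2 \<in> base" unfolding \<zeta>2_def
      by (rule restrict_base[OF _ finite_translated_support[OF \<zeta>(1), of x]])
        (auto simp: base_closed[OF \<zeta>(1)] x split: if_splits)
    have IH1: "W.spells Z (2 * (card T1 - 1) + (\<Sum>t\<in>T1. Ylen (\<zeta>1 (ev t)))) (\<zeta>1, \<one>)"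
      by (rule less.hyps[OF _ T1 b1]) (use c in \<open>auto simp: \<zeta>1_def split: if_splits\<close>)
    have IH2: "W.spells Z (2 * (card T2 - 1) + (\<Sum>t\<in>T2. Ylen (\<zeta>2 (ev t)))) (\<zeta>2, \<one>)"
      by (rule less.hyps[OF _ T2 b2]) (use c in \<open>auto simp: \<zeta>2_def split: if_splits\<close>)
    let ?n1 = "2 * (card T1 - 1) + (\<Sum>t\<in>T1. Ylen (\<zeta>1 (ev t)))"
    let ?n2 = "2 * (card T2 - 1) + (\<Sum>t\<in>T2. Ylen (\<zeta>2 (ev t)))"
    have prod: "W.spells Z (?n1 + (1 + (?n2 + 1)))
        ((\<zeta>1, \<one>) \<star> ((dark, x) \<star> ((\<zeta>2, \<one>) \<star> (dark, inv x))))"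
      by (intro W.spells_mult Z_closed IH1 IH2 spells_step x inv_gens)
    have "\<zeta> i = \<zeta>1 i \<odot> \<zeta>2 (inv x \<otimes> i)" if i: "i \<in> carrier L" for i
    proof -
      have xi: "inv x \<otimes> i \<in> carrier L" "x \<otimes> (inv x \<otimes> i) = i" using i x by simp_all
      have "nf (inv x \<otimes> i) \<in> T2 \<longleftrightarrow> nf i \<in> (#) x ` T2"
      proof
        assume "nf (inv x \<otimes> i) \<in> T2"
        moreover from this have "nf i = x # nf (inv x \<otimes> i)"
          using nf_gen_mult[OF xi(1) x] f2(4) xi(2) by auto
        ultimately show "nf i \<in> (#) x ` T2" by simp
      next
        assume "nf i \<in> (#) x ` T2"
        then obtain t where t: "t \<in> T2" "nf i = x # t" by auto
        have "nf (inv x \<otimes> i) = t" using nf_gen_mult[OF i inv_gens[OF x]] t(2) x by simp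
        thus "nf (inv x \<otimes> i) \<in> T2" using t by simp
      qed
      thus ?thesis using \<zeta>(2)[OF i] TT i xi base_closed[OF \<zeta>(1) i] unfolding \<zeta>1_def \<zeta>2_def by auto
    qed
    hence "\<zeta> = (\<lambda>i \<in> carrier L. \<zeta>1 i \<odot> \<zeta>2 (inv x \<otimes> i))"
      using base_eqI[OF \<zeta>(1) base_mult_closed[OF b1 b2]] x by simp
    moreover have "(\<zeta>1, \<one>) \<star> ((dark, x) \<star> ((\<zeta>2, \<one>) \<star> (dark, inv x)))
        = (\<lambda>i \<in> carrier L. \<zeta>1 i \<odot> \<zeta>2 (inv x \<otimes> i), \<one>)"
      unfolding W_mult dark_def using x
      by (auto intro!: restrict_ext simp: base_closed[OF b1] base_closed[OF b2])
    ultimately have eq: "(\<zeta>1, \<one>) \<star> ((dark, x) \<star> ((\<zeta>2, \<one>) \<star> (dark, inv x))) = (\<zeta>, \<one>)"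
      by simp
    have "(\<Sum>t\<in>T. Ylen (\<zeta> (ev t))) = (\<Sum>t\<in>T1. Ylen (\<zeta> (ev t))) + (\<Sum>t\<in>(#) x ` T2. Ylen (\<zeta> (ev t)))"
      unfolding TT(1) using f1 f2 TT(2) by (intro sum.union_disjoint) auto
    also have "(\<Sum>t\<in>(#) x ` T2. Ylen (\<zeta> (ev t))) = (\<Sum>t\<in>T2. Ylen (\<zeta> (ev (x # t))))"
      by (subst sum.reindex) (auto simp: inj_on_def)
    also have "\<dots> = (\<Sum>t\<in>T2. Ylen (\<zeta>2 (ev t)))"
      using f2(3) by (intro sum.cong) (auto simp: \<zeta>2_def)
    also have "(\<Sum>t\<in>T1. Ylen (\<zeta> (ev t))) = (\<Sum>t\<in>T1. Ylen (\<zeta>1 (ev t)))"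
      using f1(3) by (intro sum.cong) (auto simp: \<zeta>1_def)
    finally have "?n1 + (1 + (?n2 + 1)) = 2 * (card T - 1) + (\<Sum>t\<in>T. Ylen (\<zeta> (ev t)))"
      using c by simp
    thus ?thesis using prod eq by metis
  qed
qed

lemma base_times_cursor:
  assumes "\<zeta> \<in> base" "a \<in> carrier L"
  shows "(\<zeta>, \<one>) \<star> (dark, a) = (\<zeta>, a)"
proof -
  have "(\<zeta>, \<one>) \<star> (dark, a) = (\<lambda>i \<in> carrier L. \<zeta> i, a)"
    unfolding W_mult dark_def using assms by (auto intro!: restrict_ext simp: base_closed)
  moreover have "(\<lambda>i \<in> carrier L. \<zeta> i) = \<zeta>"
    using assms(1) unfolding base_def by (auto simp: PiE_def extensional_restrict)
  ultimately show ?thesis by simp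
qed

text \<open>
  So \<^const>\<open>word_length\<close> is meaningful on the whole wreath product, and the length of a class is the
  length of an actual word.
\<close>

lemma spells_all:
  assumes "g \<in> carrier W"
  shows "\<exists>zs \<in> lists Z. W.ev zs = g"
proof -
  obtain \<zeta> a where g: "g = (\<zeta>, a)" "\<zeta> \<in> base" "a \<in> carrier L" using assms by (auto simp: W_carrier)
  let ?A = "nf ` {i \<in> carrier L. \<zeta> i \<noteq> \<one>\<^sub>G}"
  have "prefix_hull ?A \<in> trees X"
  proof (rule prefix_hull_rooted_tree)
    show "finite ?A" using base_finite_support[OF g(2)] by simp
    show "?A \<subseteq> red" by auto
    show "hd w \<in> X" if "w \<in> ?A" "w \<noteq> []" for w
    proof -
      have "w \<in> red" using that(1) by auto
      thus ?thesis using that(2) by (cases w) (auto simp: red_Cons_iff)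
    qed
  qed
  from spells_lamps_on_tree[OF this g(2)] prefix_hull_superset[of ?A]
  obtain m where m: "W.spells Z m (\<zeta>, \<one>)" by blast
  obtain n where "W.spells Z n (dark, a)" using spells_cursor[OF g(3)] by blast
  from W.spells_mult[OF Z_closed m this]
  have "W.spells Z (m + n) (\<zeta>, a)" unfolding base_times_cursor[OF g(2,3)] .
  thus ?thesis unfolding W.spells_def g by auto
qed

text \<open>
  The walk of the cursor has to visit every lit lamp, and the letters that are not steps of the
  walk have to pay for the lamps. Summing over arbitrary finite sets \<open>A\<close> rather than over the
  support of \<open>\<eta>\<close> makes the bound stable under translation.
\<close>

lemma word_trace:
  assumes "zs \<in> lists Z" "W.ev zs = (\<eta>, a)"
  shows "\<exists>xs \<in> lists X. ev xs = a \<and>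
    (\<forall>i \<in> carrier L. \<eta> i \<noteq> \<one>\<^sub>G \<longrightarrow> (\<exists>n \<le> length xs. i = ev (take n xs))) \<and>
    (\<forall>A. finite A \<longrightarrow> A \<subseteq> carrier L \<longrightarrow> length xs + (\<Sum>i\<in>A. Ylen (\<eta> i)) \<le> length zs)"
  using assms
proof (induction zs arbitrary: \<eta> a)
  case Nil
  hence "\<eta> = dark" "a = \<one>" by (auto simp: W_one)
  moreover have "(\<Sum>i\<in>A. Ylen (dark i)) = 0" if "A \<subseteq> carrier L" for A
    using that by (intro sum.neutral) (auto simp: dark_def subset_iff)
  ultimately show ?case by (intro bexI[of _ "[]"]) (auto simp: dark_def)
next
  case (Cons z zs)
  have zs: "zs \<in> lists Z" "zs \<in> lists (carrier W)" using Cons.hyps Z_closed by auto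
  obtain \<eta>' a' where fz: "W.ev zs = (\<eta>', a')" by fastforce
  have ca: "\<eta>' \<in> base" "a' \<in> carrier L"
    using W.foldr_mult_closed[OF zs(2)] fz by (auto simp: W_carrier)
  obtain xs where xs: "xs \<in> lists X" "ev xs = a'"
    "\<And>i. i \<in> carrier L \<Longrightarrow> \<eta>' i \<noteq> \<one>\<^sub>G \<Longrightarrow> \<exists>n \<le> length xs. i = ev (take n xs)"
    "\<And>A. finite A \<Longrightarrow> A \<subseteq> carrier L \<Longrightarrow> length xs + (\<Sum>i\<in>A. Ylen (\<eta>' i)) \<le> length zs"
    using Cons.IH[OF fz] by blast
  have za: "z \<star> (\<eta>', a') = (\<eta>, a)" using Cons.prems fz by simp
  have "z \<in> Z" using Cons.hyps by simp
  then consider x where "x \<in> X" "z = (dark, x)" | y where "y \<in> Y" "z = (lamp G L y, \<one>)"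
    unfolding Z_eq by auto
  thus ?case
  proof cases
    case 1
    have \<eta>: "\<eta> i = \<eta>' (inv x \<otimes> i)" if "i \<in> carrier L" for i
      using za 1 that base_closed[OF ca(1)] by (auto simp: W_mult dark_def)
    have a: "a = x \<otimes> a'" using za 1 by (simp add: W_mult)
    show ?thesis
    proof (intro bexI[of _ "x # xs"] conjI ballI allI impI)
      show "ev (x # xs) = a" using a xs(2) by simp
      show "x # xs \<in> lists X" using xs 1 by simp
      fix i assume i: "i \<in> carrier L" "\<eta> i \<noteq> \<one>\<^sub>G"
      obtain n where n: "n \<le> length xs" "inv x \<otimes> i = ev (take n xs)"
        using xs(3)[of "inv x \<otimes> i"] i \<eta> 1 by auto
      have "i = x \<otimes> (inv x \<otimes> i)" using i 1 by (simp add: m_assoc[symmetric])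
      also have "\<dots> = ev (take (Suc n) (x # xs))" by (simp add: n)
      finally show "\<exists>n \<le> length (x # xs). i = ev (take n (x # xs))" using n(1) by auto
    next
      fix A assume A: "finite A" "A \<subseteq> carrier L"
      have "(\<Sum>i\<in>A. Ylen (\<eta> i)) = (\<Sum>i\<in>A. Ylen (\<eta>' (inv x \<otimes> i)))"
        using A \<eta> by (intro sum.cong) auto
      also have "\<dots> = (\<Sum>j\<in>(\<otimes>) (inv x) ` A. Ylen (\<eta>' j))"
        using A 1 by (subst sum.reindex) (auto simp: inj_on_def subset_iff)
      finally have "(\<Sum>i\<in>A. Ylen (\<eta> i)) = (\<Sum>j\<in>(\<otimes>) (inv x) ` A. Ylen (\<eta>' j))" .
      moreover have "(\<otimes>) (inv x) ` A \<subseteq> carrier L" using A(2) 1(1) by auto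
      from xs(4)[OF finite_imageI[OF A(1)] this]
      have "length xs + (\<Sum>j\<in>(\<otimes>) (inv x) ` A. Ylen (\<eta>' j)) \<le> length zs" .
      ultimately show "length (x # xs) + (\<Sum>i\<in>A. Ylen (\<eta> i)) \<le> length (z # zs)" by simp
    qed
  next
    case 2
    have y: "y \<in> carrier G" using 2 Y_closed by auto
    have \<eta>: "\<eta> i = (if i = \<one> then y \<odot> \<eta>' \<one> else \<eta>' i)" if "i \<in> carrier L" for i
      using za 2 that base_closed[OF ca(1)] by (auto simp: W_mult lamp_def)
    have a: "a = a'" using za 2 ca by (simp add: W_mult)
    have len: "Ylen (y \<odot> \<eta>' \<one>) \<le> 1 + Ylen (\<eta>' \<one>)"
    proof -
      have "Ylen (y \<odot> \<eta>' \<one>) \<le> Ylen y + Ylen (\<eta>' \<one>)"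
        by (intro G.word_length_mult_le Y_closed G.generating_set_spells Y y base_closed ca one_closed)
      moreover have "Ylen y \<le> length [y]" by (rule word_length_le) (use 2 y in auto)
      ultimately show ?thesis by simp
    qed
    show ?thesis
    proof (intro bexI[of _ xs] conjI ballI allI impI)
      show "ev xs = a" using a xs(2) by simp
      show "xs \<in> lists X" by (rule xs(1))
      fix i assume i: "i \<in> carrier L" "\<eta> i \<noteq> \<one>\<^sub>G"
      show "\<exists>n \<le> length xs. i = ev (take n xs)"
      proof (cases "i = \<one>")
        case True thus ?thesis by (intro exI[of _ 0]) simp
      next
        case False thus ?thesis using i \<eta> xs(3) by auto
      qed
    next
      fix A assume A: "finite A" "A \<subseteq> carrier L"
      have "(\<Sum>i\<in>A. Ylen (\<eta> i)) \<le> 1 + (\<Sum>i\<in>A. Ylen (\<eta>' i))"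
      proof (cases "\<one> \<in> A")
        case True
        have "(\<Sum>i\<in>A - {\<one>}. Ylen (\<eta> i)) = (\<Sum>i\<in>A - {\<one>}. Ylen (\<eta>' i))"
          using A \<eta> by (intro sum.cong) auto
        thus ?thesis using sum.remove[OF A(1) True, of "\<lambda>i. Ylen (\<eta> i)"]
            sum.remove[OF A(1) True, of "\<lambda>i. Ylen (\<eta>' i)"] len \<eta>[OF one_closed] by simp
      next
        case False
        have "(\<Sum>i\<in>A. Ylen (\<eta> i)) = (\<Sum>i\<in>A. Ylen (\<eta>' i))"
          using A \<eta> False by (intro sum.cong) auto
        thus ?thesis by simp
      qed
      thus "length xs + (\<Sum>i\<in>A. Ylen (\<eta> i)) \<le> length (z # zs)" using xs(4)[OF A] by simp
    qed
  qed
qed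

end

section \<open>Conjugacy classes with an involution as cursor\<close>

context lamplighter
begin

abbreviation Gcl where "Gcl \<equiv> G.conj_classes"
abbreviation triv where "triv \<equiv> {\<one>\<^sub>G}"
abbreviation cl where "cl \<equiv> class_length G Y"
abbreviation invols where "invols \<equiv> {b \<in> X. inv b = b}"

definition rep where "rep C = (SOME h. h \<in> C \<and> Ylen h = cl C)"

text \<open>
  For an involution \<open>a\<close>, the class of \<open>G\<close> at the pair of places \<open>i\<close> and \<open>a \<otimes> i\<close>.
\<close>

definition kappa where
  "kappa \<eta> a i = conj_class G (\<eta> i \<odot> \<eta> (a \<otimes> i))"

lemma rep: "C \<in> Gcl \<Longrightarrow> rep C \<in> C" "C \<in> Gcl \<Longrightarrow> Ylen (rep C) = cl C"
proof -
  assume "C \<in> Gcl"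
  hence "C \<noteq> {}" using G.conj_class_refl by auto
  hence "\<exists>h. h \<in> C \<and> Ylen h = cl C" by (rule class_length_attained) blast
  from someI_ex[OF this] show "rep C \<in> C" "Ylen (rep C) = cl C" unfolding rep_def by auto
qed

lemma rep_closed: "C \<in> Gcl \<Longrightarrow> rep C \<in> carrier G"
  using rep(1) G.conj_class_mem(1) by blast

lemma triv_class: "triv \<in> Gcl"
  using G.conj_class_one G.one_closed by (metis imageI)

lemma rep_triv: "rep triv = \<one>\<^sub>G"
  using rep(1)[OF triv_class] by simp

lemma conj_class_rep: "C \<in> Gcl \<Longrightarrow> conj_class G (rep C) = C"
  using rep(1) G.conj_class_mem(2) by blast

lemma kappa_class: "\<eta> \<in> base \<Longrightarrow> a \<in> carrier L \<Longrightarrow> i \<in> carrier L \<Longrightarrow> kappa \<eta> a i \<in> Gcl"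
  unfolding kappa_def by (auto simp: base_closed)

lemma kappa_triv_iff:
  "\<eta> \<in> base \<Longrightarrow> a \<in> carrier L \<Longrightarrow> i \<in> carrier L \<Longrightarrow>
    kappa \<eta> a i = triv \<longleftrightarrow> \<eta> i \<odot> \<eta> (a \<otimes> i) = \<one>\<^sub>G"
  unfolding kappa_def by (rule G.conj_class_eq_one_iff) (auto simp: base_closed)

lemma involution_cancel [simp]:
  assumes "b \<in> X" "inv b = b" "i \<in> carrier L"
  shows "b \<otimes> (b \<otimes> i) = i"
proof -
  have "b \<otimes> b = \<one>" using r_inv[of b] assms by simp
  thus ?thesis using assms by (simp add: m_assoc[symmetric])
qed

lemma kappa_flip:
  assumes "\<eta> \<in> base" "b \<in> X" "inv b = b" "i \<in> carrier L"
  shows "kappa \<eta> b (b \<otimes> i) = kappa \<eta> b i"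
  unfolding kappa_def using assms by (simp add: base_closed G.conj_class_commute)

text \<open>
  The square of \<open>(\<eta>, a)\<close> has lamps \<open>\<eta> i \<otimes> \<eta> (a \<otimes> i)\<close> and trivial cursor when \<open>a\<close> is an
  involution. Conjugation therefore moves \<^const>\<open>kappa\<close> along with the cursor.
\<close>

lemma kappa_conjugate:
  assumes el: "\<eta> \<in> base" "\<eta>' \<in> base" "\<theta> \<in> base" "a' \<in> carrier L" "h \<in> carrier L" "b \<in> X" "inv b = b"
    and eq: "(\<eta>', a') \<star> (\<theta>, h) = (\<theta>, h) \<star> (\<eta>, b)" and j: "j \<in> carrier L"
  shows "a' \<otimes> h = h \<otimes> b" "kappa \<eta>' a' (h \<otimes> j) = kappa \<eta> b j"
proof -
  have b: "b \<in> carrier L" using el by simp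
  show ah: "a' \<otimes> h = h \<otimes> b" using eq by (simp add: W_mult)
  have "(\<lambda>i \<in> carrier L. \<eta>' i \<odot> \<theta> (inv a' \<otimes> i)) = (\<lambda>i \<in> carrier L. \<theta> i \<odot> \<eta> (inv h \<otimes> i))"
    using eq by (simp add: W_mult)
  hence pt: "\<eta>' i \<odot> \<theta> (inv a' \<otimes> i) = \<theta> i \<odot> \<eta> (inv h \<otimes> i)" if "i \<in> carrier L" for i
    using that by (metis (no_types, lifting) restrict_apply')
  have a'hb: "a' \<otimes> (h \<otimes> k) = h \<otimes> (b \<otimes> k)" if "k \<in> carrier L" for k
    using that ah el b by (metis m_assoc)
  have inv_a': "inv a' \<otimes> (h \<otimes> k) = h \<otimes> (b \<otimes> k)" if k: "k \<in> carrier L" for k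
  proof -
    have "h \<otimes> k = a' \<otimes> (h \<otimes> (b \<otimes> k))" using a'hb[of "b \<otimes> k"] k el b by simp
    thus ?thesis using k el b by simp
  qed
  define s t where "s = \<theta> (h \<otimes> j)" and "t = \<theta> (h \<otimes> (b \<otimes> j))"
  have st: "s \<in> carrier G" "t \<in> carrier G" using el j b by (auto simp: s_def t_def base_closed)
  define u w where "u = \<eta> j" and "w = \<eta> (b \<otimes> j)"
  have uw: "u \<in> carrier G" "w \<in> carrier G" using el j b by (auto simp: u_def w_def base_closed)
  have "\<eta>' (h \<otimes> j) \<odot> t = s \<odot> u"
    using pt[of "h \<otimes> j"] inv_a'[OF j] j el by (simp add: s_def t_def u_def)
  hence 1: "\<eta>' (h \<otimes> j) = s \<odot> u \<odot> inv\<^bsub>G\<^esub> t"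
    using G.inv_solve_right[of "\<eta>' (h \<otimes> j)" "s \<odot> u" t] st uw el j by (simp add: base_closed)
  have "\<eta>' (h \<otimes> (b \<otimes> j)) \<odot> s = t \<odot> w"
    using pt[of "h \<otimes> (b \<otimes> j)"] inv_a'[of "b \<otimes> j"] j el b by (simp add: s_def t_def w_def)
  hence 2: "\<eta>' (h \<otimes> (b \<otimes> j)) = t \<odot> w \<odot> inv\<^bsub>G\<^esub> s"
    using G.inv_solve_right[of "\<eta>' (h \<otimes> (b \<otimes> j))" "t \<odot> w" s] st uw el j b by (simp add: base_closed)
  have "\<eta>' (h \<otimes> j) \<odot> \<eta>' (a' \<otimes> (h \<otimes> j)) = s \<odot> (u \<odot> w) \<odot> inv\<^bsub>G\<^esub> s"
    unfolding a'hb[OF j] 1 2 using st uw by (simp add: G.m_assoc)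
  thus "kappa \<eta>' a' (h \<otimes> j) = kappa \<eta> b j"
    unfolding kappa_def using G.conj_class_eqI[of "u \<odot> w" s] st uw by (simp add: u_def w_def)
qed

text \<open>
  Representatives of the classes: a tree in the quotient by \<open>b\<close> with a class of \<open>G\<close> at each
  vertex. Requiring a nontrivial class at the tips other than the root makes the tree minimal,
  so that it can be recovered from the classes.
\<close>

definition colours where
  "colours T t = (if t \<noteq> [] \<and> tip T t then Gcl - {triv} else Gcl)"

definition coloured_trees where
  "coloured_trees b = Sigma (trees (X - {b})) (\<lambda>T. PiE T (colours T))"

definition lit where
  "lit T f = (\<lambda>i \<in> carrier L. if nf i \<in> T then rep (f (nf i)) else \<one>\<^sub>G)"

lemma coloured_trees_class:
  "(T, f) \<in> coloured_trees b \<Longrightarrow> t \<in> T \<Longrightarrow> f t \<in> Gcl"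
  unfolding coloured_trees_def colours_def by (auto simp: PiE_iff split: if_splits)

lemma coloured_trees_tree: "(T, f) \<in> coloured_trees b \<Longrightarrow> T \<in> trees (X - {b})"
  unfolding coloured_trees_def by auto

lemma lit_base:
  assumes "(T, f) \<in> coloured_trees b"
  shows "lit T f \<in> base"
  unfolding lit_def
proof (rule restrict_base)
  have "finite T" using coloured_trees_tree[OF assms] by (simp add: rooted_trees_def)
  thus "finite (ev ` T)" by simp
  show "i \<in> ev ` T" if "i \<in> carrier L" "(if nf i \<in> T then rep (f (nf i)) else \<one>\<^sub>G) \<noteq> \<one>\<^sub>G" for i
    using that ev_nf[OF that(1)] by (auto split: if_splits intro!: image_eqI[of _ _ "nf i"])
qed (use assms coloured_trees_class rep_closed in auto)

lemma unfolded_tree_word: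
  assumes "T \<in> trees (X - {b})" "t \<in> T" "b \<in> X" "inv b = b"
  shows "t \<in> red" "fold_by b t = t" "nf (b \<otimes> ev t) = b # t" "b # t \<notin> T"
proof -
  show t: "t \<in> red" using assms unfolding rooted_trees_def by auto
  have hd: "w \<noteq> [] \<Longrightarrow> hd w \<noteq> b" if "w \<in> T" for w using assms(1) that unfolding rooted_trees_def by auto
  show "fold_by b t = t" using hd[OF assms(2)] by (auto simp: fold_by_def)
  show "nf (b \<otimes> ev t) = b # t"
    using nf_gen_mult[of "ev t" b] t assms(3,4) hd[OF assms(2)] by auto
  show "b # t \<notin> T" using hd[of "b # t"] by auto
qed

text \<open>
  Lamps are lit only at places whose word does not begin with \<open>b\<close>, so at most one of the two places
  in a pair has a lamp that is lit.
\<close>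

lemma kappa_lit:
  assumes Tf: "(T, f) \<in> coloured_trees b" and b: "b \<in> X" "inv b = b" and j: "j \<in> carrier L"
  shows "kappa (lit T f) b j = (if fold_by b (nf j) \<in> T then f (fold_by b (nf j)) else triv)"
proof -
  have T: "T \<in> trees (X - {b})" by (rule coloured_trees_tree[OF Tf])
  have unfolded: "kappa (lit T f) b k = (if nf k \<in> T then f (nf k) else triv)"
    if k: "k \<in> carrier L" "\<not> (nf k \<noteq> [] \<and> hd (nf k) = b)" for k
  proof -
    have "nf (b \<otimes> k) = b # nf k" using nf_gen_mult[OF k(1) b(1)] k(2) b(2) by auto
    moreover have "b # w \<notin> T" for w using T unfolding rooted_trees_def by fastforce
    ultimately have "lit T f (b \<otimes> k) = \<one>\<^sub>G" using k b by (auto simp: lit_def)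
    moreover have "lit T f k \<in> carrier G" using lit_base[OF Tf] k(1) by (rule base_closed)
    ultimately have "kappa (lit T f) b k = conj_class G (lit T f k)" by (simp add: kappa_def)
    thus ?thesis
      using k(1) conj_class_rep[OF coloured_trees_class[OF Tf]] G.conj_class_one by (auto simp: lit_def)
  qed
  show ?thesis
  proof (cases "nf j \<noteq> [] \<and> hd (nf j) = b")
    case False
    thus ?thesis using unfolded[OF j False] by (auto simp: fold_by_def)
  next
    case True
    hence n: "\<not> (nf (b \<otimes> j) \<noteq> [] \<and> hd (nf (b \<otimes> j)) = b)" using fold_by_mult(2)[OF j b] by blast
    have bj: "b \<otimes> j \<in> carrier L" using b j by simp
    have "nf (b \<otimes> j) = fold_by b (nf j)" using fold_by_mult(1)[OF j b] n by (auto simp: fold_by_def)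
    thus ?thesis using unfolded[OF bj n] kappa_flip[OF lit_base[OF Tf] b j] by simp
  qed
qed

lemma coloured_tip:
  assumes "(T, f) \<in> coloured_trees b" "w \<in> T" "w \<noteq> []"
  obtains v where "w @ v \<in> T" "f (w @ v) \<noteq> triv"
proof -
  obtain v where v: "w @ v \<in> T" "tip T (w @ v)"
    by (rule tip_extension[OF coloured_trees_tree[OF assms(1)] assms(2)])
  hence "f (w @ v) \<in> Gcl - {triv}"
    using assms(1,3) unfolding coloured_trees_def colours_def by (auto simp: PiE_iff)
  thus ?thesis using that v by auto
qed

lemma lit_closed: "(T, f) \<in> coloured_trees b \<Longrightarrow> b \<in> X \<Longrightarrow> (lit T f, b) \<in> carrier W"
  using lit_base by (auto simp: W_carrier)

text \<open>
  The invariant \<^const>\<open>kappa\<close> recovers the colours: the conjugating element has cursor \<open>\<one>\<close> or \<open>b\<close>,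
  neither of which moves a vertex of the quotient. The colours determine the tree, because each
  vertex other than the root is a prefix of a tip, where the colour is nontrivial.
\<close>

lemma coloured_tree_unique:
  assumes Tf: "(T, f) \<in> coloured_trees b" "b \<in> X" "inv b = b"
    and Tf': "(T', f') \<in> coloured_trees b'" "b' \<in> X" "inv b' = b'"
    and eq: "conj_class W (lit T' f', b') = conj_class W (lit T f, b)"
  shows "b = b' \<and> T = T' \<and> f = f'"
proof -
  obtain \<theta> h where \<theta>: "\<theta> \<in> base" "h \<in> carrier L"
    "(lit T' f', b') \<star> (\<theta>, h) = (\<theta>, h) \<star> (lit T f, b)"
    using W.conj_class_eq_iff_intertwine[OF lit_closed[OF Tf(1,2)] lit_closed[OF Tf'(1,2)]] eq
    by (auto simp: W_carrier)
  note k = kappa_conjugate[OF lit_base[OF Tf(1)] lit_base[OF Tf'(1)] \<theta>(1) gen_closed[OF Tf'(2)]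
      \<theta>(2) Tf(2,3) \<theta>(3)]
  have bb: "b = b'" and h: "h = \<one> \<or> h = b"
    using involution_conjugacy[OF \<theta>(2) Tf(2) Tf'(2) Tf(3) Tf'(3)] k(1)[OF one_closed] by auto
  have same: "(if fold_by b (nf j) \<in> T then f (fold_by b (nf j)) else triv)
    = (if fold_by b (nf j) \<in> T' then f' (fold_by b (nf j)) else triv)" if j: "j \<in> carrier L" for j
  proof -
    have fold: "fold_by b (nf (h \<otimes> j)) = fold_by b (nf j)"
      using h fold_by_mult(1)[OF j Tf(2,3)] j by auto
    have hj: "h \<otimes> j \<in> carrier L" using j \<theta>(2) by simp
    have "kappa (lit T f) b j = kappa (lit T' f') b (h \<otimes> j)"
      using k(2)[OF j] bb by simp
    also have "\<dots> = (if fold_by b (nf (h \<otimes> j)) \<in> T' then f' (fold_by b (nf (h \<otimes> j))) else triv)"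
      by (rule kappa_lit[OF _ Tf(2,3) hj]) (use Tf'(1) bb in simp)
    finally show ?thesis unfolding kappa_lit[OF Tf j] fold .
  qed
  have T: "T \<in> trees (X - {b})" "T' \<in> trees (X - {b})"
    using coloured_trees_tree Tf(1) Tf'(1) bb by auto
  have ext: "(if w \<in> T then f w else triv) = (if w \<in> T' then f' w else triv)" for w
  proof (cases "w \<in> T \<or> w \<in> T'")
    case True
    then have w: "w \<in> red" "fold_by b w = w" using unfolded_tree_word T Tf(2,3) by blast+
    hence e: "fold_by b (nf (ev w)) = w" by simp
    show ?thesis using same[OF ev_red_closed[OF w(1)]] unfolding e .
  qed auto
  have sub: "T1 \<subseteq> T2" if 1: "(T1, f1) \<in> coloured_trees b" and 2: "T2 \<in> trees (X - {b})"
      and e: "\<And>w. (if w \<in> T1 then f1 w else triv) = (if w \<in> T2 then f2 w else triv)" for T1 T2 f1 f2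
  proof
    fix w assume w: "w \<in> T1"
    show "w \<in> T2"
    proof (cases "w = []")
      case True thus ?thesis using 2 by (simp add: rooted_trees_def)
    next
      case False
      obtain v where v: "w @ v \<in> T1" "f1 (w @ v) \<noteq> triv" by (rule coloured_tip[OF 1 w False])
      hence "w @ v \<in> T2" using e[of "w @ v"] by (auto split: if_splits)
      thus ?thesis using rooted_trees_prefix[OF 2] by blast
    qed
  qed
  have TT: "T = T'"
    using sub[OF Tf(1) T(2), of f'] sub[of T' f' T f] Tf'(1) T(1) ext bb by auto
  have "f = f'"
  proof (rule PiE_ext)
    show "f \<in> PiE T (colours T)" "f' \<in> PiE T (colours T)"
      using Tf(1) Tf'(1) TT unfolding coloured_trees_def by auto
    show "f w = f' w" if "w \<in> T" for w using ext[of w] that TT by simp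
  qed
  thus ?thesis using bb TT by simp
qed

text \<open>
  Conjugating by lamps alone, the lamp at \<open>b \<otimes> i\<close> can be switched off at the expense of the one at
  \<open>i\<close>, which then shows the product of the two, and that product can be replaced by any conjugate.
\<close>

lemma conjugate_to_lit:
  assumes \<eta>: "\<eta> \<in> base" and b: "b \<in> X" "inv b = b"
  obtains T f where "(T, f) \<in> coloured_trees b" "conj_class W (lit T f, b) = conj_class W (\<eta>, b)"
proof -
  have bc: "b \<in> carrier L" using b by simp
  define P where "P = {i \<in> carrier L. \<not> (nf i \<noteq> [] \<and> hd (nf i) = b) \<and> kappa \<eta> b i \<noteq> triv}"
  have finP: "finite P"
  proof (rule finite_subset)
    show "P \<subseteq> {i \<in> carrier L. \<eta> i \<noteq> \<one>\<^sub>G} \<union> {i \<in> carrier L. \<eta> (b \<otimes> i) \<noteq> \<one>\<^sub>G}"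
    proof
      fix i assume "i \<in> P"
      hence i: "i \<in> carrier L" "kappa \<eta> b i \<noteq> triv" unfolding P_def by blast+
      hence "\<eta> i \<odot> \<eta> (b \<otimes> i) \<noteq> \<one>\<^sub>G" using kappa_triv_iff[OF \<eta> bc i(1)] by simp
      thus "i \<in> {i \<in> carrier L. \<eta> i \<noteq> \<one>\<^sub>G} \<union> {i \<in> carrier L. \<eta> (b \<otimes> i) \<noteq> \<one>\<^sub>G}"
        using i(1) by auto
    qed
    show "finite ({i \<in> carrier L. \<eta> i \<noteq> \<one>\<^sub>G} \<union> {i \<in> carrier L. \<eta> (b \<otimes> i) \<noteq> \<one>\<^sub>G})"
      using base_finite_support[OF \<eta>] finite_translated_support[OF \<eta> bc] by simp
  qed
  define T where "T = prefix_hull (nf ` P)"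
  have T: "T \<in> trees (X - {b})"
    unfolding T_def
  proof (rule prefix_hull_rooted_tree)
    show "nf ` P \<subseteq> red" by (auto simp: P_def)
    show "hd w \<in> X - {b}" if "w \<in> nf ` P" "w \<noteq> []" for w
    proof -
      have "w \<in> red" using that by (auto simp: P_def)
      hence "hd w \<in> X" using that(2) by (cases w) (auto simp: red_Cons_iff)
      thus ?thesis using that by (auto simp: P_def)
    qed
  qed (use finP in simp)
  have TP: "nf i \<in> T" if "i \<in> P" for i using that prefix_hull_superset unfolding T_def by blast
  define f where "f = (\<lambda>t \<in> T. kappa \<eta> b (ev t))"
  have "f t \<in> colours T t" if t: "t \<in> T" for t
  proof -
    have tr: "t \<in> red" using T t unfolding rooted_trees_def by auto
    have "f t \<in> Gcl" using kappa_class[OF \<eta> bc ev_red_closed[OF tr]] t by (simp add: f_def)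
    moreover have "f t \<noteq> triv" if "t \<noteq> []" "tip T t"
    proof -
      obtain v where v: "t @ v \<in> nf ` P" using t \<open>t \<noteq> []\<close> by (auto simp: T_def prefix_hull_def)
      have "v = []"
      proof (rule ccontr)
        assume "v \<noteq> []"
        hence "(t @ [hd v]) @ tl v \<in> nf ` P" using v by simp
        hence "t @ [hd v] \<in> T" unfolding T_def prefix_hull_def by blast
        thus False using \<open>tip T t\<close> by (simp add: tip_def)
      qed
      then obtain i where "i \<in> P" "t = nf i" using v by auto
      thus ?thesis using t by (simp add: f_def P_def)
    qed
    ultimately show ?thesis by (auto simp: colours_def)
  qed
  hence Tf: "(T, f) \<in> coloured_trees b"
    using T unfolding coloured_trees_def f_def by auto
  let ?\<zeta> = "lit T f"
  let ?head = "\<lambda>i. nf i \<noteq> [] \<and> hd (nf i) = b"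
  define t where "t i = (if i \<in> P then (SOME g. g \<in> carrier G \<and>
      ?\<zeta> i = g \<odot> (\<eta> i \<odot> \<eta> (b \<otimes> i)) \<odot> inv\<^bsub>G\<^esub> g) else \<one>\<^sub>G)" for i
  have t: "t i \<in> carrier G \<and> ?\<zeta> i = t i \<odot> (\<eta> i \<odot> \<eta> (b \<otimes> i)) \<odot> inv\<^bsub>G\<^esub> (t i)"
    if i: "i \<in> carrier L" "\<not> ?head i" for i
  proof (cases "i \<in> P")
    case True
    have "?\<zeta> i \<in> kappa \<eta> b i"
      using TP[OF True] i rep(1)[OF kappa_class[OF \<eta> bc i(1)]] by (simp add: lit_def f_def)
    hence "\<exists>g. g \<in> carrier G \<and> ?\<zeta> i = g \<odot> (\<eta> i \<odot> \<eta> (b \<otimes> i)) \<odot> inv\<^bsub>G\<^esub> g"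
      using i \<eta> bc unfolding kappa_def by (auto simp: G.conj_class_eq base_closed)
    from someI_ex[OF this] show ?thesis using True by (simp add: t_def)
  next
    case False
    hence k: "kappa \<eta> b i = triv" using i by (auto simp: P_def)
    hence 1: "\<eta> i \<odot> \<eta> (b \<otimes> i) = \<one>\<^sub>G" using kappa_triv_iff[OF \<eta> bc i(1)] by simp
    have "?\<zeta> i = \<one>\<^sub>G" using k i rep_triv by (simp add: lit_def f_def)
    thus ?thesis using False 1 by (simp add: t_def)
  qed
  \<comment> \<open>At places beginning with \<open>b\<close> the value is forced by the equation \<open>pt\<close> below, since \<open>lit T f\<close> is trivial there.\<close>
  define \<theta> where "\<theta> = (\<lambda>i \<in> carrier L. if ?head i then t (b \<otimes> i) \<odot> inv\<^bsub>G\<^esub> (\<eta> i) else t i)"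
  have flip: "\<not> ?head (b \<otimes> i) \<longleftrightarrow> ?head i" if "i \<in> carrier L" for i
    using fold_by_mult(2)[OF that b] by blast
  have \<theta>: "\<theta> \<in> base"
    unfolding \<theta>_def
  proof (rule restrict_base)
    show "finite (P \<union> (\<otimes>) b ` P \<union> {i \<in> carrier L. \<eta> i \<noteq> \<one>\<^sub>G})"
      using finP base_finite_support[OF \<eta>] by simp
    fix i assume i: "i \<in> carrier L"
    show "(if ?head i then t (b \<otimes> i) \<odot> inv\<^bsub>G\<^esub> (\<eta> i) else t i) \<in> carrier G"
      using t[of "b \<otimes> i"] t[of i] flip[OF i] i bc \<eta> by (auto simp: base_closed)
    assume ne: "(if ?head i then t (b \<otimes> i) \<odot> inv\<^bsub>G\<^esub> (\<eta> i) else t i) \<noteq> \<one>\<^sub>G"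
    show "i \<in> P \<union> (\<otimes>) b ` P \<union> {i \<in> carrier L. \<eta> i \<noteq> \<one>\<^sub>G}"
    proof (rule ccontr)
      assume n: "i \<notin> P \<union> (\<otimes>) b ` P \<union> {i \<in> carrier L. \<eta> i \<noteq> \<one>\<^sub>G}"
      have "i = b \<otimes> (b \<otimes> i)" using b i by simp
      hence "b \<otimes> i \<notin> P" using n by blast
      thus False using ne n i by (auto simp: t_def split: if_splits)
    qed
  qed
  have pt: "?\<zeta> i \<odot> \<theta> (b \<otimes> i) = \<theta> i \<odot> \<eta> i" if i: "i \<in> carrier L" for i
  proof (cases "?head i")
    case False
    have h: "?head (b \<otimes> i)" using flip[OF i] False by blast
    define g u w where "g = t i" and "u = \<eta> i" and "w = \<eta> (b \<otimes> i)"
    have c: "g \<in> carrier G" "u \<in> carrier G" "w \<in> carrier G"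
      using t[OF i False] \<eta> i bc by (auto simp: g_def u_def w_def base_closed)
    have "?\<zeta> i = g \<odot> (u \<odot> w) \<odot> inv\<^bsub>G\<^esub> g" using t[OF i False] by (simp add: g_def u_def w_def)
    moreover have "\<theta> (b \<otimes> i) = g \<odot> inv\<^bsub>G\<^esub> w" using h i bc b by (simp add: \<theta>_def g_def w_def)
    moreover have "\<theta> i = g" using False i by (auto simp: \<theta>_def g_def)
    ultimately show ?thesis using c by (simp add: G.m_assoc u_def[symmetric])
  next
    case True
    have h: "\<not> ?head (b \<otimes> i)" using flip[OF i] True by blast
    have "nf i \<notin> T" using True T unfolding rooted_trees_def by auto
    hence "?\<zeta> i = \<one>\<^sub>G" using i by (simp add: lit_def)
    moreover have "\<theta> (b \<otimes> i) = t (b \<otimes> i)" using h i bc by (auto simp: \<theta>_def)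
    moreover have "\<theta> i = t (b \<otimes> i) \<odot> inv\<^bsub>G\<^esub> (\<eta> i)" using True i by (simp add: \<theta>_def)
    moreover have "t (b \<otimes> i) \<in> carrier G" using t[OF _ h] i bc by simp
    ultimately show ?thesis using \<eta> i by (simp add: base_closed G.m_assoc)
  qed
  have "(?\<zeta>, b) \<star> (\<theta>, \<one>) = (\<theta>, \<one>) \<star> (\<eta>, b)"
    unfolding W_mult using pt b bc by (auto intro!: restrict_ext)
  moreover have "(\<eta>, b) \<in> carrier W" "(\<theta>, \<one>) \<in> carrier W" using \<eta> \<theta> bc by (auto simp: W_carrier)
  ultimately have "conj_class W (?\<zeta>, b) = conj_class W (\<eta>, b)"
    using W.conj_class_eq_iff_intertwine lit_closed[OF Tf b(1)] by blast
  thus ?thesis using that Tf by blast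
qed

lemma coloured_trees_classes:
  "bij_betw (\<lambda>(b, T, f). conj_class W (lit T f, b)) (Sigma invols coloured_trees)
    (nontrivial_torsion_cursor_classes G L)"
  unfolding bij_betw_def
proof
  show "inj_on (\<lambda>(b, T, f). conj_class W (lit T f, b)) (Sigma invols coloured_trees)"
  proof (rule inj_onI)
    fix s s'
    assume *: "s \<in> Sigma invols coloured_trees" "s' \<in> Sigma invols coloured_trees"
      "(case s of (b, T, f) \<Rightarrow> conj_class W (lit T f, b)) = (case s' of (b, T, f) \<Rightarrow> conj_class W (lit T f, b))"
    obtain b T f b' T' f' where s: "s = (b, T, f)" "s' = (b', T', f')"
      by (metis prod_cases3)
    have "b = b' \<and> T = T' \<and> f = f'"
      by (rule coloured_tree_unique) (use * in \<open>auto simp: s\<close>)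
    thus "s = s'" by (simp add: s)
  qed
  show "(\<lambda>(b, T, f). conj_class W (lit T f, b)) ` Sigma invols coloured_trees
    = nontrivial_torsion_cursor_classes G L"
  proof (intro equalityI subsetI)
    fix C assume "C \<in> (\<lambda>(b, T, f). conj_class W (lit T f, b)) ` Sigma invols coloured_trees"
    then obtain b T f where *: "b \<in> X" "inv b = b" "(T, f) \<in> coloured_trees b"
        "C = conj_class W (lit T f, b)" by auto
    have "b [^] (2::nat) = \<one>"
      using r_inv[of b] * by (simp add: numeral_2_eq_2)
    thus "C \<in> nontrivial_torsion_cursor_classes G L"
      unfolding nontrivial_torsion_cursor_classes_def *(4)
      using lit_closed[OF *(3,1)] gen_not_one[OF *(1)]
      by (intro imageI) (auto intro!: exI[of _ "2::nat"])
  next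
    fix C assume "C \<in> nontrivial_torsion_cursor_classes G L"
    then obtain \<eta> a n where a: "\<eta> \<in> base" "a \<in> carrier L" "a \<noteq> \<one>" "(n::nat) > 0" "a [^] n = \<one>"
        "C = conj_class W (\<eta>, a)"
      unfolding nontrivial_torsion_cursor_classes_def W_carrier by auto
    obtain h b where h: "h \<in> carrier L" "b \<in> X" "inv b = b" "a = h \<otimes> b \<otimes> inv h"
      using torsion_conjugate_to_involution[OF a(2,3,5,4)] by blast
    define \<eta>0 where "\<eta>0 = (\<lambda>i \<in> carrier L. \<eta> (h \<otimes> i))"
    have \<eta>0: "\<eta>0 \<in> base"
      unfolding \<eta>0_def by (rule restrict_base[OF _ finite_translated_support[OF a(1) h(1)]])
        (use a(1) h(1) base_closed in auto)
    have ah: "a \<otimes> h = h \<otimes> b" using h by (simp add: m_assoc)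
    have "(\<eta>, a) \<star> (dark, h) = (dark, h) \<star> (\<eta>0, b)"
      unfolding W_mult ah dark_def \<eta>0_def using a(1,2) h(1)
      by (auto intro!: restrict_ext simp: base_closed m_assoc[symmetric])
    moreover have "(\<eta>, a) \<in> carrier W" "(dark, h) \<in> carrier W" "(\<eta>0, b) \<in> carrier W"
      using a \<eta>0 h dark_base by (auto simp: W_carrier)
    ultimately have "C = conj_class W (\<eta>0, b)"
      unfolding a(6) using W.conj_class_eq_iff_intertwine by blast
    moreover obtain T f where "(T, f) \<in> coloured_trees b" "conj_class W (lit T f, b) = conj_class W (\<eta>0, b)"
      by (rule conjugate_to_lit[OF \<eta>0 h(2,3)])
    ultimately show "C \<in> (\<lambda>(b, T, f). conj_class W (lit T f, b)) ` Sigma invols coloured_trees"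
      using h by (intro image_eqI[of _ _ "(b, T, f)"]) auto
  qed
qed

section \<open>The length of these classes\<close>

text \<open>
  The cursor tours \<open>T\<close>, lighting the lamps with shortest representatives of their classes, returns
  to \<open>\<one>\<close> and then takes the step \<open>b\<close>.
\<close>

lemma class_length_lit_le:
  assumes Tf: "(T, f) \<in> coloured_trees b" and b: "b \<in> X"
  shows "class_length W Z (conj_class W (lit T f, b)) \<le> 1 + 2 * (card T - 1) + (\<Sum>t\<in>T. cl (f t))"
proof -
  have T: "T \<in> trees (X - {b})" by (rule coloured_trees_tree[OF Tf])
  have Tr: "T \<subseteq> red" using T by (simp add: rooted_trees_def)
  have "W.spells Z (2 * (card T - 1) + (\<Sum>t\<in>T. Ylen (lit T f (ev t)))) (lit T f, \<one>)"
    by (rule spells_lamps_on_tree[OF T lit_base[OF Tf]]) (auto simp: lit_def split: if_splits)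
  moreover have "(\<Sum>t\<in>T. Ylen (lit T f (ev t))) = (\<Sum>t\<in>T. cl (f t))"
    using Tr rep(2)[OF coloured_trees_class[OF Tf]] by (intro sum.cong) (auto simp: lit_def)
  ultimately have "W.spells Z (2 * (card T - 1) + (\<Sum>t\<in>T. cl (f t)) + 1) ((lit T f, \<one>) \<star> (dark, b))"
    using W.spells_mult[OF Z_closed _ spells_step[OF b]] by simp
  moreover have "(lit T f, \<one>) \<star> (dark, b) = (lit T f, b)"
    by (rule base_times_cursor[OF lit_base[OF Tf] gen_closed[OF b]])
  ultimately have "word_length W Z (lit T f, b) \<le> 2 * (card T - 1) + (\<Sum>t\<in>T. cl (f t)) + 1"
    using W.word_length_le_spells by simp
  moreover have "(lit T f, b) \<in> conj_class W (lit T f, b)"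
    by (rule W.conj_class_refl[OF lit_closed[OF Tf b]])
  from class_length_le[OF this, of W Z]
  have "class_length W Z (conj_class W (lit T f, b)) \<le> word_length W Z (lit T f, b)" .
  ultimately show ?thesis by simp
qed

text \<open>
  Conjugation by an element with cursor \<open>h\<close> turns the walk of the cursor from \<open>\<one>\<close> to \<open>a\<close> into one from
  \<open>h\<^sup>-\<^sup>1\<close> to \<open>b h\<^sup>-\<^sup>1\<close>, which is closed in the quotient. At a pair of places with a nontrivial colour at
  least one lamp is lit, so the walk gets there. The product of the two lamps lies in the class that
  is the colour, so together they cost at least the length of this class.
\<close>

lemma class_length_lit_ge:
  assumes Tf: "(T, f) \<in> coloured_trees b" and b: "b \<in> X" "inv b = b"
  shows "1 + 2 * (card T - 1) + (\<Sum>t\<in>T. cl (f t)) \<le> class_length W Z (conj_class W (lit T f, b))"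
proof -
  let ?C = "conj_class W (lit T f, b)"
  have T: "T \<in> trees (X - {b})" by (rule coloured_trees_tree[OF Tf])
  have fT: "finite T" "[] \<in> T" "T \<subseteq> red" using T by (auto simp: rooted_trees_def)
  have bc: "b \<in> carrier L" using b by simp
  have litW: "(lit T f, b) \<in> carrier W" by (rule lit_closed[OF Tf b(1)])
  have "?C \<noteq> {}" using W.conj_class_refl[OF litW] by auto
  then obtain g where g: "g \<in> ?C" "word_length W Z g = class_length W Z ?C"
    by (rule class_length_attained)
  have gW: "g \<in> carrier W" "conj_class W g = ?C"
    using W.conj_class_mem[OF imageI[OF litW] g(1)] by auto
  obtain zs where zs: "zs \<in> lists Z" "W.ev zs = g" "length zs = word_length W Z g"
    by (rule word_length_attained[OF spells_all[OF gW(1)]])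
  obtain \<eta> a where \<eta>: "g = (\<eta>, a)" "\<eta> \<in> base" "a \<in> carrier L" using gW(1) by (auto simp: W_carrier)
  obtain \<theta> h where \<theta>: "\<theta> \<in> base" "h \<in> carrier L"
    "(\<eta>, a) \<star> (\<theta>, h) = (\<theta>, h) \<star> (lit T f, b)"
    using W.conj_class_eq_iff_intertwine[OF litW gW(1)] gW(2) \<eta>(1) by (auto simp: W_carrier)
  note k = kappa_conjugate[OF lit_base[OF Tf] \<eta>(2) \<theta>(1) \<eta>(3) \<theta>(2) b \<theta>(3)]
  have ah: "a \<otimes> h = h \<otimes> b" using k(1)[OF one_closed] .
  have ahj: "a \<otimes> (h \<otimes> j) = h \<otimes> (b \<otimes> j)" if "j \<in> carrier L" for j
    using that ah \<theta>(2) \<eta>(3) bc by (metis m_assoc)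
  have kap: "kappa \<eta> a (h \<otimes> ev t) = f t" if t: "t \<in> T" for t
  proof -
    have "t \<in> red" "fold_by b t = t" using unfolded_tree_word[OF T t b] by auto
    thus ?thesis using k(2)[of "ev t"] kappa_lit[OF Tf b, of "ev t"] t by simp
  qed
  have zs': "W.ev zs = (\<eta>, a)" using zs(2) \<eta>(1) by (rule HOL.trans)
  obtain xs where xs: "xs \<in> lists X" "ev xs = a"
    "\<And>i. i \<in> carrier L \<Longrightarrow> \<eta> i \<noteq> \<one>\<^sub>G \<Longrightarrow> \<exists>n \<le> length xs. i = ev (take n xs)"
    "\<And>A. finite A \<Longrightarrow> A \<subseteq> carrier L \<Longrightarrow> length xs + (\<Sum>i\<in>A. Ylen (\<eta> i)) \<le> length zs"
    using word_trace[OF zs(1) zs'] by blast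
  have walk: "2 * card (T - {[]}) + 1 \<le> length xs"
  proof (rule closed_walk_length[OF b xs(1)])
    show "inv h \<in> carrier L" using \<theta>(2) by simp
    have "inv h \<otimes> a = inv h \<otimes> (a \<otimes> h) \<otimes> inv h" using \<theta>(2) \<eta>(3) by (simp add: m_assoc)
    also have "\<dots> = b \<otimes> inv h" unfolding ah using \<theta>(2) bc by (simp add: m_assoc[symmetric])
    finally show "inv h \<otimes> ev xs = b \<otimes> inv h" unfolding xs(2) .
    fix w assume w: "w \<in> T - {[]}"
    obtain v where v: "w @ v \<in> T" "f (w @ v) \<noteq> triv" using coloured_tip[OF Tf, of w] w by auto
    define j where "j = ev (w @ v)"
    have wv: "w @ v \<in> red" "fold_by b (w @ v) = w @ v" using unfolded_tree_word[OF T v(1) b] by auto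
    have j: "j \<in> carrier L" using wv(1) unfolding j_def by (rule ev_red_closed)
    have hj: "h \<otimes> j \<in> carrier L" using j \<theta>(2) by simp
    have "kappa \<eta> a (h \<otimes> j) \<noteq> triv" using kap[OF v(1)] v(2) by (simp add: j_def del: foldr_append)
    hence "\<eta> (h \<otimes> j) \<odot> \<eta> (a \<otimes> (h \<otimes> j)) \<noteq> \<one>\<^sub>G"
      using kappa_triv_iff[OF \<eta>(2,3) hj] by simp
    hence "\<eta> (h \<otimes> j) \<noteq> \<one>\<^sub>G \<or> \<eta> (h \<otimes> (b \<otimes> j)) \<noteq> \<one>\<^sub>G" unfolding ahj[OF j] by auto
    hence "\<exists>i \<in> {j, b \<otimes> j}. \<eta> (h \<otimes> i) \<noteq> \<one>\<^sub>G" by auto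
    then obtain i where i: "i \<in> {j, b \<otimes> j}" "\<eta> (h \<otimes> i) \<noteq> \<one>\<^sub>G" by blast
    have ic: "i \<in> carrier L" using i(1) j bc by auto
    obtain n where n: "n \<le> length xs" "h \<otimes> i = ev (take n xs)"
      using xs(3)[of "h \<otimes> i"] i(2) ic \<theta>(2) by auto
    have "inv h \<otimes> ev (take n xs) = i"
      unfolding n(2)[symmetric] using ic \<theta>(2) by (simp add: m_assoc[symmetric])
    moreover have "fold_by b (nf i) = w @ v"
      using i(1) fold_by_mult(1)[OF j b] nf_ev[OF wv(1)] wv(2) by (auto simp: j_def simp del: foldr_append)
    ultimately show "\<exists>n\<le>length xs. \<exists>v. fold_by b (nf (inv h \<otimes> ev (take n xs))) = w @ v"
      using n(1) by auto
  qed (use fT in auto)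
  let ?A = "(\<lambda>t. h \<otimes> ev t) ` T" and ?B = "(\<lambda>t. h \<otimes> (b \<otimes> ev t)) ` T"
  have evc: "ev t \<in> carrier L" if "t \<in> T" for t using fT(3) that by auto
  have injA: "inj_on (\<lambda>t. h \<otimes> ev t) T"
    by (rule inj_onI) (use evc \<theta>(2) fT(3) ev_inject in \<open>auto simp: subset_iff\<close>)
  have injB: "inj_on (\<lambda>t. h \<otimes> (b \<otimes> ev t)) T"
    by (rule inj_onI) (use evc \<theta>(2) bc fT(3) ev_inject in \<open>auto simp: subset_iff\<close>)
  have disj: "?A \<inter> ?B = {}"
  proof (rule equals0I)
    fix i assume "i \<in> ?A \<inter> ?B"
    then obtain t t' where t: "t \<in> T" "t' \<in> T" "h \<otimes> ev t = h \<otimes> (b \<otimes> ev t')" by auto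
    hence "ev t = b \<otimes> ev t'" using evc \<theta>(2) bc by simp
    hence "nf (ev t) = b # t'" using unfolded_tree_word(3)[OF T t(2) b] by simp
    thus False using unfolded_tree_word(1)[OF T t(1) b] unfolded_tree_word(4)[OF T t(2) b] t(1) by simp
  qed
  have "(\<Sum>t\<in>T. cl (f t)) \<le> (\<Sum>t\<in>T. Ylen (\<eta> (h \<otimes> ev t)) + Ylen (\<eta> (h \<otimes> (b \<otimes> ev t))))"
  proof (rule sum_mono)
    fix t assume t: "t \<in> T"
    have c: "\<eta> (h \<otimes> ev t) \<in> carrier G" "\<eta> (h \<otimes> (b \<otimes> ev t)) \<in> carrier G"
      using evc[OF t] \<theta>(2) bc base_closed[OF \<eta>(2)] by auto
    let ?p = "\<eta> (h \<otimes> ev t) \<odot> \<eta> (h \<otimes> (b \<otimes> ev t))"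
    have "f t = conj_class G ?p" using kap[OF t] ahj[OF evc[OF t]] by (simp add: kappa_def)
    hence "?p \<in> f t" using G.conj_class_refl c by simp
    hence "cl (f t) \<le> Ylen ?p" by (rule class_length_le)
    also have "\<dots> \<le> Ylen (\<eta> (h \<otimes> ev t)) + Ylen (\<eta> (h \<otimes> (b \<otimes> ev t)))"
      by (intro G.word_length_mult_le Y_closed G.generating_set_spells Y c)
    finally show "cl (f t) \<le> Ylen (\<eta> (h \<otimes> ev t)) + Ylen (\<eta> (h \<otimes> (b \<otimes> ev t)))" .
  qed
  also have "\<dots> = (\<Sum>i\<in>?A. Ylen (\<eta> i)) + (\<Sum>i\<in>?B. Ylen (\<eta> i))"
    by (simp add: sum.distrib sum.reindex[OF injA] sum.reindex[OF injB])
  also have "\<dots> = (\<Sum>i\<in>?A \<union> ?B. Ylen (\<eta> i))"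
    using fT(1) disj by (intro sum.union_disjoint[symmetric]) auto
  finally have "(\<Sum>t\<in>T. cl (f t)) \<le> (\<Sum>i\<in>?A \<union> ?B. Ylen (\<eta> i))" .
  moreover have "finite (?A \<union> ?B)" "?A \<union> ?B \<subseteq> carrier L" using fT(1) evc \<theta>(2) bc by auto
  from xs(4)[OF this] have "length xs + (\<Sum>i\<in>?A \<union> ?B. Ylen (\<eta> i)) \<le> length zs" .
  moreover have "card (T - {[]}) = card T - 1" using fT by simp
  ultimately show ?thesis using walk zs(3) g(2) by simp
qed

end

section \<open>Summation over the classes\<close>

context lamplighter
begin

abbreviation sigma where "sigma \<equiv> conj_growth_series G Y"

lemma formal_sum_colours:
  "formal_sum (colours T t) (\<lambda>C. fps_X ^ cl C) = (if t \<noteq> [] \<and> tip T t then sigma - 1 else sigma)"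
  unfolding colours_def using G.formal_sum_classes[OF Y] G.formal_sum_nontrivial_classes[OF Y] by simp

lemma summable_colours: "summable_family (colours T t) (\<lambda>C. fps_X ^ cl C)"
  by (rule summable_family_subset[OF G.summable_classes[OF Y]]) (auto simp: colours_def)

text \<open>
  Each vertex other than the root accounts for the two passages through the edge to its parent.
\<close>

lemma formal_sum_colourings:
  assumes "finite T" "[] \<in> T"
  shows "formal_sum (PiE T (colours T)) (\<lambda>f. fps_X ^ (1 + 2 * (card T - 1) + (\<Sum>t\<in>T. cl (f t))))
    = fps_X * sigma * tree_weight (fps_X\<^sup>2 * sigma) (fps_X\<^sup>2 * (sigma - 1)) T"
proof -
  have "formal_sum (PiE T (colours T)) (\<lambda>f. fps_X ^ (1 + 2 * (card T - 1) + (\<Sum>t\<in>T. cl (f t))))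
      = formal_sum (PiE T (colours T)) (\<lambda>f. fps_X ^ (1 + 2 * (card T - 1)) * (\<Prod>t\<in>T. fps_X ^ cl (f t)))"
    by (rule formal_sum_cong) (simp add: power_add power_sum)
  also have "\<dots> = fps_X ^ (1 + 2 * (card T - 1)) *
      (\<Prod>t\<in>T. if t \<noteq> [] \<and> tip T t then sigma - 1 else sigma)"
    using formal_sum_cmult[OF summable_family_PiE[OF assms(1), of "colours T" "\<lambda>_ C. fps_X ^ cl C",
          OF summable_colours], of "fps_X ^ (1 + 2 * (card T - 1))"]
      formal_sum_PiE[OF assms(1), of "colours T" "\<lambda>_ C. fps_X ^ cl C", OF summable_colours]
    by (simp add: formal_sum_colours)
  also have "(\<Prod>t\<in>T. if t \<noteq> [] \<and> tip T t then sigma - 1 else sigma)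
      = sigma * (\<Prod>t\<in>T - {[]}. if tip T t then sigma - 1 else sigma)"
    using assms by (simp add: prod.remove[OF assms])
  also have "fps_X ^ (1 + 2 * (card T - 1)) = fps_X * (\<Prod>t\<in>T - {[]}. fps_X\<^sup>2 :: int fps)"
    using assms by (simp add: power_mult)
  also have "fps_X * (\<Prod>t\<in>T - {[]}. fps_X\<^sup>2) * (sigma * (\<Prod>t\<in>T - {[]}. if tip T t then sigma - 1 else sigma))
      = fps_X * sigma * (\<Prod>t\<in>T - {[]}. fps_X\<^sup>2 * (if tip T t then sigma - 1 else sigma))"
    by (simp add: prod.distrib mult.assoc mult.left_commute)
  also have "(\<Prod>t\<in>T - {[]}. fps_X\<^sup>2 * (if tip T t then sigma - 1 else sigma))
      = tree_weight (fps_X\<^sup>2 * sigma) (fps_X\<^sup>2 * (sigma - 1)) T"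
    unfolding tree_weight_def by (intro prod.cong) auto
  finally show ?thesis .
qed

lemma summable_coloured_trees:
  "summable_family (coloured_trees b) (\<lambda>(T, f). fps_X ^ (1 + 2 * (card T - 1) + (\<Sum>t\<in>T. cl (f t))))"
  unfolding summable_family_def
proof
  fix n
  let ?l = "\<lambda>T f. 1 + 2 * (card T - 1) + (\<Sum>t\<in>T. cl (f t))"
  let ?D = "Sigma {T \<in> trees (X - {b}). card T \<le> Suc n} (\<lambda>T. PiE T (\<lambda>_. \<Union>k\<in>{..n}. {C \<in> Gcl. cl C = k}))"
  have "finite ?D"
  proof (rule finite_SigmaI)
    show "finite {T \<in> trees (X - {b}). card T \<le> Suc n}"
      by (rule finite_rooted_trees_card_le[OF finite_gens])
    show "finite (PiE T (\<lambda>_. \<Union>k\<in>{..n}. {C \<in> Gcl. cl C = k}))"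
      if "T \<in> {T \<in> trees (X - {b}). card T \<le> Suc n}" for T
      using that by (intro finite_PiE finite_UN_I G.finite_classes_of_length[OF Y])
        (auto simp: rooted_trees_def)
  qed
  moreover have "{s \<in> coloured_trees b. fps_nth (case s of (T, f) \<Rightarrow> (fps_X ^ ?l T f :: int fps)) n \<noteq> 0} \<subseteq> ?D"
  proof
    fix s assume "s \<in> {s \<in> coloured_trees b.
      fps_nth (case s of (T, f) \<Rightarrow> (fps_X ^ ?l T f :: int fps)) n \<noteq> 0}"
    then obtain T f where s: "s = (T, f)" and Tf: "(T, f) \<in> coloured_trees b"
      and "fps_nth (fps_X ^ ?l T f :: int fps) n \<noteq> 0"
      by (cases s) (simp only: mem_Collect_eq prod.case, blast)
    hence l: "?l T f = n" by (simp only: fps_X_power_nth split: if_splits)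
    have T: "T \<in> trees (X - {b})" "finite T"
      using coloured_trees_tree[OF Tf] by (auto simp: rooted_trees_def)
    have "f \<in> PiE T (\<lambda>_. \<Union>k\<in>{..n}. {C \<in> Gcl. cl C = k})"
    proof (rule PiE_I)
      fix t assume t: "t \<in> T"
      have "cl (f t) \<le> (\<Sum>t\<in>T. cl (f t))" using T(2) t by (intro member_le_sum) auto
      thus "f t \<in> (\<Union>k\<in>{..n}. {C \<in> Gcl. cl C = k})"
        using coloured_trees_class[OF Tf t] l by auto
    next
      fix t assume "t \<notin> T"
      thus "f t = undefined" using Tf unfolding coloured_trees_def by (auto simp: PiE_iff extensional_def)
    qed
    thus "s \<in> ?D" unfolding s using T(1) l by auto
  qed
  ultimately show "finite {s \<in> coloured_trees b.
      fps_nth (case s of (T, f) \<Rightarrow> (fps_X ^ ?l T f :: int fps)) n \<noteq> 0}"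
    by (rule finite_subset[rotated])
qed

text \<open>
  In the quotient by \<open>b\<close> the trees branch off the root in the directions other than \<open>b\<close>.
\<close>

theorem torsion_cursor_contribution:
  assumes "v \<in> X"
  shows "class_contribution W Z (nontrivial_torsion_cursor_classes G L)
    = of_nat (card invols) * fps_X * sigma *
      fps_subst2 (subtree_series L X v) (fps_X\<^sup>2 * sigma) (fps_X\<^sup>2 * (sigma - 1)) ^ (card X - 1)"
proof -
  let ?p = "fps_X\<^sup>2 * sigma" and ?q = "fps_X\<^sup>2 * (sigma - 1)"
  let ?l = "\<lambda>T f. 1 + 2 * (card T - 1) + (\<Sum>t\<in>T. cl (f t))"
  let ?w = "\<lambda>(T, f). (fps_X ^ ?l T f :: int fps)"
  define F where "F u = formal_sum (trees {u}) (tree_weight ?p ?q)" for u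
  have pq: "fps_X dvd ?p" "fps_X dvd ?q" by (simp_all add: power2_eq_square mult.assoc)
  have Fv: "F u = fps_subst2 (subtree_series L X v) ?p ?q" if "u \<in> X" for u
    unfolding F_def subtree_series_subst[OF assms pq]
    by (rule branch_series_indep[OF finite_gens inv_gens pq that assms])
  have per_b: "formal_sum (coloured_trees b) ?w
      = fps_X * sigma * fps_subst2 (subtree_series L X v) ?p ?q ^ (card X - 1)" if b: "b \<in> X" for b
  proof -
    have "formal_sum (coloured_trees b) ?w
        = formal_sum (trees (X - {b})) (\<lambda>T. formal_sum (PiE T (colours T)) (\<lambda>f. fps_X ^ ?l T f))"
      using formal_sum_Sigma[of "trees (X - {b})" "\<lambda>T. PiE T (colours T)" "\<lambda>T f. fps_X ^ ?l T f"]
        summable_coloured_trees[of b]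
      unfolding coloured_trees_def by simp
    also have "\<dots> = formal_sum (trees (X - {b})) (\<lambda>T. fps_X * sigma * tree_weight ?p ?q T)"
      by (rule formal_sum_cong, rule formal_sum_colourings) (auto simp: rooted_trees_def)
    also have "\<dots> = fps_X * sigma * formal_sum (trees (X - {b})) (tree_weight ?p ?q)"
      by (rule formal_sum_cmult[OF summable_tree_weights[OF finite_gens pq]])
    also have "formal_sum (trees (X - {b})) (tree_weight ?p ?q) = (\<Prod>u\<in>X - {b}. F u)"
      unfolding F_def using finite_gens by (intro formal_sum_branches pq) auto
    also have "\<dots> = (\<Prod>u\<in>X - {b}. fps_subst2 (subtree_series L X v) ?p ?q)"
      by (rule prod.cong) (auto simp: Fv)
    also have "\<dots> = fps_subst2 (subtree_series L X v) ?p ?q ^ (card X - 1)"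
      using b finite_gens by simp
    finally show ?thesis .
  qed
  have "class_contribution W Z (nontrivial_torsion_cursor_classes G L)
      = formal_sum (Sigma invols coloured_trees) (\<lambda>s. fps_X ^ (case s of (b, T, f) \<Rightarrow> ?l T f))"
  proof (rule class_contribution_eq_formal_sum[OF coloured_trees_classes])
    fix s assume "s \<in> Sigma invols coloured_trees"
    then obtain b T f where "s = (b, T, f)" "b \<in> X" "inv b = b" "(T, f) \<in> coloured_trees b" by auto
    thus "class_length W Z (case s of (b, T, f) \<Rightarrow> conj_class W (lit T f, b)) = (case s of (b, T, f) \<Rightarrow> ?l T f)"
      using class_length_lit_le[of T f b] class_length_lit_ge[of T f b] by simp
  qed
  also have "\<dots> = formal_sum (Sigma invols coloured_trees) (\<lambda>(b, s). ?w s)"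
    by (rule formal_sum_cong) auto
  also have "\<dots> = formal_sum invols (\<lambda>b. formal_sum (coloured_trees b) ?w)"
    by (rule formal_sum_Sigma, rule summable_family_Sigma_finite)
      (use finite_gens summable_coloured_trees in auto)
  also have "\<dots> = (\<Sum>b\<in>invols. formal_sum (coloured_trees b) ?w)"
    by (rule formal_sum_finite) (use finite_gens in simp)
  also have "\<dots> = (\<Sum>b\<in>invols. fps_X * sigma * fps_subst2 (subtree_series L X v) ?p ?q ^ (card X - 1))"
    by (rule sum.cong[OF HOL.refl], rule per_b) simp
  finally show ?thesis by (simp add: mult.assoc)
qed

end

section \<open>Groups given by presentations\<close>

lemma word_equiv_words: "(u, w) \<in> word_equiv S R \<Longrightarrow> u \<in> words_over S \<and> w \<in> words_over S"
  by (induction rule: word_equiv.induct) auto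

lemma equiv_word_equiv: "equiv (words_over S) (word_equiv S R)"
proof (rule equivI)
  show "word_equiv S R \<subseteq> words_over S \<times> words_over S"
  proof (rule subrelI)
    fix u w assume "(u, w) \<in> word_equiv S R"
    from word_equiv_words[OF this] show "(u, w) \<in> words_over S \<times> words_over S" by blast
  qed
  show "refl_on (words_over S) (word_equiv S R)"
    by (rule refl_onI) (rule word_equiv.refl)
  show "Relation.sym (word_equiv S R)" by (rule symI) (rule word_equiv.sym)
  show "Relation.trans (word_equiv S R)" by (rule transI) (rule word_equiv.trans)
qed

lemma word_equiv_context:
  assumes "(u, w) \<in> word_equiv S R" "a \<in> words_over S" "b \<in> words_over S"
  shows "(a @ u @ b, a @ w @ b) \<in> word_equiv S R"
  using assms(1)
proof (induction rule: word_equiv.induct)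
  case (refl w)
  thus ?case using assms by (intro word_equiv.refl) auto
next
  case (sym u w)
  show ?case by (rule word_equiv.sym[OF sym.IH])
next
  case (trans u v w)
  show ?case by (rule word_equiv.trans[OF trans.IH])
next
  case (cancel u w s p)
  thus ?case using word_equiv.cancel[of "a @ u" S "w @ b" s p R] assms by simp
next
  case (relator u w r)
  thus ?case using word_equiv.relator[of "a @ u" S "w @ b" r R] assms by simp
qed

lemma word_equiv_append:
  assumes "(u, u') \<in> word_equiv S R" "(w, w') \<in> word_equiv S R"
  shows "(u @ w, u' @ w') \<in> word_equiv S R"
proof -
  have "(u @ w, u' @ w) \<in> word_equiv S R"
    using word_equiv_context[OF assms(1), of "[]" w] word_equiv_words[OF assms(2)] by simp
  moreover have "(u' @ w, u' @ w') \<in> word_equiv S R"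
    using word_equiv_context[OF assms(2), of u' "[]"] word_equiv_words[OF assms(1)] by simp
  ultimately show ?thesis by (rule word_equiv.trans)
qed

abbreviation word_class where "word_class S R w \<equiv> word_equiv S R `` {w}"

lemma word_class_eq_iff:
  "u \<in> words_over S \<Longrightarrow> w \<in> words_over S \<Longrightarrow>
    word_class S R u = word_class S R w \<longleftrightarrow> (u, w) \<in> word_equiv S R"
  using eq_equiv_class_iff[OF equiv_word_equiv] by metis

lemma presented_group_carrier: "carrier (presented_group S R) = word_class S R ` words_over S"
  by (auto simp: presented_group_def quotient_def)

lemma presented_group_one: "\<one>\<^bsub>presented_group S R\<^esub> = word_class S R []"
  by (simp add: presented_group_def)

lemma presented_group_mult:
  assumes "u \<in> words_over S" "w \<in> words_over S"
  shows "word_class S R u \<otimes>\<^bsub>presented_group S R\<^esub> word_class S R w = word_class S R (u @ w)"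
proof -
  have "word_class S R (u' @ w') = word_class S R (u @ w)"
    if "(u, u') \<in> word_equiv S R" "(w, w') \<in> word_equiv S R" for u' w'
  proof -
    have "(u' @ w', u @ w) \<in> word_equiv S R"
      by (rule word_equiv.sym[OF word_equiv_append[OF that]])
    thus ?thesis using equiv_class_eq[OF equiv_word_equiv] by metis
  qed
  moreover have "(u, u) \<in> word_equiv S R" "(w, w) \<in> word_equiv S R"
    using assms by (auto intro: word_equiv.refl)
  ultimately have "(\<Union>u'\<in>word_class S R u. \<Union>w'\<in>word_class S R w. word_class S R (u' @ w'))
      = word_class S R (u @ w)" by blast
  thus ?thesis by (simp add: presented_group_def)
qed

lemma word_equiv_inverse:
  assumes "w \<in> words_over S"
  shows "(rev (map (\<lambda>(p, s). (\<not> p, s)) w) @ w, []) \<in> word_equiv S R"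
  using assms
proof (induction w)
  case Nil
  show ?case by (simp add: word_equiv.refl)
next
  case (Cons l w)
  obtain p s where l: "l = (p, s)" by (cases l)
  let ?v = "rev (map (\<lambda>(p, s). (\<not> p, s)) w)"
  have "?v \<in> words_over S" using Cons.hyps by auto
  hence "(?v @ [(\<not> p, s), (\<not> \<not> p, s)] @ w, ?v @ w) \<in> word_equiv S R"
    using Cons.hyps l by (intro word_equiv.cancel) auto
  from word_equiv.trans[OF this] Cons.IH show ?case using l by simp
qed

lemma group_presented_group: "group (presented_group S R)"
proof -
  let ?P = "presented_group S R"
  show ?thesis
proof (rule groupI)
  fix x y assume "x \<in> carrier ?P" "y \<in> carrier ?P"
  then obtain u v where *: "u \<in> words_over S" "v \<in> words_over S"
    "x = word_class S R u" "y = word_class S R v"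
    unfolding presented_group_carrier by blast
  hence "u @ v \<in> words_over S" by auto
  thus "x \<otimes>\<^bsub>?P\<^esub> y \<in> carrier ?P"
    using presented_group_mult[OF *(1,2)] *(3,4) unfolding presented_group_carrier by auto
next
  show "\<one>\<^bsub>?P\<^esub> \<in> carrier ?P"
    by (simp add: presented_group_carrier presented_group_one)
next
  fix x y z assume "x \<in> carrier ?P" "y \<in> carrier ?P"
    "z \<in> carrier ?P"
  then obtain u v w where *: "u \<in> words_over S" "v \<in> words_over S" "w \<in> words_over S"
    "x = word_class S R u" "y = word_class S R v" "z = word_class S R w"
    unfolding presented_group_carrier by auto
  have "u @ v \<in> words_over S" "v @ w \<in> words_over S" using * by auto
  thus "x \<otimes>\<^bsub>?P\<^esub> y \<otimes>\<^bsub>?P\<^esub> z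
      = x \<otimes>\<^bsub>?P\<^esub> (y \<otimes>\<^bsub>?P\<^esub> z)"
    using * by (simp add: presented_group_mult)
next
  fix x assume "x \<in> carrier ?P"
  then obtain w where *: "w \<in> words_over S" "x = word_class S R w"
    unfolding presented_group_carrier by auto
  show "\<one>\<^bsub>?P\<^esub> \<otimes>\<^bsub>?P\<^esub> x = x"
    using * presented_group_mult[of "[]" S w R] by (simp add: presented_group_one)
  let ?v = "rev (map (\<lambda>(p, s). (\<not> p, s)) w)"
  have v: "?v \<in> words_over S" using * by auto
  have "word_class S R (?v @ w) = word_class S R []"
    using word_equiv_inverse[OF *(1), of R] equiv_class_eq[OF equiv_word_equiv] by metis
  hence "word_class S R ?v \<otimes>\<^bsub>?P\<^esub> x = \<one>\<^bsub>?P\<^esub>"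
    using presented_group_mult[OF v *(1)] * by (simp add: presented_group_one)
  thus "\<exists>y\<in>carrier ?P. y \<otimes>\<^bsub>?P\<^esub> x = \<one>\<^bsub>?P\<^esub>"
    using v unfolding presented_group_carrier by blast
qed
qed

section \<open>Normal forms in the free product\<close>

text \<open>
  The letter \<open>b\<^sub>j\<close> and its formal inverse name the same element of the group; the positive letter
  represents both.
\<close>

fun std_letter :: "bool \<times> (nat + nat) \<Rightarrow> bool \<times> (nat + nat)" where
  "std_letter (p, Inl i) = (p, Inl i)"
| "std_letter (p, Inr j) = (True, Inr j)"

fun letter_inv :: "bool \<times> (nat + nat) \<Rightarrow> bool \<times> (nat + nat)" where
  "letter_inv (p, Inl i) = (\<not> p, Inl i)"
| "letter_inv (p, Inr j) = (True, Inr j)"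

definition std_letters :: "nat \<Rightarrow> nat \<Rightarrow> (bool \<times> (nat + nat)) set" where
  "std_letters M N = {l \<in> UNIV \<times> L_letters M N. std_letter l = l}"

text \<open>
  The effect on normal forms of left multiplication by a letter.
\<close>

definition act :: "bool \<times> (nat + nat) \<Rightarrow> (nat + nat) word \<Rightarrow> (nat + nat) word" where
  "act l w = (if w \<noteq> [] \<and> hd w = letter_inv (std_letter l) then tl w else std_letter l # w)"

lemma std_letter_in: "l \<in> UNIV \<times> L_letters M N \<Longrightarrow> std_letter l \<in> std_letters M N"
  by (cases l rule: std_letter.cases) (auto simp: std_letters_def)

lemma std_letter_id: "l \<in> std_letters M N \<Longrightarrow> std_letter l = l"
  by (simp add: std_letters_def)

lemma letter_inv_in: "l \<in> std_letters M N \<Longrightarrow> letter_inv l \<in> std_letters M N"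
  by (cases l rule: letter_inv.cases) (auto simp: std_letters_def)

lemma letter_inv_inv: "l \<in> std_letters M N \<Longrightarrow> letter_inv (letter_inv l) = l"
  by (cases l rule: letter_inv.cases) (auto simp: std_letters_def)

lemma std_letter_flip: "std_letter (\<not> p, s) = letter_inv (std_letter (p, s))"
  by (cases s) auto

lemma act_reduced:
  assumes "l \<in> UNIV \<times> L_letters M N" "w \<in> reduced_words letter_inv (std_letters M N)"
  shows "act l w \<in> reduced_words letter_inv (std_letters M N)"
  using assms(2) std_letter_in[OF assms(1)] unfolding act_def reduced_words_def
  by (cases w) (auto simp: successively_Cons)

lemma act_cancel:
  assumes "l \<in> UNIV \<times> L_letters M N" "l' \<in> UNIV \<times> L_letters M N"
    "std_letter l' = letter_inv (std_letter l)" "w \<in> reduced_words letter_inv (std_letters M N)"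
  shows "act l (act l' w) = w"
proof -
  have c: "letter_inv (letter_inv (std_letter l)) = std_letter l"
    using letter_inv_inv[OF std_letter_in[OF assms(1)]] .
  show ?thesis
  proof (cases w)
    case (Cons a t)
    have "t \<noteq> [] \<Longrightarrow> hd t \<noteq> letter_inv a"
      using assms(4) Cons unfolding reduced_words_def by (auto simp: successively_Cons)
    thus ?thesis using Cons assms(3) c by (auto simp: act_def)
  qed (simp add: act_def assms(3) c)
qed

lemma foldr_act_reduced:
  "u \<in> words_over (L_letters M N) \<Longrightarrow> w \<in> reduced_words letter_inv (std_letters M N) \<Longrightarrow>
    foldr act u w \<in> reduced_words letter_inv (std_letters M N)"
  by (induction u) (auto intro: act_reduced)

text \<open>Letting words act on reduced words shows that equivalent words have the same normal form.\<close>

lemma foldr_act_equiv: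
  assumes "(u, u') \<in> word_equiv (L_letters M N) (L_relators N)"
    and "w \<in> reduced_words letter_inv (std_letters M N)"
  shows "foldr act u w = foldr act u' w"
  using assms
proof (induction arbitrary: w rule: word_equiv.induct)
  case (cancel u v s p)
  have "act (p, s) (act (\<not> p, s) (foldr act v w)) = foldr act v w"
    using cancel foldr_act_reduced[of v M N w] by (intro act_cancel[of _ M N]) (auto simp: std_letter_flip)
  thus ?case by simp
next
  case (relator u v r)
  then obtain j where r: "r = [(True, Inr j), (True, Inr j)]" "j < N" by (auto simp: L_relators_def)
  have "act (True, Inr j) (act (True, Inr j) (foldr act v w)) = foldr act v w"
    using relator r foldr_act_reduced[of v M N w]
    by (intro act_cancel[of _ M N]) (auto simp: L_letters_def)
  thus ?case using r by simp
qed auto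

lemma foldr_act_Nil:
  "w \<in> reduced_words letter_inv (std_letters M N) \<Longrightarrow> foldr act w [] = w"
proof (induction w)
  case (Cons a w)
  hence "w \<in> reduced_words letter_inv (std_letters M N)" "a \<in> std_letters M N"
    "w \<noteq> [] \<Longrightarrow> hd w \<noteq> letter_inv a"
    unfolding reduced_words_def by (auto simp: successively_Cons)
  thus ?case using Cons.IH by (auto simp: act_def std_letter_id)
qed simp

context
  fixes M N :: nat
begin

private abbreviation (input) S where "S \<equiv> L_letters M N"
private abbreviation (input) eqv where "eqv \<equiv> word_equiv (L_letters M N) (L_relators N)"
private abbreviation (input) L where "L \<equiv> L_group M N"
private abbreviation (input) A where "A \<equiv> std_letters M N"
private abbreviation (input) RW where "RW \<equiv> reduced_words letter_inv (std_letters M N)"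
private abbreviation (input) wc where "wc \<equiv> word_class (L_letters M N) (L_relators N)"
private abbreviation (input) \<phi> where "\<phi> l \<equiv> wc [l]"

lemma std_letters_subset: "A \<subseteq> UNIV \<times> S"
  by (auto simp: std_letters_def)

lemma RW_words: "w \<in> RW \<Longrightarrow> w \<in> words_over S"
  unfolding reduced_words_def using std_letters_subset by auto

lemma std_letters_eq:
  "A = (\<lambda>(p, i). (p, Inl i)) ` (UNIV \<times> {..<M}) \<union> (\<lambda>j. (True, Inr j)) ` {..<N}"
  unfolding std_letters_def L_letters_def
  by (auto simp: image_iff elim!: std_letter.elims)

lemma letter_inv_equiv:
  assumes "l \<in> A"
  shows "([letter_inv l, l], []) \<in> eqv"
proof (cases l rule: letter_inv.cases)
  case (1 p i)
  have "([] @ [(\<not> p, Inl i), (\<not> \<not> p, Inl i)] @ [], [] @ []) \<in> eqv"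
    using assms 1 by (intro word_equiv.cancel) (auto simp: std_letters_def)
  thus ?thesis using 1 by simp
next
  case (2 p j)
  hence "p" "j < N" using assms by (auto simp: std_letters_def L_letters_def)
  have "([] @ [(True, Inr j), (True, Inr j)] @ [], [] @ []) \<in> eqv"
    using \<open>j < N\<close> by (intro word_equiv.relator) (auto simp: L_relators_def L_letters_def)
  thus ?thesis using 2 \<open>p\<close> by simp
qed

lemma std_letter_equiv:
  assumes "l \<in> UNIV \<times> S"
  shows "([l], [std_letter l]) \<in> eqv"
proof (cases l rule: std_letter.cases)
  case (1 p i)
  thus ?thesis using assms by (auto intro: word_equiv.refl)
next
  case (2 p j)
  let ?t = "(True, Inr j :: nat + nat)"
  have t: "?t \<in> A" using std_letter_in[OF assms] 2 by simp
  show ?thesis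
  proof (cases p)
    case True
    thus ?thesis using 2 assms by (auto intro: word_equiv.refl)
  next
    case False
    have tt: "([?t, ?t], []) \<in> eqv" using letter_inv_equiv[OF t] by simp
    have "([l] @ [?t, ?t] @ [], [l] @ [] @ []) \<in> eqv"
      by (rule word_equiv_context[OF tt]) (use assms in auto)
    moreover have "([] @ [(False, Inr j), (\<not> False, Inr j)] @ [?t], [] @ [?t]) \<in> eqv"
      using assms 2 t std_letters_subset by (intro word_equiv.cancel) auto
    ultimately show ?thesis using 2 False by (auto intro: word_equiv.trans word_equiv.sym)
  qed
qed

lemma act_equiv:
  assumes "l \<in> UNIV \<times> S" "w \<in> RW"
  shows "(l # w, act l w) \<in> eqv"
proof -
  let ?c = "std_letter l"
  have c: "?c \<in> A" by (rule std_letter_in[OF assms(1)])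
  have w: "w \<in> words_over S" by (rule RW_words[OF assms(2)])
  have "([l] @ w, [?c] @ w) \<in> eqv"
    using word_equiv_append[OF std_letter_equiv[OF assms(1)] word_equiv.refl[OF w]] .
  moreover have "(?c # w, act l w) \<in> eqv"
  proof (cases "w \<noteq> [] \<and> hd w = letter_inv ?c")
    case True
    then obtain t where t: "w = letter_inv ?c # t" by (cases w) auto
    have "([letter_inv (letter_inv ?c), letter_inv ?c], []) \<in> eqv"
      by (rule letter_inv_equiv[OF letter_inv_in[OF c]])
    hence "([?c, letter_inv ?c], []) \<in> eqv" using letter_inv_inv[OF c] by simp
    from word_equiv_append[OF this word_equiv.refl[of t S]] show ?thesis using True t w by (simp add: act_def)
  next
    case False
    have "?c # w \<in> words_over S" using c w std_letters_subset by auto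
    hence "(?c # w, ?c # w) \<in> eqv" by (rule word_equiv.refl)
    moreover have "act l w = ?c # w" using False by (auto simp: act_def)
    ultimately show ?thesis by simp
  qed
  ultimately show ?thesis by (simp add: word_equiv.trans[of "l # w"])
qed

lemma normal_form_equiv:
  assumes "u \<in> words_over S"
  shows "(u, foldr act u []) \<in> eqv"
  using assms
proof (induction u)
  case (Cons l u)
  have r: "foldr act u [] \<in> RW"
    by (rule foldr_act_reduced) (use Cons.hyps in \<open>auto simp: reduced_words_def\<close>)
  have "[l] \<in> words_over S" using Cons.hyps by auto
  from word_equiv_append[OF word_equiv.refl[OF this] Cons.IH]
  have "(l # u, l # foldr act u []) \<in> eqv" by simp
  also have "(l # foldr act u [], act l (foldr act u [])) \<in> eqv"
    by (rule act_equiv[OF _ r]) (use Cons.hyps in auto)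
  finally (word_equiv.trans) show ?case by simp
qed (simp add: word_equiv.refl)

lemma group_L_group: "group L"
  unfolding L_group_def by (rule group_presented_group)

lemma reduced_word_class_inject:
  assumes "u \<in> RW" "w \<in> RW"
  shows "wc u = wc w \<longleftrightarrow> u = w"
proof
  assume "wc u = wc w"
  hence "(u, w) \<in> eqv" using word_class_eq_iff RW_words assms by metis
  hence "foldr act u [] = foldr act w []"
    by (rule foldr_act_equiv) (simp add: reduced_words_def)
  thus "u = w" using foldr_act_Nil assms by simp
qed simp

lemma letter_class_inject: "l \<in> A \<Longrightarrow> l' \<in> A \<Longrightarrow> \<phi> l = \<phi> l' \<longleftrightarrow> l = l'"
  using reduced_word_class_inject[of "[l]" "[l']"] by (simp add: reduced_words_def)

lemma letter_class_carrier: "l \<in> A \<Longrightarrow> \<phi> l \<in> carrier L"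
  unfolding L_group_def presented_group_carrier using std_letters_subset by auto

lemma inv_letter_class:
  assumes "l \<in> A"
  shows "inv\<^bsub>L\<^esub> (\<phi> l) = \<phi> (letter_inv l)"
proof -
  interpret group L by (rule group_L_group)
  have w: "[l] \<in> words_over S" "[letter_inv l] \<in> words_over S"
    using assms letter_inv_in[OF assms] std_letters_subset by auto
  have "\<phi> (letter_inv l) \<otimes>\<^bsub>L\<^esub> \<phi> l = wc [letter_inv l, l]"
    unfolding L_group_def presented_group_mult[OF w(2,1)] by simp
  also have "\<dots> = \<one>\<^bsub>L\<^esub>"
    unfolding L_group_def presented_group_one
    by (rule equiv_class_eq[OF equiv_word_equiv letter_inv_equiv[OF assms]])
  finally show ?thesis
    using inv_equality letter_class_carrier assms letter_inv_in by blast
qed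

lemma L_gens_eq: "L_gens M N = \<phi> ` A"
proof -
  have g: "generator (L_letters M N) (L_relators N) s = \<phi> (True, s)" for s
    by (simp add: generator_def)
  have i: "inv\<^bsub>L_group M N\<^esub> (\<phi> (True, Inl i)) = \<phi> (False, Inl i)" if "i < M" for i
  proof -
    have "(True, Inl i) \<in> A" using that by (auto simp: std_letters_def L_letters_def)
    from inv_letter_class[OF this] show ?thesis by simp
  qed
  have "\<phi> ` A = {\<phi> (True, Inl i) | i. i < M} \<union> {\<phi> (False, Inl i) | i. i < M} \<union> {\<phi> (True, Inr j) | j. j < N}"
  proof -
    have "A = {(True, Inl i) | i. i < M} \<union> {(False, Inl i) | i. i < M} \<union> {(True, Inr j) | j. j < N}"
      unfolding std_letters_eq by (auto simp: image_iff)
    thus ?thesis by (simp only: image_Un setcompr_eq_image image_image)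
  qed
  also have "{\<phi> (False, Inl i) | i. i < M} = {inv\<^bsub>L_group M N\<^esub> (\<phi> (True, Inl i)) | i. i < M}"
    using i by (intro Collect_cong) metis
  finally show ?thesis unfolding L_gens_def Let_def g by simp
qed

lemma mult_letter_classes:
  assumes "cs \<in> lists A"
  shows "foldr (\<otimes>\<^bsub>L\<^esub>) (map \<phi> cs) \<one>\<^bsub>L\<^esub> = wc cs"
  using assms
proof (induction cs)
  case (Cons c cs)
  have w: "[c] \<in> words_over S" "cs \<in> words_over S" using Cons.hyps std_letters_subset by auto
  show ?case using Cons.IH presented_group_mult[OF w, of "L_relators N"] by (simp add: L_group_def)
qed (simp add: L_group_def presented_group_one)

lemma reduced_words_gens: "reduced_words (m_inv L) (L_gens M N) = map \<phi> ` RW"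
proof -
  have red: "successively (\<lambda>x y. y \<noteq> inv\<^bsub>L\<^esub> x) (map \<phi> cs) \<longleftrightarrow> successively (\<lambda>x y. y \<noteq> letter_inv x) cs"
    if "cs \<in> lists A" for cs
    unfolding successively_map
  proof (rule successively_cong[OF _ HOL.refl])
    fix x y assume "x \<in> set cs" "y \<in> set cs"
    hence "x \<in> A" "y \<in> A" using that by auto
    thus "\<phi> y \<noteq> inv\<^bsub>L\<^esub> (\<phi> x) \<longleftrightarrow> y \<noteq> letter_inv x"
      using letter_class_inject[OF \<open>y \<in> A\<close> letter_inv_in[OF \<open>x \<in> A\<close>]] inv_letter_class[OF \<open>x \<in> A\<close>]
      by (simp only:)
  qed
  have "{w \<in> lists (\<phi> ` A). successively (\<lambda>x y. y \<noteq> inv\<^bsub>L\<^esub> x) w}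
      = map \<phi> ` {cs \<in> lists A. successively (\<lambda>x y. y \<noteq> inv\<^bsub>L\<^esub> x) (map \<phi> cs)}"
    unfolding lists_image by auto
  also have "{cs \<in> lists A. successively (\<lambda>x y. y \<noteq> inv\<^bsub>L\<^esub> x) (map \<phi> cs)} = RW"
    unfolding reduced_words_def using red by blast
  finally show ?thesis unfolding reduced_words_def[of "m_inv L"] L_gens_eq .
qed

lemma tree_group_L_group: "tree_group L (L_gens M N)"
proof -
  interpret group L by (rule group_L_group)
  show ?thesis
  proof
    show "finite (L_gens M N)" unfolding L_gens_eq std_letters_eq by simp
    show "L_gens M N \<subseteq> carrier L" unfolding L_gens_eq using letter_class_carrier by auto
    show "inv\<^bsub>L\<^esub> x \<in> L_gens M N" if "x \<in> L_gens M N" for x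
      using that inv_letter_class letter_inv_in unfolding L_gens_eq by auto
    have prod: "foldr (\<otimes>\<^bsub>L\<^esub>) (map \<phi> cs) \<one>\<^bsub>L\<^esub> = wc cs" if "cs \<in> RW" for cs
      by (rule mult_letter_classes) (use that in \<open>simp add: reduced_words_def\<close>)
    show "\<exists>w\<in>reduced_words (m_inv L) (L_gens M N). foldr (\<otimes>\<^bsub>L\<^esub>) w \<one>\<^bsub>L\<^esub> = g"
      if g: "g \<in> carrier L" for g
    proof -
      obtain u where u: "u \<in> words_over S" "g = wc u"
        using g unfolding L_group_def presented_group_carrier by blast
      let ?w = "foldr act u []"
      have w: "?w \<in> RW" by (rule foldr_act_reduced[OF u(1)]) (simp add: reduced_words_def)
      have "g = wc ?w"
        unfolding u(2) by (rule equiv_class_eq[OF equiv_word_equiv normal_form_equiv[OF u(1)]])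
      hence "foldr (\<otimes>\<^bsub>L\<^esub>) (map \<phi> ?w) \<one>\<^bsub>L\<^esub> = g" using prod[OF w] by (simp only:)
      moreover have "map \<phi> ?w \<in> reduced_words (m_inv L) (L_gens M N)"
        unfolding reduced_words_gens by (rule imageI[OF w])
      ultimately show ?thesis by (rule bexI)
    qed
    show "inj_on (\<lambda>w. foldr (\<otimes>\<^bsub>L\<^esub>) w \<one>\<^bsub>L\<^esub>) (reduced_words (m_inv L) (L_gens M N))"
    proof (rule inj_onI)
      fix x y assume *: "x \<in> reduced_words (m_inv L) (L_gens M N)" "y \<in> reduced_words (m_inv L) (L_gens M N)"
        "foldr (\<otimes>\<^bsub>L\<^esub>) x \<one>\<^bsub>L\<^esub> = foldr (\<otimes>\<^bsub>L\<^esub>) y \<one>\<^bsub>L\<^esub>"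
      obtain cs ds where c: "cs \<in> RW" "x = map \<phi> cs" "ds \<in> RW" "y = map \<phi> ds"
        using *(1,2) unfolding reduced_words_gens by blast
      hence "wc cs = wc ds" using *(3) prod by simp
      thus "x = y" using reduced_word_class_inject c by simp
    qed
  qed
qed

lemma card_L_gens: "card (L_gens M N) = 2 * M + N"
proof -
  have "card (L_gens M N) = card A"
    unfolding L_gens_eq by (rule card_image) (simp add: inj_on_def letter_class_inject)
  also have "\<dots> = card ((\<lambda>(p :: bool, i). (p, Inl i :: nat + nat)) ` (UNIV \<times> {..<M})) + card ((\<lambda>j. (True, Inr j :: nat + nat)) ` {..<N})"
    unfolding std_letters_eq by (rule card_Un_disjoint) auto
  also have "\<dots> = card ((UNIV :: bool set) \<times> {..<M}) + card {..<N}"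
    by (intro arg_cong2[where f = "(+)"] card_image) (auto simp: inj_on_def)
  finally show ?thesis by simp
qed

lemma card_L_involutions: "card {b \<in> L_gens M N. inv\<^bsub>L\<^esub> b = b} = N"
proof -
  have "{b \<in> L_gens M N. inv\<^bsub>L\<^esub> b = b} = \<phi> ` {l \<in> A. letter_inv l = l}"
  proof -
    have "inv\<^bsub>L\<^esub> (\<phi> l) = \<phi> l \<longleftrightarrow> letter_inv l = l" if "l \<in> A" for l
      unfolding inv_letter_class[OF that] by (rule letter_class_inject[OF letter_inv_in[OF that] that])
    thus ?thesis unfolding L_gens_eq by blast
  qed
  also have "{l \<in> A. letter_inv l = l} = (\<lambda>j. (True, Inr j)) ` {..<N}"
    by (auto simp: std_letters_eq)
  finally have "{b \<in> L_gens M N. inv\<^bsub>L\<^esub> b = b} = (\<lambda>j. \<phi> (True, Inr j)) ` {..<N}"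
    by (simp add: image_image)
  moreover have "inj_on (\<lambda>j. \<phi> (True, Inr j)) {..<N}"
    by (rule inj_onI) (use letter_class_inject in \<open>auto simp: std_letters_eq\<close>)
  ultimately show ?thesis by (simp add: card_image)
qed

end

theorem proposition4p5:
  fixes G :: "('g, 'c) monoid_scheme" and Y :: "'g set"
    and M N :: nat and v :: "(nat + nat) word set"
  assumes "2 * M + N \<ge> 2"
    and "group G"
    and "finite_symmetric_generating_set G Y"
    and "v \<in> L_gens M N"
  shows "class_contribution (wreath_product G (L_group M N))
           (wreath_gens G (L_group M N) (L_gens M N) Y)
           (nontrivial_torsion_cursor_classes G (L_group M N)) =
         of_nat N * fps_X * conj_growth_series G Y *
         fps_subst2 (subtree_series (L_group M N) (L_gens M N) v)
           (fps_X\<^sup>2 * conj_growth_series G Y)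
           (fps_X\<^sup>2 * (conj_growth_series G Y - 1)) ^ (2 * M + N - 1)"
proof -
  interpret tree_group "L_group M N" "L_gens M N" by (rule tree_group_L_group)
  interpret G: group G by (rule assms(2))
  interpret lamplighter "L_group M N" "L_gens M N" G Y
    by unfold_locales (rule assms(3))
  show ?thesis
    using torsion_cursor_contribution[OF assms(4)] unfolding card_L_gens card_L_involutions .
qed

end
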